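(* Fix $0<p<1$ and let $b=1/(1-p)$. There exists a function $\kappa_p=\kappa_p(\tau)$ that is continuous and strictly increasing for $\tau\in[0,\infty)$, with $\kappa_p(0)=2/\ln b$ and $\kappa_p(\tau)\sim\tau/p$ as $\tau\to\infty$, such that the following holds: if $t=t(n)$ is a non-negative integer sequence with $t(n)=o(n)$, then asymptotically almost surely \[ \chi^t(G_{n,p})\sim \frac{n}{\kappa_p(t/\ln n)\,\ln n}. \] Furthermore, if $t(n)\sim np/x$, where $x>0$ is fixed and not an integer, then $\chi^t(G_{n,p})=\lceil x\rceil$ asymptotically almost surely.
   Context: $G_{n,p}$ denotes the Erdős–Rényi random graph on vertex set $\{1,\dots,n\}$ in which each pair is an edge independently with probability $p$. "Asymptotically almost surely" (a.a.s.) means with probability tending to $1$ as $n\to\infty$. For a non-negative integer $t$, a vertex set of a graph is $t$-dependent if the subgraph it induces has maximum degree at most $t$. The $t$-improper chromatic number $\chi^t(G)$ is the smallest number of colours in a colouring of the vertices of $G$ in which every colour class is a $t$-dependent set. $a(n)\sim b(n)$ means $a(n)/b(n)\to1$. *)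

theory Defs
  imports "HOL-Probability.Probability" "HOL-Probability.Product_PMF"
    "HOL-Library.Landau_Symbols" "HOL-Library.Ramsey"
begin

text \<open>
  A simple graph on a vertex set \<open>V\<close> is given by its edge set, a set of two-element subsets of \<open>V\<close>.
  The random graph is thus a distribution on edge sets over the vertex set \<open>{1..n}\<close>.
\<close>

definition gnp :: "nat \<Rightarrow> real \<Rightarrow> nat set set pmf" where
  "gnp n p =
     map_pmf (\<lambda>X. {e \<in> nsets {1..n} 2. X e})
       (Pi_pmf (nsets {1..n} 2) False (\<lambda>_. bernoulli_pmf p))"

definition aas :: "real \<Rightarrow> (nat \<Rightarrow> nat set set \<Rightarrow> bool) \<Rightarrow> bool" where
  "aas p P \<longleftrightarrow> (\<lambda>n. measure_pmf.prob (gnp n p) {E. P n E}) \<longlonglongrightarrow> 1"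

text \<open>
  ``Asymptotically almost surely \<open>X n \<sim> a n\<close>'' for a random variable \<open>X n\<close> and a deterministic
  sequence \<open>a\<close>: the ratio tends to \<open>1\<close> in probability.
\<close>

definition aas_asymp_equiv ::
    "real \<Rightarrow> (nat \<Rightarrow> nat set set \<Rightarrow> real) \<Rightarrow> (nat \<Rightarrow> real) \<Rightarrow> bool" where
  "aas_asymp_equiv p X a \<longleftrightarrow> (\<forall>\<epsilon>>0. aas p (\<lambda>n E. \<bar>X n E / a n - 1\<bar> < \<epsilon>))"

definition induced_edges :: "'a set set \<Rightarrow> 'a set \<Rightarrow> 'a set set" where
  "induced_edges E S = {e \<in> E. e \<subseteq> S}"

definition vertex_degree :: "'a set set \<Rightarrow> 'a \<Rightarrow> nat" where
  "vertex_degree E v = card {e \<in> E. v \<in> e}"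

definition dependent_set :: "nat \<Rightarrow> 'a set set \<Rightarrow> 'a set \<Rightarrow> bool" where
  "dependent_set t E S \<longleftrightarrow> (\<forall>v\<in>S. vertex_degree (induced_edges E S) v \<le> t)"

definition improper_colouring ::
    "nat \<Rightarrow> 'a set \<Rightarrow> 'a set set \<Rightarrow> nat \<Rightarrow> ('a \<Rightarrow> nat) \<Rightarrow> bool" where
  "improper_colouring t V E k c \<longleftrightarrow>
     c ` V \<subseteq> {..<k} \<and> (\<forall>i<k. dependent_set t E {v \<in> V. c v = i})"

definition improper_chromatic_number :: "nat \<Rightarrow> 'a set \<Rightarrow> 'a set set \<Rightarrow> nat" where
  "improper_chromatic_number t V E = (LEAST k. \<exists>c. improper_colouring t V E k c)"

end

theory Submission
  imports Defs "HOL-Probability.Hoeffding" "HOL-Real_Asymp.Real_Asymp"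
begin

text \<open>
  Write \<open>\<phi> s = - ln (1 - p + p * exp (- s))\<close> and let \<open>\<kappa> \<tau>\<close> be the infimum of \<open>(2 + s * \<tau>) / \<phi> s\<close>
  over \<open>s > 0\<close>. Applying Markov's inequality to the exponential of the degree sum, a \<open>k\<close>-set is
  \<open>t\<close>-dependent with probability at most \<open>exp (k / 2 * (s * t - (k - 1) * \<phi> s))\<close> for every
  \<open>s \<ge> 0\<close>. The expected number of dependent \<open>k\<close>-sets is therefore small once \<open>k\<close> exceeds
  \<open>\<kappa> (t / ln n) * ln n\<close>, which bounds the chromatic number from below.

  For the upper bound with \<open>t = O(ln n)\<close>, tilting the edge probability shows that the moment bound
  is sharp up to a factor \<open>exp (o(k\<^sup>2))\<close>. For \<open>k\<close> slightly below the threshold, two \<open>k\<close>-sets meeting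
  in \<open>l\<close> vertices are simultaneously dependent with probability at most the product of the two
  probabilities times the smaller of \<open>b ^ (l choose 2)\<close> and \<open>exp (l * (1 - \<epsilon>) * ln n + o(k\<^sup>2))\<close>.
  Janson's inequality for the decreasing events ``\<open>A\<close> is dependent'' then shows that a given set of
  \<open>n powr (1 - \<epsilon> / 8)\<close> vertices contains no dependent \<open>k\<close>-set with probability at most
  \<open>exp (- (n powr (3 / 2)) / 4)\<close>, which survives a union bound over all such vertex sets; hence colour
  classes of size \<open>k\<close> can be removed greedily. If \<open>t\<close> is at least a large multiple of \<open>ln n\<close>, the
  residue classes modulo a suitable number already form a colouring, by Hoeffding's inequality.
\<close>

section \<open>Correlation inequalities for independent coins\<close>

text \<open>The greedy step is exposed to as many as 2^n vertex sets, so the failure probability of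
  one set must be exp(-\<mu> + \<Delta>) with \<mu> of larger order than n. Taking the full expected
  number as \<mu> would be useless: \<Delta> is quadratic in the weights of the events and would
  overtake it. The weights are therefore scaled down until \<mu> = n^(3/2)/2. The exponent 3/2 sits
  between 1, the order demanded by the union bound, and 2, the order at which pairs of sets meeting
  in just two vertices make \<Delta> comparable to \<mu>. The lower bound for the probability of
  dependence has an error \<eta> k^2 in the exponent, which is harmless when it is small against k
  ln n, that is, when k / ln n and hence t / ln n stay bounded. This forces the split at t = C ln n.
  The constant C depends on p and the desired accuracy alone, so every single n falls under one of
  the two cases and t / ln n may oscillate freely.\<close>

definition coins :: "'e set \<Rightarrow> real \<Rightarrow> ('e \<Rightarrow> bool) pmf" where
  "coins D p = Pi_pmf D False (\<lambda>_. bernoulli_pmf p)"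

definition determined_by :: "'e set \<Rightarrow> (('e \<Rightarrow> bool) \<Rightarrow> 'a) \<Rightarrow> bool" where
  "determined_by D f \<longleftrightarrow> (\<forall>X Y. (\<forall>e\<in>D. X e = Y e) \<longrightarrow> f X = f Y)"

lemma determined_byD: "determined_by D f \<Longrightarrow> (\<And>e. e \<in> D \<Longrightarrow> X e = Y e) \<Longrightarrow> f X = f Y"
  by (auto simp: determined_by_def)

lemma finite_set_coins: "finite D \<Longrightarrow> finite (set_pmf (coins D p))"
  unfolding coins_def
  by (rule finite_subset[OF set_Pi_pmf_subset']) auto

lemma integrable_coins [simp, intro]:
  fixes f :: "_ \<Rightarrow> real"
  shows "finite D \<Longrightarrow> integrable (measure_pmf (coins D p)) f"
  by (intro integrable_measure_pmf_finite finite_set_coins)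

lemma expectation_coins_insert:
  fixes f :: "_ \<Rightarrow> real"
  assumes "finite D" "e \<notin> D" "0 \<le> p" "p \<le> 1"
  shows "measure_pmf.expectation (coins (insert e D) p) f =
     p * measure_pmf.expectation (coins D p) (\<lambda>X. f (X(e := True))) +
     (1 - p) * measure_pmf.expectation (coins D p) (\<lambda>X. f (X(e := False)))"
proof -
  have eq: "coins (insert e D) p =
      bernoulli_pmf p \<bind> (\<lambda>b. map_pmf (\<lambda>X. X(e := b)) (coins D p))"
    unfolding coins_def using assms by (subst Pi_pmf_insert') (auto simp: map_pmf_def)
  show ?thesis
    unfolding eq using assms
    by (subst pmf_expectation_bind[where A = UNIV])
       (auto simp: UNIV_bool finite_set_coins)
qed

text \<open>The covariance created by one coin is p (1 - p) times the product of the two increments;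
  induction handles the other coins. X and Y range separately because the increments of
  \<open>f\<close> and of \<open>g\<close> are averaged separately. A condition on products of
  increments covers both monotone pairs and functions of disjoint coins.\<close>

lemma coins_correlation:
  fixes f g :: "('e \<Rightarrow> bool) \<Rightarrow> real"
  assumes "finite D" "0 \<le> p" "p \<le> 1"
    and "\<And>e X Y. e \<in> D \<Longrightarrow>
      (f (X(e := True)) - f (X(e := False))) * (g (Y(e := True)) - g (Y(e := False))) \<le> 0"
  shows "measure_pmf.expectation (coins D p) (\<lambda>X. f X * g X) \<le>
    measure_pmf.expectation (coins D p) f * measure_pmf.expectation (coins D p) g"
  using assms(1,4)
proof (induction D arbitrary: f g rule: finite_induct)
  case empty
  show ?case by (simp add: coins_def)
next
  case (insert e D)
  let ?E = "measure_pmf.expectation (coins D p)"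
  define f1 f0 g1 g0 where d: "f1 = (\<lambda>X. f (X(e := True)))" "f0 = (\<lambda>X. f (X(e := False)))"
    "g1 = (\<lambda>X. g (X(e := True)))" "g0 = (\<lambda>X. g (X(e := False)))"
  have "(f1 (X(a := True)) - f1 (X(a := False))) * (g1 (Y(a := True)) - g1 (Y(a := False))) \<le> 0"
    if "a \<in> D" for a X Y
  proof -
    have "a \<noteq> e" using that insert.hyps by auto
    thus ?thesis
      unfolding d fun_upd_twist[OF \<open>a \<noteq> e\<close>]
      by (intro insert.prems insertI2 that)
  qed
  from insert.IH[OF this] have 1: "?E (\<lambda>X. f1 X * g1 X) \<le> ?E f1 * ?E g1" .
  have "(f0 (X(a := True)) - f0 (X(a := False))) * (g0 (Y(a := True)) - g0 (Y(a := False))) \<le> 0"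
    if "a \<in> D" for a X Y
  proof -
    have "a \<noteq> e" using that insert.hyps by auto
    thus ?thesis
      unfolding d fun_upd_twist[OF \<open>a \<noteq> e\<close>]
      by (intro insert.prems insertI2 that)
  qed
  from insert.IH[OF this] have 0: "?E (\<lambda>X. f0 X * g0 X) \<le> ?E f0 * ?E g0" .
  \<comment> \<open>The sign condition survives averaging: integrate over Y with X fixed, then over
    X.\<close>
  have neg: "(?E f1 - ?E f0) * (?E g1 - ?E g0) \<le> 0"
  proof -
    have pt: "(f1 X - f0 X) * (?E g1 - ?E g0) \<le> 0" for X
    proof -
      have "(f1 X - f0 X) * (?E g1 - ?E g0) = ?E (\<lambda>Y. (f1 X - f0 X) * (g1 Y - g0 Y))"
        using insert.hyps by simp
      also have "\<dots> \<le> ?E (\<lambda>Y. 0)"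
        by (intro integral_mono integrable_coins insert.hyps)
           (unfold d, intro insert.prems insertI1)
      finally show ?thesis by simp
    qed
    have "(?E f1 - ?E f0) * (?E g1 - ?E g0) = ?E (\<lambda>X. (f1 X - f0 X) * (?E g1 - ?E g0))"
      using insert.hyps by simp
    also have "\<dots> \<le> ?E (\<lambda>Y. 0)"
      by (intro integral_mono) (use insert.hyps pt in \<open>auto simp: d\<close>)
    finally show ?thesis by simp
  qed
  have "measure_pmf.expectation (coins (insert e D) p) (\<lambda>X. f X * g X) =
      p * ?E (\<lambda>X. f1 X * g1 X) + (1 - p) * ?E (\<lambda>X. f0 X * g0 X)"
    using insert.hyps assms by (simp add: expectation_coins_insert d)
  also have "\<dots> \<le> p * (?E f1 * ?E g1) + (1 - p) * (?E f0 * ?E g0)"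
    by (intro add_mono mult_left_mono 0 1) (use assms in auto)
  also have "\<dots> = (p * ?E f1 + (1 - p) * ?E f0) * (p * ?E g1 + (1 - p) * ?E g0) +
      p * (1 - p) * ((?E f1 - ?E f0) * (?E g1 - ?E g0))"
    by (simp add: algebra_simps power2_eq_square)
  also have "\<dots> \<le> (p * ?E f1 + (1 - p) * ?E f0) * (p * ?E g1 + (1 - p) * ?E g0)"
    using mult_nonneg_nonpos[OF _ neg, of "p * (1 - p)"] assms by simp
  also have "\<dots> = measure_pmf.expectation (coins (insert e D) p) f *
      measure_pmf.expectation (coins (insert e D) p) g"
    using insert.hyps assms by (simp add: expectation_coins_insert d)
  finally show ?case .
qed

text \<open>Raising a coin lowers \<open>f\<close> and raises \<open>g\<close>, so their increments
  have opposite signs.\<close>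

lemma harris_inequality:
  fixes f g :: "('e \<Rightarrow> bool) \<Rightarrow> real"
  assumes "finite D" "0 \<le> p" "p \<le> 1" "antimono f" "mono g"
  shows "measure_pmf.expectation (coins D p) (\<lambda>X. f X * g X) \<le>
    measure_pmf.expectation (coins D p) f * measure_pmf.expectation (coins D p) g"
proof (rule coins_correlation)
  fix e and X Y :: "'e \<Rightarrow> bool"
  have "X(e := False) \<le> X(e := True)" "Y(e := False) \<le> Y(e := True)"
    by (auto simp: le_fun_def)
  hence "f (X(e := True)) \<le> f (X(e := False))" "g (Y(e := False)) \<le> g (Y(e := True))"
    using assms by (auto simp: monotone_def)
  thus "(f (X(e := True)) - f (X(e := False))) * (g (Y(e := True)) - g (Y(e := False))) \<le> 0"
    by (intro mult_nonpos_nonneg) auto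
qed (use assms in auto)

text \<open>No coin affects both functions, so all products of increments vanish and the correlation
  inequality holds for \<open>g\<close> and for \<open>- g\<close>; together these give
  equality.\<close>

lemma expectation_coins_mult_indep:
  fixes f g :: "('e \<Rightarrow> bool) \<Rightarrow> real"
  assumes "finite D" "0 \<le> p" "p \<le> 1" "determined_by A f" "determined_by B g" "A \<inter> B = {}"
  shows "measure_pmf.expectation (coins D p) (\<lambda>X. f X * g X) =
    measure_pmf.expectation (coins D p) f * measure_pmf.expectation (coins D p) g"
proof -
  have *: "(f (X(e := True)) - f (X(e := False))) * (g (Y(e := True)) - g (Y(e := False))) = 0"
    for e X Y
  proof (cases "e \<in> A")
    case True
    hence "g (Y(e := True)) = g (Y(e := False))"
      using assms by (intro determined_byD[OF assms(5)]) auto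
    thus ?thesis by simp
  next
    case False
    hence "f (X(e := True)) = f (X(e := False))"
      using assms by (intro determined_byD[OF assms(4)]) auto
    thus ?thesis by simp
  qed
  have "measure_pmf.expectation (coins D p) (\<lambda>X. f X * (- g X)) \<le>
    measure_pmf.expectation (coins D p) f * measure_pmf.expectation (coins D p) (\<lambda>X. - g X)"
    by (rule coins_correlation) (use assms * in \<open>auto simp: algebra_simps\<close>)
  moreover have "measure_pmf.expectation (coins D p) (\<lambda>X. f X * g X) \<le>
    measure_pmf.expectation (coins D p) f * measure_pmf.expectation (coins D p) g"
    by (rule coins_correlation) (use assms in \<open>simp_all add: * del: mult_eq_0_iff\<close>)
  ultimately show ?thesis by simp
qed

lemma determined_by_prod:
  fixes g :: "'i \<Rightarrow> ('e \<Rightarrow> bool) \<Rightarrow> real"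
  shows "(\<And>i. i \<in> I \<Longrightarrow> determined_by B (g i)) \<Longrightarrow> determined_by B (\<lambda>X. \<Prod>i\<in>I. g i X)"
  unfolding determined_by_def by (metis (mono_tags, lifting) prod.cong)

lemma determined_by_mono: "determined_by A f \<Longrightarrow> A \<subseteq> B \<Longrightarrow> determined_by B f"
  unfolding determined_by_def by blast

text \<open>Weierstrass' product inequality, which serves as the union bound inside Janson's
  argument.\<close>

lemma prod_one_minus_ge:
  fixes x :: "'i \<Rightarrow> real"
  assumes "finite I" "\<And>i. i \<in> I \<Longrightarrow> 0 \<le> x i" "\<And>i. i \<in> I \<Longrightarrow> x i \<le> 1"
  shows "(\<Prod>i\<in>I. 1 - x i) \<ge> 1 - (\<Sum>i\<in>I. x i)"
  using assms
proof (induction I rule: finite_induct)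
  case (insert i I)
  have "(\<Prod>i\<in>I. 1 - x i) \<le> 1" "(\<Prod>i\<in>I. 1 - x i) \<ge> 0"
    using insert.prems by (auto intro!: prod_le_1 prod_nonneg)
  hence "x i * (\<Prod>i\<in>I. 1 - x i) \<le> x i"
    using insert.prems(1)[of i] by (simp add: mult_left_le)
  with insert show ?case by (simp add: algebra_simps)
qed auto

text \<open>
  Janson's inequality for functions in place of events. Weights below \<open>1\<close> do the work of the random
  thinning by which the exponent \<open>\<mu>\<^sup>2 / \<Delta>\<close> is usually obtained.
\<close>

theorem janson_inequality:
  fixes f :: "'i \<Rightarrow> ('e \<Rightarrow> bool) \<Rightarrow> real"
  assumes D: "finite D" "0 \<le> p" "p \<le> 1" and I: "finite I"
    and anti: "\<And>i. i \<in> I \<Longrightarrow> antimono (f i)"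
    and det: "\<And>i. i \<in> I \<Longrightarrow> determined_by (A i) (f i)"
    and nonneg: "\<And>i X. i \<in> I \<Longrightarrow> 0 \<le> f i X"
    and le1: "\<And>i X. i \<in> I \<Longrightarrow> f i X \<le> 1"
  shows "measure_pmf.expectation (coins D p) (\<lambda>X. \<Prod>i\<in>I. 1 - f i X) \<le>
    exp (- (\<Sum>i\<in>I. measure_pmf.expectation (coins D p) (f i)) +
      (\<Sum>i\<in>I. \<Sum>j | j \<in> I \<and> A i \<inter> A j \<noteq> {}.
         measure_pmf.expectation (coins D p) (\<lambda>X. f i X * f j X)))"
  using I anti det nonneg le1
proof (induction I rule: finite_induct)
  case empty
  show ?case by simp
next
  case (insert i I)
  let ?E = "measure_pmf.expectation (coins D p)"
  \<comment> \<open>\<open>J\<close> holds the indices sharing coins with \<open>i\<close>,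
    \<open>K\<close> those sharing none; the factor \<open>C\<close> of \<open>N\<close> is
    independent of \<open>f i\<close>.\<close>
  define J where "J = {j \<in> I. A i \<inter> A j \<noteq> {}}"
  define K where "K = {j \<in> I. A i \<inter> A j = {}}"
  have fin: "finite J" "finite K" and IJK: "I = J \<union> K" "J \<inter> K = {}"
    using insert.hyps by (auto simp: J_def K_def)
  define N where "N = (\<lambda>X. \<Prod>j\<in>I. 1 - f j X)"
  define C where "C = (\<lambda>X. \<Prod>j\<in>K. 1 - f j X)"
  have NC: "N X = C X * (\<Prod>j\<in>J. 1 - f j X)" for X
    unfolding N_def C_def using fin IJK by (simp add: prod.union_disjoint mult.commute)
  have C_nonneg: "C X \<ge> 0" for X
    unfolding C_def by (intro prod_nonneg) (use insert.prems in \<open>auto simp: K_def\<close>)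
  have C_mono: "mono C"
    unfolding C_def
  proof (intro monoI prod_mono conjI)
    fix X Y :: "'e \<Rightarrow> bool" and j assume "X \<le> Y" "j \<in> K"
    thus "1 - f j X \<le> 1 - f j Y"
      using insert.prems(1)[of j] by (auto simp: K_def monotone_def)
    show "0 \<le> 1 - f j X" using insert.prems(4)[of j] \<open>j \<in> K\<close> by (auto simp: K_def)
  qed
  have C_det: "determined_by (- A i) C"
    unfolding C_def
  proof (rule determined_by_prod)
    fix j assume j: "j \<in> K"
    hence "determined_by (- A i) (f j)"
      by (intro determined_by_mono[OF insert.prems(2)]) (auto simp: K_def)
    thus "determined_by (- A i) (\<lambda>X. 1 - f j X)"
      by (auto simp: determined_by_def)
  qed
  have N_le_C: "N X \<le> C X" for X
  proof -
    have "(\<Prod>j\<in>J. 1 - f j X) \<le> 1"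
      by (intro prod_le_1) (use insert.prems in \<open>auto simp: J_def\<close>)
    thus ?thesis unfolding NC using C_nonneg[of X] by (simp add: mult_left_le)
  qed
  have N_nonneg: "N X \<ge> 0" for X
    unfolding N_def by (intro prod_nonneg) (use insert.prems in auto)
  define a where "a = ?E (f i)"
  define d where "d = (\<Sum>j\<in>J. ?E (\<lambda>X. f i X * f j X))"
  \<comment> \<open>For events: given that no earlier event occurs, event i still has probability at
    least a - d. Independence splits \<open>C\<close> off the main term, Harris splits it off the
    pair terms.\<close>
  have step: "?E (\<lambda>X. f i X * N X) \<ge> (a - d) * ?E N"
  proof (cases "a - d \<ge> 0")
    case True
    have "?E N \<le> ?E C"
      by (intro integral_mono) (use N_le_C D in auto)
    hence "(a - d) * ?E N \<le> (a - d) * ?E C"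
      using True by (intro mult_left_mono) auto
    also have "\<dots> = ?E (f i) * ?E C - (\<Sum>j\<in>J. ?E (\<lambda>X. f i X * f j X) * ?E C)"
      by (simp add: a_def d_def algebra_simps sum_distrib_left)
    also have "\<dots> \<le> ?E (f i) * ?E C - (\<Sum>j\<in>J. ?E (\<lambda>X. (f i X * f j X) * C X))"
    proof -
      have "?E (\<lambda>X. (f i X * f j X) * C X) \<le> ?E (\<lambda>X. f i X * f j X) * ?E C" if "j \<in> J" for j
      proof (rule harris_inequality[OF D _ C_mono])
        have "j \<in> I" using that by (auto simp: J_def)
        show "antimono (\<lambda>X. f i X * f j X)"
        proof (intro antimonoI mult_mono)
          fix X Y :: "'e \<Rightarrow> bool" assume "X \<le> Y"
          thus "f i Y \<le> f i X" "f j Y \<le> f j X"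
            using insert.prems(1)[of j] insert.prems(1)[of i] \<open>j \<in> I\<close> by (auto simp: monotone_def)
        qed (use insert.prems(3) \<open>j \<in> I\<close> in auto)
      qed
      thus ?thesis by (simp add: sum_mono)
    qed
    also have "?E (f i) * ?E C = ?E (\<lambda>X. f i X * C X)"
      by (rule expectation_coins_mult_indep[OF D _ C_det, symmetric, where A = "A i"])
         (use insert.prems in auto)
    also have "?E (\<lambda>X. f i X * C X) - (\<Sum>j\<in>J. ?E (\<lambda>X. (f i X * f j X) * C X)) =
        ?E (\<lambda>X. f i X * C X * (1 - (\<Sum>j\<in>J. f j X)))"
      using D by (simp add: algebra_simps sum_distrib_left)
    also have "\<dots> \<le> ?E (\<lambda>X. f i X * C X * (\<Prod>j\<in>J. 1 - f j X))"
    proof (intro integral_mono mult_left_mono)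
      fix X show "1 - (\<Sum>j\<in>J. f j X) \<le> (\<Prod>j\<in>J. 1 - f j X)"
        by (intro prod_one_minus_ge) (use fin insert.prems in \<open>auto simp: J_def\<close>)
    qed (use D C_nonneg insert.prems in auto)
    also have "\<dots> = ?E (\<lambda>X. f i X * N X)"
      by (simp add: NC mult.assoc)
    finally show ?thesis .
  next
    case False
    have "(a - d) * ?E N \<le> 0"
      using False N_nonneg by (intro mult_nonpos_nonneg) auto
    also have "0 \<le> ?E (\<lambda>X. f i X * N X)"
      using N_nonneg insert.prems by (intro Bochner_Integration.integral_nonneg) auto
    finally show ?thesis .
  qed
  let ?S = "\<lambda>I. (\<Sum>i\<in>I. \<Sum>j | j \<in> I \<and> A i \<inter> A j \<noteq> {}. ?E (\<lambda>X. f i X * f j X))"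
  have "?E (\<lambda>X. \<Prod>j\<in>insert i I. 1 - f j X) = ?E N - ?E (\<lambda>X. f i X * N X)"
    using D insert.hyps by (simp add: N_def algebra_simps)
  also have "\<dots> \<le> (1 - (a - d)) * ?E N"
    using step by (simp add: algebra_simps)
  also have "\<dots> \<le> exp (- (a - d)) * ?E N"
  proof (intro mult_right_mono Bochner_Integration.integral_nonneg N_nonneg)
    show "1 - (a - d) \<le> exp (- (a - d))"
      using exp_ge_add_one_self[of "- (a - d)"] by linarith
  qed
  also have "\<dots> \<le> exp (- (a - d)) * exp (- (\<Sum>i\<in>I. ?E (f i)) + ?S I)"
    unfolding N_def by (intro mult_left_mono insert.IH) (use insert.prems in auto)
  also have "\<dots> = exp (- (\<Sum>j\<in>insert i I. ?E (f j)) + (d + ?S I))"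
    using insert.hyps by (simp add: exp_add[symmetric] a_def)
  \<comment> \<open>The induction meets each pair once, whereas the stated sum contains ordered
    pairs and the diagonal; the surplus is nonnegative.\<close>
  also have "\<dots> \<le> exp (- (\<Sum>j\<in>insert i I. ?E (f j)) + ?S (insert i I))"
  proof -
    have nn: "?E (\<lambda>X. f k X * f j X) \<ge> 0" if "k \<in> insert i I" "j \<in> insert i I" for k j
      using insert.prems that by (intro Bochner_Integration.integral_nonneg) auto
    have "d \<le> (\<Sum>j | j \<in> insert i I \<and> A i \<inter> A j \<noteq> {}. ?E (\<lambda>X. f i X * f j X))"
      unfolding d_def J_def by (intro sum_mono2) (use insert.hyps nn in auto)
    moreover have "?S I \<le> (\<Sum>k\<in>I. \<Sum>j | j \<in> insert i I \<and> A k \<inter> A j \<noteq> {}. ?E (\<lambda>X. f k X * f j X))"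
      by (intro sum_mono sum_mono2) (use insert.hyps nn in auto)
    ultimately show ?thesis using insert.hyps by simp
  qed
  finally show ?case .
qed

section \<open>The rate function\<close>

text \<open>Negative logarithm of E exp(-s X) for a Bernoulli variable X. Its slope p at 0 and its
  limit ln (1/(1-p)) at infinity produce the growth of \<open>kappa\<close> at infinity and its
  value at 0.\<close>

definition cgf :: "real \<Rightarrow> real \<Rightarrow> real" where
  "cgf p s = - ln (1 - p + p * exp (- s))"

text \<open>Balances about n^k sets against the moment bound: for k = \<kappa> ln n and t = \<tau>
  ln n the exponent is, to leading order, (k/2) ln n times 2 + s\<tau> - \<kappa>
  \<open>cgf p s\<close>. It is negative for some s exactly when \<kappa> exceeds the infimum. The 2
  compensates the factor 1/2 in the degree sum.\<close>

definition kappa :: "real \<Rightarrow> real \<Rightarrow> real" where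
  "kappa p \<tau> = (INF s\<in>{0<..}. (2 + s * \<tau>) / cgf p s)"

context
  fixes p :: real
  assumes p: "0 < p" "p < 1"
begin

section \<open>The Laplace exponent of a single edge\<close>

lemma cgf_arg_pos: "1 - p + p * exp (- s) > 0"
  using p by (intro add_pos_pos mult_pos_pos) auto

lemma exp_minus_cgf: "exp (- cgf p s) = 1 - p + p * exp (- s)"
  using cgf_arg_pos[of s] by (simp add: cgf_def)

lemma cgf_0 [simp]: "cgf p 0 = 0"
  by (simp add: cgf_def)

lemma cgf_pos: "s > 0 \<Longrightarrow> cgf p s > 0"
proof -
  assume "s > 0"
  hence "p * exp (- s) < p * 1" using p by (intro mult_strict_left_mono) auto
  thus ?thesis unfolding cgf_def using cgf_arg_pos[of s] by simp
qed

lemma cgf_nonneg: "s \<ge> 0 \<Longrightarrow> cgf p s \<ge> 0"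
  using cgf_pos[of s] by (cases "s = 0") auto

lemma cgf_less: "cgf p s < - ln (1 - p)"
  unfolding cgf_def using p cgf_arg_pos[of s] by simp

text \<open>Jensen's inequality for exp.\<close>

lemma cgf_le: "cgf p s \<le> p * s"
proof -
  have "exp (- (p * s)) \<le> 1 - p + p * exp (- s)"
    using convex_onD[OF exp_convex, of p 0 "- s"] p by (simp add: algebra_simps)
  hence "- (p * s) \<le> ln (1 - p + p * exp (- s))"
    using cgf_arg_pos[of s] by (simp add: ln_ge_iff)
  thus ?thesis by (simp add: cgf_def)
qed

text \<open>Cauchy-Schwarz for u^X with X Bernoulli: (E u^X)^2 is at most E u^(2X), and the gap is
  the variance p (1 - p) (1 - u)^2.\<close>

lemma cgf_half: "cgf p (s / 2) \<ge> cgf p s / 2"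
proof -
  define u where "u = exp (- (s / 2))"
  have u2: "exp (- s) = u\<^sup>2"
    unfolding u_def power2_eq_square by (simp add: exp_add[symmetric])
  have "(1 - p + p * u)\<^sup>2 \<le> 1 - p + p * u\<^sup>2"
  proof -
    have "1 - p + p * u\<^sup>2 - (1 - p + p * u)\<^sup>2 = p * (1 - p) * (1 - u)\<^sup>2"
      by (simp add: power2_eq_square algebra_simps)
    also have "\<dots> \<ge> 0" using p by simp
    finally show ?thesis by simp
  qed
  hence "ln ((1 - p + p * u)\<^sup>2) \<le> ln (1 - p + p * u\<^sup>2)"
    using cgf_arg_pos[of "s / 2"] cgf_arg_pos[of s] u2 by (subst ln_le_cancel_iff) (auto simp: u_def)
  moreover have "ln ((1 - p + p * u)\<^sup>2) = 2 * ln (1 - p + p * u)"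
    using cgf_arg_pos[of "s / 2"] by (simp add: ln_realpow u_def)
  ultimately show ?thesis by (simp add: cgf_def u2 u_def)
qed

text \<open>The derivative of \<open>cgf\<close> at 0 is p. Such small s are the efficient choice
  when \<tau> is large or t is a constant fraction of n.\<close>

lemma cgf_slope_at_0:
  assumes "r < p"
  obtains s where "s > 0" "r * s < cgf p s"
proof -
  have "((\<lambda>s. cgf p s) has_real_derivative p) (at 0)"
    unfolding cgf_def by (auto intro!: derivative_eq_intros)
  hence "((\<lambda>h. cgf p h / h) \<longlongrightarrow> p) (at 0)"
    by (simp add: DERIV_def)
  hence "((\<lambda>h. cgf p h / h) \<longlongrightarrow> p) (at_right 0)"
    by (rule filterlim_mono) (auto simp: at_within_le_at)
  hence "eventually (\<lambda>h. cgf p h / h > r) (at_right 0)"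
    using assms by (rule order_tendstoD)
  moreover have "eventually (\<lambda>h::real. h > 0) (at_right 0)"
    by (rule eventually_at_right_less)
  ultimately have "eventually (\<lambda>h. h > 0 \<and> cgf p h / h > r) (at_right 0)"
    by eventually_elim auto
  from eventually_happens[OF this] obtain s where "s > 0" "cgf p s / s > r" by auto
  thus ?thesis by (intro that[of s]) (auto simp: field_simps)
qed

lemma cgf_tendsto: "(cgf p \<longlongrightarrow> - ln (1 - p)) at_top"
proof -
  have "((\<lambda>s. exp (- s)) \<longlongrightarrow> (0::real)) at_top" by real_asymp
  hence "((\<lambda>s. 1 - p + p * exp (- s)) \<longlongrightarrow> 1 - p + p * 0) at_top"
    by (intro tendsto_intros)
  from tendsto_ln[OF this] p show ?thesis
    unfolding cgf_def by (auto intro!: tendsto_intros)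
qed

lemma cgf_approx_sup:
  assumes "y < - ln (1 - p)"
  obtains s where "s > 0" "y < cgf p s"
proof -
  have "eventually (\<lambda>s. s > 0 \<and> cgf p s > y) at_top"
    using order_tendstoD(1)[OF cgf_tendsto assms] eventually_gt_at_top[of 0]
    by eventually_elim auto
  from eventually_happens[OF this] that show ?thesis by auto
qed

section \<open>The threshold function: monotonicity, value at 0, continuity, growth\<close>

lemma kappa_bdd: "\<tau> \<ge> 0 \<Longrightarrow> bdd_below ((\<lambda>s. (2 + s * \<tau>) / cgf p s) ` {0<..})"
  by (rule bdd_belowI[of _ 0]) (use cgf_pos in \<open>auto simp: less_imp_le\<close>)

lemma kappa_le: "\<tau> \<ge> 0 \<Longrightarrow> s > 0 \<Longrightarrow> kappa p \<tau> \<le> (2 + s * \<tau>) / cgf p s"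
  unfolding kappa_def by (rule cINF_lower[OF kappa_bdd]) auto

lemma kappa_ge: "(\<And>s. s > 0 \<Longrightarrow> y \<le> (2 + s * \<tau>) / cgf p s) \<Longrightarrow> y \<le> kappa p \<tau>"
  unfolding kappa_def by (rule cINF_greatest) auto

lemma kappa_lessE:
  assumes "\<tau> \<ge> 0" "kappa p \<tau> < y"
  obtains s where "s > 0" "(2 + s * \<tau>) / cgf p s < y"
  using assms cINF_less_iff[OF _ kappa_bdd, of \<tau> y] unfolding kappa_def by auto

text \<open>Passing to \<tau>' adds s (\<tau>' - \<tau>) / \<open>cgf p s\<close> to every candidate
  of the infimum, which \<open>cgf_le\<close> bounds below uniformly in s. Strict monotonicity and
  the lower half of the asymptotics both follow.\<close>

lemma kappa_increment:
  assumes "0 \<le> \<tau>" "\<tau> \<le> \<tau>'"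
  shows "kappa p \<tau> + (\<tau>' - \<tau>) / p \<le> kappa p \<tau>'"
proof (rule kappa_ge)
  fix s :: real assume s: "s > 0"
  have "(\<tau>' - \<tau>) / p = s * (\<tau>' - \<tau>) / (p * s)" using s by simp
  also have "\<dots> \<le> s * (\<tau>' - \<tau>) / cgf p s"
    using s assms cgf_pos[OF s] cgf_le[of s] by (intro divide_left_mono) auto
  finally have "(\<tau>' - \<tau>) / p \<le> s * (\<tau>' - \<tau>) / cgf p s" .
  moreover have "kappa p \<tau> \<le> (2 + s * \<tau>) / cgf p s"
    using kappa_le s assms by simp
  moreover have "(2 + s * \<tau>') / cgf p s = (2 + s * \<tau>) / cgf p s + s * (\<tau>' - \<tau>) / cgf p s"
    by (simp add: add_divide_distrib[symmetric] algebra_simps)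
  ultimately show "kappa p \<tau> + (\<tau>' - \<tau>) / p \<le> (2 + s * \<tau>') / cgf p s"
    by linarith
qed

lemma kappa_mono: "0 \<le> \<tau> \<Longrightarrow> \<tau> \<le> \<tau>' \<Longrightarrow> kappa p \<tau> \<le> kappa p \<tau>'"
  using kappa_increment[of \<tau> \<tau>'] p divide_nonneg_pos[of "\<tau>' - \<tau>" p] by linarith

lemma strict_mono_kappa: "strict_mono_on {0..} (kappa p)"
proof (rule strict_mono_onI)
  fix r s :: real assume "r \<in> {0..}" "r < s"
  moreover from this have "(s - r) / p > 0" using p by simp
  ultimately show "kappa p r < kappa p s" using kappa_increment[of r s] by simp
qed

text \<open>Without the term s\<tau> the infimum is 2 over the supremum of \<open>cgf\<close>. No s
  attains it, so one direction works with approximating s.\<close>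

lemma kappa_0: "kappa p 0 = 2 / - ln (1 - p)"
proof (rule antisym)
  have l: "- ln (1 - p) > 0" using p by simp
  show "kappa p 0 \<le> 2 / - ln (1 - p)"
  proof (rule ccontr)
    assume "\<not> ?thesis"
    hence lt: "2 / - ln (1 - p) < kappa p 0" by simp
    have "0 < 2 / - ln (1 - p)" using l by (intro divide_pos_pos) auto
    with lt have k: "kappa p 0 > 0" by linarith
    have "2 / kappa p 0 < - ln (1 - p)"
      using lt l k by (simp add: field_simps)
    then obtain s where s: "s > 0" "2 / kappa p 0 < cgf p s" by (rule cgf_approx_sup)
    hence "2 / cgf p s < kappa p 0" using k cgf_pos[of s] by (simp add: field_simps)
    with kappa_le[of 0 s] s show False by simp
  qed
  show "2 / - ln (1 - p) \<le> kappa p 0"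
  proof (rule kappa_ge)
    fix s :: real assume s: "s > 0"
    have "2 / - ln (1 - p) \<le> 2 / cgf p s"
      using cgf_less[of s] by (intro divide_left_mono mult_pos_pos cgf_pos[OF s] l) auto
    thus "2 / - ln (1 - p) \<le> (2 + s * 0) / cgf p s" by simp
  qed
qed

lemma kappa_0_pos: "kappa p 0 > 0"
  unfolding kappa_0 using p by (intro divide_pos_pos) auto

lemma kappa_pos: "\<tau> \<ge> 0 \<Longrightarrow> kappa p \<tau> > 0"
  using kappa_0_pos kappa_mono[of 0 \<tau>] by linarith

lemma kappa_ge_linear: "\<tau> \<ge> 0 \<Longrightarrow> \<tau> / p \<le> kappa p \<tau>"
  using kappa_increment[of 0 \<tau>] kappa_0_pos by simp

text \<open>As an infimum of affine functions \<open>kappa\<close> is upper semicontinuous: a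
  candidate below y at \<tau> stays below y nearby. The lower half uses monotonicity to the right of
  \<tau> and a scaling bound to its left.\<close>

lemma continuous_kappa: "continuous_on {0..} (kappa p)"
  unfolding continuous_on_def
proof
  fix \<tau> :: real assume "\<tau> \<in> {0..}"
  hence \<tau>: "\<tau> \<ge> 0" by simp
  have in_dom: "eventually (\<lambda>x. x \<ge> 0) (at \<tau> within {0..})"
    by (simp add: eventually_at_filter)
  have id: "((\<lambda>x. x) \<longlongrightarrow> \<tau>) (at \<tau> within {0..})" by (rule tendsto_ident_at)
  show "(kappa p \<longlongrightarrow> kappa p \<tau>) (at \<tau> within {0..})"
  proof (rule order_tendstoI)
    fix y assume "kappa p \<tau> < y"
    then obtain s where s: "s > 0" "(2 + s * \<tau>) / cgf p s < y"
      using kappa_lessE \<tau> by blast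
    have "((\<lambda>x. (2 + s * x) / cgf p s) \<longlongrightarrow> (2 + s * \<tau>) / cgf p s) (at \<tau> within {0..})"
      using cgf_pos[OF s(1)] by (intro tendsto_intros id) auto
    from order_tendstoD(2)[OF this s(2)] in_dom
    show "eventually (\<lambda>x. kappa p x < y) (at \<tau> within {0..})"
    proof eventually_elim
      case (elim x)
      thus ?case using kappa_le[of x s] s by linarith
    qed
  next
    fix y assume y: "y < kappa p \<tau>"
    show "eventually (\<lambda>x. y < kappa p x) (at \<tau> within {0..})"
    proof (cases "\<tau> = 0")
      case True
      show ?thesis using in_dom
      proof eventually_elim
        case (elim x)
        thus ?case using kappa_mono[of 0 x] y True by simp
      qed
    next
      case False
      hence \<tau>0: "\<tau> > 0" using \<tau> by simp
      have "((\<lambda>x. x / \<tau> * kappa p \<tau>) \<longlongrightarrow> \<tau> / \<tau> * kappa p \<tau>) (at \<tau> within {0..})"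
        using \<tau>0 by (intro tendsto_intros id) auto
      moreover have "y < \<tau> / \<tau> * kappa p \<tau>" using \<tau>0 y by simp
      ultimately have "eventually (\<lambda>x. y < x / \<tau> * kappa p \<tau>) (at \<tau> within {0..})"
        by (rule order_tendstoD)
      with in_dom show ?thesis
      proof eventually_elim
        case (elim x)
        show ?case
        proof (cases "x \<ge> \<tau>")
          case True
          thus ?thesis using y kappa_mono[of \<tau> x] \<tau> by simp
        next
          case False
          \<comment> \<open>Replacing \<tau> by x < \<tau> shrinks the term s\<tau> in proportion,
            while the intercept 2 does not shrink at all.\<close>
          have "x / \<tau> * kappa p \<tau> \<le> kappa p x"
          proof (rule kappa_ge)
            fix s :: real assume s: "s > 0"
            have "x / \<tau> * kappa p \<tau> \<le> x / \<tau> * ((2 + s * \<tau>) / cgf p s)"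
              using elim \<tau>0 s by (intro mult_left_mono kappa_le) auto
            also have "\<dots> = (x / \<tau> * 2 + s * x) / cgf p s"
              using \<tau>0 by (simp add: field_simps)
            also have "\<dots> \<le> (2 + s * x) / cgf p s"
              using cgf_pos[OF s] False elim \<tau>0 by (intro divide_right_mono) (auto simp: field_simps)
            finally show "x / \<tau> * kappa p \<tau> \<le> (2 + s * x) / cgf p s" .
          qed
          with elim show ?thesis by simp
        qed
      qed
    qed
  qed
qed

text \<open>One fixed small s with \<open>cgf p s\<close> close to p s gives the right slope; from
  \<open>C\<close> on, the constant 2 / \<open>cgf p s\<close> is at most \<epsilon>/2 of the linear
  term. The explicit threshold helps to fix where the regime of large t begins.\<close>

lemma kappa_asymp_upper:
  assumes "\<epsilon> > 0"
  obtains C where "C > 0" "\<And>\<tau>. \<tau> \<ge> C \<Longrightarrow> kappa p \<tau> \<le> (1 + \<epsilon>) * (\<tau> / p)"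
proof -
  have "p / (1 + \<epsilon> / 2) < p" using p assms by (simp add: field_simps)
  then obtain s where s: "s > 0" "p / (1 + \<epsilon> / 2) * s < cgf p s" by (rule cgf_slope_at_0)
  define C where "C = 4 * p / (\<epsilon> * cgf p s)"
  have c: "cgf p s > 0" using s cgf_pos by simp
  have "C > 0" using p assms c by (simp add: C_def)
  moreover have "kappa p \<tau> \<le> (1 + \<epsilon>) * (\<tau> / p)" if "\<tau> \<ge> C" for \<tau>
  proof -
    have \<tau>: "\<tau> > 0" using that \<open>C > 0\<close> by simp
    have "kappa p \<tau> \<le> 2 / cgf p s + s / cgf p s * \<tau>"
      using kappa_le[of \<tau> s] \<tau> s by (simp add: add_divide_distrib)
    also have "s / cgf p s \<le> (1 + \<epsilon> / 2) / p"
      using s p assms c by (simp add: field_simps)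
    also have "2 / cgf p s \<le> \<epsilon> / 2 * (\<tau> / p)"
      using that c p assms by (simp add: C_def field_simps)
    finally show ?thesis using \<tau> p by (simp add: field_simps)
  qed
  ultimately show ?thesis by (rule that)
qed

lemma kappa_asymp_equiv: "kappa p \<sim>[at_top] (\<lambda>\<tau>. \<tau> / p)"
proof (rule asymp_equivI')
  show "((\<lambda>\<tau>. kappa p \<tau> / (\<tau> / p)) \<longlongrightarrow> 1) at_top"
  proof (rule order_tendstoI)
    fix y :: real assume y: "y < 1"
    show "eventually (\<lambda>\<tau>. y < kappa p \<tau> / (\<tau> / p)) at_top"
      using eventually_gt_at_top[of 0]
    proof eventually_elim
      case (elim \<tau>)
      hence "1 \<le> kappa p \<tau> / (\<tau> / p)" using kappa_ge_linear[of \<tau>] p by (subst le_divide_eq) auto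
      with y show ?case by simp
    qed
  next
    fix y :: real assume y: "1 < y"
    obtain C where C: "C > 0" "\<And>\<tau>. \<tau> \<ge> C \<Longrightarrow> kappa p \<tau> \<le> (1 + (y - 1) / 2) * (\<tau> / p)"
      using kappa_asymp_upper[of "(y - 1) / 2"] y by auto
    show "eventually (\<lambda>\<tau>. kappa p \<tau> / (\<tau> / p) < y) at_top"
      using eventually_ge_at_top[of C]
    proof eventually_elim
      case (elim \<tau>)
      have "\<tau> / p > 0" using C(1) elim p by simp
      hence "kappa p \<tau> / (\<tau> / p) \<le> 1 + (y - 1) / 2"
        using C(2)[OF elim] by (subst divide_le_eq) auto
      also have "\<dots> < y" using y by (simp add: field_simps)
      finally show ?case .
    qed
  qed
qed

end

section \<open>Probability that a vertex set is dependent\<close>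

lemma expectation_coins_prod:
  fixes g :: "'e \<Rightarrow> bool \<Rightarrow> real"
  assumes "finite D" "F \<subseteq> D" "0 \<le> p" "p \<le> 1" "\<And>e y. 0 \<le> g e y"
  shows "measure_pmf.expectation (coins D p) (\<lambda>X. \<Prod>e\<in>F. g e (X e)) =
    (\<Prod>e\<in>F. p * g e True + (1 - p) * g e False)"
proof -
  have fin: "finite F" using assms finite_subset by blast
  define h where "h = (\<lambda>e y. if e \<in> F then g e y else 1)"
  have "measure_pmf.expectation (coins D p) (\<lambda>X. \<Prod>e\<in>F. g e (X e)) =
      measure_pmf.expectation (coins D p) (\<lambda>X. \<Prod>e\<in>D. h e (X e))"
    unfolding h_def using assms by (simp add: prod.If_cases Int_absorb1)
  also have "\<dots> = (\<Prod>e\<in>D. measure_pmf.expectation (bernoulli_pmf p) (h e))"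
    unfolding coins_def
    by (rule expectation_prod_Pi_pmf) (use assms in \<open>auto simp: h_def intro!: integrable_measure_pmf_finite\<close>)
  also have "\<dots> = (\<Prod>e\<in>D. if e \<in> F then p * g e True + (1 - p) * g e False else 1)"
    using assms by (intro prod.cong) (auto simp: h_def)
  also have "\<dots> = (\<Prod>e\<in>F. p * g e True + (1 - p) * g e False)"
    using assms by (simp add: prod.If_cases Int_absorb1)
  finally show ?thesis .
qed

lemma prob_coins_le_expectation:
  assumes "finite D" "\<And>X. X \<in> A \<Longrightarrow> 1 \<le> f X" "\<And>X. 0 \<le> f X"
  shows "measure_pmf.prob (coins D p) A \<le> measure_pmf.expectation (coins D p) f"
proof -
  have "measure_pmf.prob (coins D p) A = measure_pmf.expectation (coins D p) (indicator A)"
    by simp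
  also have "\<dots> \<le> measure_pmf.expectation (coins D p) f"
    by (intro integral_mono) (use assms in \<open>auto simp: indicator_def\<close>)
  finally show ?thesis .
qed

lemma map_coins_card:
  assumes "finite D" "F \<subseteq> D" "0 \<le> p" "p \<le> 1"
  shows "map_pmf (\<lambda>X. card {e\<in>F. X e}) (coins D p) = binomial_pmf (card F) p"
proof -
  have fin: "finite F" using assms finite_subset by blast
  have "binomial_pmf (card F) p = map_pmf (\<lambda>X. card {e\<in>F. X e}) (coins F p)"
    unfolding coins_def by (rule binomial_pmf_altdef') (use fin assms in auto)
  also have "coins F p = map_pmf (\<lambda>X e. if e \<in> F then X e else False) (coins D p)"
    unfolding coins_def by (rule Pi_pmf_subset) (use assms in auto)
  also have "map_pmf (\<lambda>X. card {e\<in>F. X e}) \<dots> = map_pmf (\<lambda>X. card {e\<in>F. X e}) (coins D p)"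
    unfolding map_pmf_comp by (intro map_pmf_cong refl arg_cong[where f = card]) auto
  finally show ?thesis by simp
qed

lemma hoeffding_coins:
  fixes p \<delta> :: real
  assumes "finite D" "F \<subseteq> D" "0 \<le> p" "p \<le> 1" "F \<noteq> {}" "\<delta> \<ge> 0"
  shows "measure_pmf.prob (coins D p) {X. real (card {e\<in>F. X e}) \<ge> card F * p + \<delta>} \<le>
      exp (- 2 * \<delta>\<^sup>2 / card F)"
    and "measure_pmf.prob (coins D p) {X. real (card {e\<in>F. X e}) \<le> card F * p - \<delta>} \<le>
      exp (- 2 * \<delta>\<^sup>2 / card F)"
proof -
  interpret binomial_distribution "card F" p
    using assms by unfold_locales auto
  have "card F > 0" using assms finite_subset[of F D] by (simp add: card_gt_0_iff)
  note b = prob_ge[OF this \<open>\<delta> \<ge> 0\<close>] prob_le[OF this \<open>\<delta> \<ge> 0\<close>]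
  have "measure_pmf.prob (coins D p) {X. P (real (card {e\<in>F. X e}))} =
      measure_pmf.prob (binomial_pmf (card F) p) {x. P (real x)}" for P
    unfolding map_coins_card[OF assms(1-4), symmetric] by simp
  from this[of "\<lambda>x. x \<ge> card F * p + \<delta>"] this[of "\<lambda>x. x \<le> card F * p - \<delta>"] b
  show "measure_pmf.prob (coins D p) {X. real (card {e\<in>F. X e}) \<ge> card F * p + \<delta>} \<le>
      exp (- 2 * \<delta>\<^sup>2 / card F)"
    and "measure_pmf.prob (coins D p) {X. real (card {e\<in>F. X e}) \<le> card F * p - \<delta>} \<le>
      exp (- 2 * \<delta>\<^sup>2 / card F)"
    by simp_all
qed

section \<open>Degree constraints and the exponential moment bound\<close>

lemma card_star:
  assumes "finite B" "v \<in> B"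
  shows "card {e \<in> nsets B 2. v \<in> e} = card B - 1"
proof -
  have "{e \<in> nsets B 2. v \<in> e} = (\<lambda>u. {v, u}) ` (B - {v})"
    using assms by (auto simp: nsets_2_eq)
  also have "card \<dots> = card (B - {v})"
    by (rule card_image) (auto simp: inj_on_def doubleton_eq_iff)
  finally show ?thesis using assms by simp
qed

definition deg_le :: "nat \<Rightarrow> 'a set set \<Rightarrow> 'a set \<Rightarrow> ('a set \<Rightarrow> bool) \<Rightarrow> bool" where
  "deg_le t F M X \<longleftrightarrow> (\<forall>v\<in>M. card {e\<in>F. v \<in> e \<and> X e} \<le> t)"

lemma dependent_set_iff_deg_le:
  assumes "S \<subseteq> V"
  shows "dependent_set t {e \<in> nsets V 2. X e} S \<longleftrightarrow> deg_le t (nsets S 2) S X"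
proof -
  have "{e \<in> {e \<in> {e \<in> nsets V 2. X e}. e \<subseteq> S}. v \<in> e} = {e \<in> nsets S 2. v \<in> e \<and> X e}" for v
    using assms by (auto simp: nsets_def)
  thus ?thesis
    unfolding dependent_set_def deg_le_def vertex_degree_def induced_edges_def by simp
qed

lemma determined_by_deg_le: "determined_by F (deg_le t F M)"
  unfolding determined_by_def deg_le_def
proof (intro allI impI)
  fix X Y :: "'a set \<Rightarrow> bool" assume "\<forall>e\<in>F. X e = Y e"
  hence "{e\<in>F. v \<in> e \<and> X e} = {e\<in>F. v \<in> e \<and> Y e}" for v by auto
  thus "(\<forall>v\<in>M. card {e \<in> F. v \<in> e \<and> X e} \<le> t) = (\<forall>v\<in>M. card {e \<in> F. v \<in> e \<and> Y e} \<le> t)"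
    by simp
qed

lemma deg_le_antimono:
  assumes "finite F'" "F \<subseteq> F'" "X \<le> Y" "M \<subseteq> M'" "deg_le t F' M' Y"
  shows "deg_le t F M X"
  unfolding deg_le_def
proof
  fix v assume "v \<in> M"
  have "card {e\<in>F. v \<in> e \<and> X e} \<le> card {e\<in>F'. v \<in> e \<and> Y e}"
    using assms by (intro card_mono) (auto simp: le_fun_def)
  also have "\<dots> \<le> t" using assms \<open>v \<in> M\<close> by (auto simp: deg_le_def)
  finally show "card {e\<in>F. v \<in> e \<and> X e} \<le> t" .
qed

lemma sum_card_incidence:
  assumes "finite F" "finite M"
  shows "(\<Sum>v\<in>M. card {e\<in>F. v \<in> e \<and> P e}) = (\<Sum>e\<in>F. if P e then card (e \<inter> M) else 0)"
proof -
  have "(\<Sum>v\<in>M. card {e\<in>F. v \<in> e \<and> P e}) = (\<Sum>v\<in>M. \<Sum>e\<in>F. if v \<in> e \<and> P e then 1 else 0)"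
    using assms by (simp add: sum.If_cases Int_def)
  also have "\<dots> = (\<Sum>e\<in>F. \<Sum>v\<in>M. if v \<in> e \<and> P e then 1 else 0)"
    by (rule sum.swap)
  also have "\<dots> = (\<Sum>e\<in>F. if P e then card (e \<inter> M) else 0)"
    using assms by (intro sum.cong) (auto simp: sum.If_cases Int_def conj_commute)
  finally show ?thesis .
qed

text \<open>
  An edge inside \<open>M\<close> is counted by both its ends, a crossing edge once; \<open>cgf_half\<close> makes the
  exponential bound linear in this multiplicity.
\<close>

lemma prob_deg_le_upper:
  assumes p: "0 < p" "p < 1" and V: "finite V" "B \<subseteq> V" "M \<subseteq> B" and s: "s \<ge> 0"
  shows "measure_pmf.prob (coins (nsets V 2) p) {X. deg_le t (nsets B 2 - nsets (B - M) 2) M X} \<le>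
    exp (card M / 2 * (s * t - (real (card B) - 1) * cgf p s))"
proof -
  define F where "F = nsets B 2 - nsets (B - M) 2"
  have finV: "finite (nsets V 2)" using V finite_imp_finite_nsets by blast
  have "finite B" by (rule finite_subset[OF V(2,1)])
  moreover from this have "finite M" by (rule finite_subset[OF V(3)])
  ultimately have finB: "finite B" "finite M" .
  have FV: "F \<subseteq> nsets V 2" using V nsets_mono[of B V] by (auto simp: F_def)
  have finF: "finite F" using FV finV finite_subset by blast
  have star: "{e\<in>F. v \<in> e} = {e\<in>nsets B 2. v \<in> e}" if "v \<in> M" for v
    using that by (auto simp: F_def nsets_def)
  define w where "w = (\<lambda>e. real (card (e \<inter> M)))"
  \<comment> \<open>Handshake count: each vertex of \<open>M\<close> has all its card B - 1 pairs in
    \<open>F\<close>.\<close>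
  have sumw: "(\<Sum>e\<in>F. w e) = card M * (real (card B) - 1)"
  proof (cases "M = {}")
    case False
    have "card B > 0" using False V finB by (auto simp: card_gt_0_iff)
    have "(\<Sum>e\<in>F. w e) = real (\<Sum>v\<in>M. card {e\<in>F. v \<in> e})"
      using sum_card_incidence[OF finF finB(2), of "\<lambda>_. True"] by (simp add: w_def)
    also have "(\<Sum>v\<in>M. card {e\<in>F. v \<in> e}) = (\<Sum>v\<in>M. card B - 1)"
      using V finB card_star[OF finB(1)] by (intro sum.cong) (auto simp: star)
    finally show ?thesis using \<open>card B > 0\<close> by (simp add: of_nat_diff)
  qed (simp add: w_def)
  \<comment> \<open>Markov's bound: \<open>h\<close> is at least 1 on the event. The rate s/2 per
    incidence gives a pair inside \<open>M\<close> the full weight s.\<close>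
  define h where "h = (\<lambda>X. exp (s / 2 * t * card M) * (\<Prod>e\<in>F. exp (if X e then - (s / 2 * w e) else 0)))"
  have h: "1 \<le> h X" if "deg_le t F M X" for X
  proof -
    have "(\<Sum>v\<in>M. card {e\<in>F. v \<in> e \<and> X e}) \<le> (\<Sum>v\<in>M. t)"
      using that by (intro sum_mono) (auto simp: deg_le_def)
    hence "real (\<Sum>e\<in>F. if X e then card (e \<inter> M) else 0) \<le> real (card M * t)"
      unfolding sum_card_incidence[OF finF finB(2)] by (subst of_nat_le_iff) simp
    hence "s / 2 * real (\<Sum>e\<in>F. if X e then card (e \<inter> M) else 0) \<le> s / 2 * real (card M * t)"
      using s by (intro mult_left_mono) auto
    moreover have "s / 2 * real (\<Sum>e\<in>F. if X e then card (e \<inter> M) else 0) =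
        - (\<Sum>e\<in>F. if X e then - (s / 2 * w e) else 0)"
      unfolding of_nat_sum sum_distrib_left sum_negf[symmetric]
      by (intro sum.cong) (auto simp: w_def)
    ultimately have "0 \<le> s / 2 * t * card M + (\<Sum>e\<in>F. if X e then - (s / 2 * w e) else 0)"
      by (simp add: mult_ac)
    thus ?thesis
      unfolding h_def exp_sum[OF finF, symmetric] exp_add[symmetric] by simp
  qed
  have "measure_pmf.prob (coins (nsets V 2) p) {X. deg_le t F M X} \<le>
      measure_pmf.expectation (coins (nsets V 2) p) h"
    by (rule prob_coins_le_expectation) (use finV h in \<open>auto simp: h_def intro!: mult_nonneg_nonneg prod_nonneg\<close>)
  also have "\<dots> = exp (s / 2 * t * card M) *
      (\<Prod>e\<in>F. p * exp (- (s / 2 * w e)) + (1 - p))"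
    unfolding h_def using expectation_coins_prod[OF finV FV, of p "\<lambda>e y. exp (if y then - (s / 2 * w e) else 0)"] p
    by simp
  also have "(\<Prod>e\<in>F. p * exp (- (s / 2 * w e)) + (1 - p)) \<le> (\<Prod>e\<in>F. exp (- (cgf p s / 2 * w e)))"
  proof (intro prod_mono conjI)
    fix e assume "e \<in> F"
    hence "finite e" "card e = 2" by (auto simp: F_def nsets_def)
    hence "card (e \<inter> M) \<le> 2" using card_mono[of e "e \<inter> M"] by auto
    then consider "card (e \<inter> M) = 0" | "card (e \<inter> M) = 1" | "card (e \<inter> M) = 2" by linarith
    thus "p * exp (- (s / 2 * w e)) + (1 - p) \<le> exp (- (cgf p s / 2 * w e))"
    proof cases
      case 2
      have "p * exp (- (s / 2)) + (1 - p) = exp (- cgf p (s / 2))"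
        using exp_minus_cgf[OF p, of "s / 2"] by simp
      also have "\<dots> \<le> exp (- (cgf p s / 2))" using cgf_half[OF p, of s] by simp
      finally show ?thesis using 2 by (simp add: w_def)
    next
      case 3
      thus ?thesis using exp_minus_cgf[OF p, of s] by (simp add: w_def)
    qed (simp add: w_def)
    show "0 \<le> p * exp (- (s / 2 * w e)) + (1 - p)" using p by simp
  qed
  also have "(\<Prod>e\<in>F. exp (- (cgf p s / 2 * w e))) = exp (- (cgf p s / 2 * (card M * (real (card B) - 1))))"
    unfolding exp_sum[OF finF, symmetric] sum_negf sum_distrib_left[symmetric] sumw ..
  also have "exp (s / 2 * t * card M) * \<dots> = exp (card M / 2 * (s * t - (real (card B) - 1) * cgf p s))"
    unfolding exp_add[symmetric] by (simp add: field_simps)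
  finally show ?thesis by (simp add: F_def)
qed

lemma prob_dependent_le:
  assumes p: "0 < p" "p < 1" and V: "finite V" "B \<subseteq> V" and s: "s \<ge> 0"
  shows "measure_pmf.prob (coins (nsets V 2) p) {X. deg_le t (nsets B 2) B X} \<le>
    exp (card B / 2 * (s * t - (real (card B) - 1) * cgf p s))"
  using prob_deg_le_upper[OF p V order.refl s, of t] by (simp add: nsets_empty_iff)

section \<open>Joint probability of two overlapping dependent sets\<close>

lemma prob_no_edges:
  assumes "finite D" "F \<subseteq> D" "0 \<le> p" "p \<le> 1"
  shows "measure_pmf.prob (coins D p) {X. \<forall>e\<in>F. \<not> X e} = (1 - p) ^ card F"
proof -
  have fin: "finite F" using assms finite_subset by blast
  have "measure_pmf.prob (coins D p) {X. \<forall>e\<in>F. \<not> X e} =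
      measure_pmf.expectation (coins D p) (indicator {X. \<forall>e\<in>F. \<not> X e})" by simp
  also have "indicator {X. \<forall>e\<in>F. \<not> X e} = (\<lambda>X. \<Prod>e\<in>F. if X e then 0 else 1 :: real)"
    using fin by (auto simp: indicator_def fun_eq_iff)
  also have "measure_pmf.expectation (coins D p) \<dots> = (1 - p) ^ card F"
    using expectation_coins_prod[OF assms, of "\<lambda>e y. if y then 0 else 1"] by simp
  finally show ?thesis .
qed

lemma prob_coins_indep:
  assumes "finite D" "0 \<le> p" "p \<le> 1" "determined_by A P" "determined_by B Q" "A \<inter> B = {}"
  shows "measure_pmf.prob (coins D p) {X. P X \<and> Q X} =
    measure_pmf.prob (coins D p) {X. P X} * measure_pmf.prob (coins D p) {X. Q X}"
proof -
  have "measure_pmf.prob (coins D p) {X. P X \<and> Q X} =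
      measure_pmf.expectation (coins D p) (indicator {X. P X \<and> Q X})" by simp
  also have "indicator {X. P X \<and> Q X} = (\<lambda>X. indicator {X. P X} X * indicator {X. Q X} X :: real)"
    by (auto simp: indicator_def fun_eq_iff)
  also have "measure_pmf.expectation (coins D p) \<dots> =
      measure_pmf.expectation (coins D p) (indicator {X. P X}) *
      measure_pmf.expectation (coins D p) (indicator {X. Q X})"
    by (rule expectation_coins_mult_indep[OF assms(1-3) _ _ assms(6)])
       (use assms(4,5) in \<open>auto simp: determined_by_def indicator_def\<close>)
  finally show ?thesis by simp
qed

text \<open>Ignoring the shared pairs weakens the condition on B and makes it independent of A. The
  price is bounded in two ways. Either the shared pairs are required to be non-edges, independently
  of the rest, which restores full dependence of B; or the constraints at shared vertices are
  dropped, and the vertices of \<open>B - A\<close> still have all their pairs in B.\<close>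

lemma prob_two_dependent_le:
  assumes p: "0 < p" "p < 1" and V: "finite V" "A \<subseteq> V" "B \<subseteq> V"
  defines "P \<equiv> measure_pmf.prob (coins (nsets V 2) p)"
  shows "P {X. deg_le t (nsets A 2) A X \<and> deg_le t (nsets B 2) B X} \<le>
      P {X. deg_le t (nsets A 2) A X} *
      P {X. deg_le t (nsets B 2 - nsets (A \<inter> B) 2) B X}" (is "?l \<le> ?r")
    and "P {X. deg_le t (nsets B 2 - nsets (A \<inter> B) 2) B X} \<le>
      P {X. deg_le t (nsets B 2) B X} / (1 - p) ^ (card (A \<inter> B) choose 2)"
    and "s \<ge> 0 \<Longrightarrow> P {X. deg_le t (nsets B 2 - nsets (A \<inter> B) 2) B X} \<le>
      exp (card (B - A) / 2 * (s * t - (real (card B) - 1) * cgf p s))"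
proof -
  define F where "F = nsets B 2 - nsets (A \<inter> B) 2"
  have finV: "finite (nsets V 2)" using V finite_imp_finite_nsets by blast
  have finAB: "finite A" "finite B" using V finite_subset by blast+
  hence finB2: "finite (nsets B 2)" using finite_imp_finite_nsets by blast
  have "?l \<le> P {X. deg_le t (nsets A 2) A X \<and> deg_le t F B X}"
    unfolding P_def
    by (intro measure_pmf.finite_measure_mono)
       (auto simp: F_def intro: deg_le_antimono[OF finB2])
  also have "\<dots> = P {X. deg_le t (nsets A 2) A X} * P {X. deg_le t F B X}"
    unfolding P_def
    by (rule prob_coins_indep[OF finV _ _ determined_by_deg_le determined_by_deg_le])
       (use p in \<open>auto simp: F_def nsets_def\<close>)
  finally show "?l \<le> ?r" by (simp add: F_def)
  have "P {X. deg_le t F B X} * (1 - p) ^ (card (A \<inter> B) choose 2) =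
      P {X. deg_le t F B X} * P {X. \<forall>e\<in>nsets (A \<inter> B) 2. \<not> X e}"
  proof -
    have "nsets (A \<inter> B) 2 \<subseteq> nsets V 2" using V by (intro nsets_mono) auto
    thus ?thesis
      unfolding P_def using p finV finAB by (subst prob_no_edges) (auto simp: card_nsets)
  qed
  also have "\<dots> = P {X. deg_le t F B X \<and> (\<forall>e\<in>nsets (A \<inter> B) 2. \<not> X e)}"
    unfolding P_def
    by (rule prob_coins_indep[OF finV _ _ determined_by_deg_le, symmetric, where B = "nsets (A \<inter> B) 2"])
       (use p in \<open>auto simp: F_def determined_by_def\<close>)
  also have "\<dots> \<le> P {X. deg_le t (nsets B 2) B X}"
    unfolding P_def
  proof (intro measure_pmf.finite_measure_mono subsetI, clarify)
    fix X assume 1: "deg_le t F B X" "\<forall>e\<in>nsets (A \<inter> B) 2. \<not> X e"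
    have "{e \<in> nsets B 2. v \<in> e \<and> X e} = {e \<in> F. v \<in> e \<and> X e}" for v
      using 1(2) by (auto simp: F_def)
    thus "deg_le t (nsets B 2) B X" using 1(1) by (simp add: deg_le_def)
  qed auto
  finally show "P {X. deg_le t (nsets B 2 - nsets (A \<inter> B) 2) B X} \<le>
      P {X. deg_le t (nsets B 2) B X} / (1 - p) ^ (card (A \<inter> B) choose 2)"
    using p by (simp add: F_def field_simps)
  assume s: "s \<ge> 0"
  have "B - (B - A) = A \<inter> B" by auto
  moreover have "P {X. deg_le t F B X} \<le> P {X. deg_le t F (B - A) X}"
    unfolding P_def
    by (intro measure_pmf.finite_measure_mono) (auto simp: deg_le_def)
  ultimately show "P {X. deg_le t (nsets B 2 - nsets (A \<inter> B) 2) B X} \<le>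
      exp (card (B - A) / 2 * (s * t - (real (card B) - 1) * cgf p s))"
    using prob_deg_le_upper[OF p V(1,3) _ s, of "B - A" t] by (auto simp: P_def F_def)
qed

lemma real_choose_two: "real (k choose 2) = k * (real k - 1) / 2"
proof (cases k)
  case (Suc m)
  have "even (k * (k - 1))" using Suc by simp
  thus ?thesis using Suc by (simp add: choose_two real_of_nat_div algebra_simps)
qed simp

section \<open>Change of measure and the matching lower bound\<close>

lemma prob_coins_restrict:
  assumes "finite D" "F \<subseteq> D" "determined_by F Q"
  shows "measure_pmf.prob (coins D p) {X. Q X} = measure_pmf.prob (coins F p) {X. Q X}"
proof -
  have eq: "coins F p = map_pmf (\<lambda>X e. if e \<in> F then X e else False) (coins D p)"
    unfolding coins_def by (rule Pi_pmf_subset) (use assms in auto)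
  have "Q (\<lambda>e. if e \<in> F then X e else False) = Q X" for X
    by (rule determined_byD[OF assms(3)]) auto
  thus ?thesis unfolding eq by simp
qed

lemma prob_coins_sum:
  fixes Q :: "('e \<Rightarrow> bool) \<Rightarrow> bool"
  assumes "finite D"
  shows "measure_pmf.prob (coins D p) {X. Q X} =
    (\<Sum>X | Q X \<and> (\<forall>e. e \<notin> D \<longrightarrow> \<not> X e). \<Prod>e\<in>D. pmf (bernoulli_pmf p) (X e))"
proof -
  let ?Supp = "{X. \<forall>e. e \<notin> D \<longrightarrow> \<not> X e}"
  have supp: "set_pmf (coins D p) \<subseteq> ?Supp"
    using set_Pi_pmf_subset[OF assms, of False "\<lambda>_. bernoulli_pmf p"] by (auto simp: coins_def)
  have "?Supp = PiE_dflt D False (\<lambda>_. UNIV)"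
    by (auto simp: PiE_dflt_def)
  hence fin: "finite ?Supp" using assms by (auto intro!: finite_PiE_dflt)
  have "measure_pmf.prob (coins D p) {X. Q X} = measure_pmf.prob (coins D p) {X. Q X \<and> X \<in> ?Supp}"
    by (rule measure_eq_AE) (use supp in \<open>auto simp: AE_measure_pmf_iff\<close>)
  also have "\<dots> = (\<Sum>X | Q X \<and> X \<in> ?Supp. pmf (coins D p) X)"
    by (rule measure_measure_pmf_finite) (use fin in auto)
  also have "\<dots> = (\<Sum>X | Q X \<and> X \<in> ?Supp. \<Prod>e\<in>D. pmf (bernoulli_pmf p) (X e))"
    unfolding coins_def by (intro sum.cong refl pmf_Pi'[OF assms]) auto
  finally show ?thesis by simp
qed

text \<open>Edge probability after exponential (Cramer) tilting: the Bernoulli weights are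
  multiplied by exp(-s X) and normalised.\<close>

definition tilted :: "real \<Rightarrow> real \<Rightarrow> real" where
  "tilted p s = p * exp (- s) / (1 - p + p * exp (- s))"

context
  fixes p :: real
  assumes p: "0 < p" "p < 1"
begin

lemma tilted_bounds: "0 < tilted p s" "tilted p s < 1"
  using p cgf_arg_pos[OF p, of s] by (auto simp: tilted_def field_simps)

lemma tilted_0 [simp]: "tilted p 0 = p"
  by (simp add: tilted_def)

text \<open>The density of the original law against the tilted one is exp(s e - card D
  \<open>cgf p s\<close>) with e the number of edges, so a lower bound on e bounds the density from
  below.\<close>

lemma prob_coins_tilt:
  assumes "finite D" "s \<ge> 0"
  shows "exp (s * m - card D * cgf p s) *
      measure_pmf.prob (coins D (tilted p s)) {X. Q X \<and> m \<le> real (card {e\<in>D. X e})} \<le>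
    measure_pmf.prob (coins D p) {X. Q X}"
proof -
  let ?Supp = "\<lambda>X. \<forall>e. e \<notin> D \<longrightarrow> \<not> X e"
  let ?b = "\<lambda>X. \<Prod>e\<in>D. pmf (bernoulli_pmf (tilted p s)) (X e)"
  let ?c = "\<lambda>X. real (card {e\<in>D. X e})"
  have "{X. ?Supp X} = PiE_dflt D False (\<lambda>_. UNIV)"
    by (auto simp: PiE_dflt_def)
  hence fin: "finite {X. ?Supp X}" using assms by (auto intro!: finite_PiE_dflt)
  have density: "pmf (bernoulli_pmf p) y =
      exp ((if y then s else 0) - cgf p s) * pmf (bernoulli_pmf (tilted p s)) y" for y
  proof (cases y)
    case True
    define Z where "Z = 1 - p + p * exp (- s)"
    have "Z > 0" using cgf_arg_pos[OF p, of s] by (simp add: Z_def)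
    have "exp (s - cgf p s) * tilted p s = exp s * exp (- cgf p s) * tilted p s"
      by (simp add: exp_add[symmetric])
    also have "\<dots> = exp s * Z * (p * exp (- s) / Z)"
      unfolding exp_minus_cgf[OF p] tilted_def Z_def ..
    also have "\<dots> = p * (exp s * exp (- s))" using \<open>Z > 0\<close> by simp
    also have "\<dots> = p" by (simp add: exp_minus)
    finally have "exp (s - cgf p s) * tilted p s = p" .
    thus ?thesis using True p tilted_bounds[of s] by simp
  next
    case False
    have "exp (- cgf p s) * (1 - tilted p s) = 1 - p"
      unfolding exp_minus_cgf[OF p] tilted_def
      using cgf_arg_pos[OF p, of s] by (simp add: right_diff_distrib)
    thus ?thesis using False p tilted_bounds[of s] by simp
  qed
  have dens: "(\<Prod>e\<in>D. pmf (bernoulli_pmf p) (X e)) = exp (s * ?c X - card D * cgf p s) * ?b X" for X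
  proof -
    have "(\<Sum>e\<in>D. (if X e then s else 0) - cgf p s) = s * ?c X - card D * cgf p s"
      using assms by (simp add: sum_subtractf sum.If_cases Int_def)
    thus ?thesis
      unfolding density prod.distrib exp_sum[OF assms(1), symmetric] by simp
  qed
  have nn: "?b X \<ge> 0" for X by (intro prod_nonneg) auto
  have "exp (s * m - card D * cgf p s) *
      measure_pmf.prob (coins D (tilted p s)) {X. Q X \<and> m \<le> ?c X} =
      (\<Sum>X | (Q X \<and> m \<le> ?c X) \<and> ?Supp X. exp (s * m - card D * cgf p s) * ?b X)"
    unfolding prob_coins_sum[OF assms(1)] by (simp add: sum_distrib_left)
  also have "\<dots> \<le> (\<Sum>X | (Q X \<and> m \<le> ?c X) \<and> ?Supp X. exp (s * ?c X - card D * cgf p s) * ?b X)"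
    using assms nn by (intro sum_mono mult_right_mono) (auto intro!: mult_left_mono)
  also have "\<dots> \<le> (\<Sum>X | Q X \<and> ?Supp X. exp (s * ?c X - card D * cgf p s) * ?b X)"
    by (intro sum_mono2 mult_nonneg_nonneg nn finite_subset[OF _ fin]) auto
  also have "\<dots> = measure_pmf.prob (coins D p) {X. Q X}"
    unfolding prob_coins_sum[OF assms(1)] dens ..
  finally show ?thesis .
qed

text \<open>Under the tilted law dependence is typical: mean degrees are (k - 1)
  \<open>tilted p s\<close>, and \<open>t\<close> leaves room \<delta> per pair. The k + 1 bad
  events are one excessive degree for each vertex and too few edges in total.\<close>

lemma prob_dependent_tilt:
  assumes B: "finite B" "card B \<ge> 2" and s: "s \<ge> 0" and "\<delta> \<ge> 0"
    and t: "(real (card B) - 1) * (tilted p s + \<delta>) \<le> t"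
  defines "k \<equiv> card B" and "N \<equiv> real (card (nsets B 2))"
  shows "exp (s * (N * (tilted p s - \<delta>)) - N * cgf p s) *
      (1 - (real k + 1) * exp (- 2 * (real k - 1) * \<delta>\<^sup>2)) \<le>
    measure_pmf.prob (coins (nsets B 2) p) {X. deg_le t (nsets B 2) B X}"
proof -
  let ?D = "nsets B 2" and ?q = "tilted p s"
  let ?P = "measure_pmf.prob (coins ?D ?q)"
  let ?m = "N * (?q - \<delta>)"
  have k: "k \<ge> 2" using B by (simp add: k_def)
  have finD: "finite ?D" using B finite_imp_finite_nsets by blast
  have q: "0 \<le> ?q" "?q \<le> 1" using tilted_bounds[of s] by auto
  have Nk: "N = k choose 2" using B by (simp add: N_def k_def card_nsets)
  \<comment> \<open>Lets the edge count share the Hoeffding bound of the degrees.\<close>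
  have N_ge: "real k - 1 \<le> N"
  proof -
    have "2 * (real k - 1) \<le> real k * (real k - 1)" using k by (intro mult_right_mono) auto
    thus ?thesis unfolding Nk real_choose_two using k by (simp add: of_nat_diff)
  qed
  let ?star = "\<lambda>v. {e \<in> ?D. v \<in> e}"
  let ?bad = "\<lambda>v. {X. real (card {e\<in>?star v. X e}) \<ge> card (?star v) * ?q + (real k - 1) * \<delta>}"
  let ?few = "{X. real (card {e\<in>?D. X e}) \<le> card ?D * ?q - N * \<delta>}"
  have bad: "?P (?bad v) \<le> exp (- 2 * (real k - 1) * \<delta>\<^sup>2)" if "v \<in> B" for v
  proof -
    have c: "card (?star v) = k - 1" using card_star[OF B(1) that] by (simp add: k_def)
    hence "?star v \<noteq> {}" using k by (intro notI) simp
    hence "?P (?bad v) \<le> exp (- 2 * ((real k - 1) * \<delta>)\<^sup>2 / card (?star v))"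
      using q \<open>\<delta> \<ge> 0\<close> k finD by (intro hoeffding_coins) auto
    also have "- 2 * ((real k - 1) * \<delta>)\<^sup>2 / card (?star v) = - 2 * (real k - 1) * \<delta>\<^sup>2"
      proof -
      have "- 2 * (y * \<delta>)\<^sup>2 / y = - 2 * y * \<delta>\<^sup>2" if "y > 0" for y :: real
        using that by (simp add: power2_eq_square)
      from this[of "real k - 1"] show ?thesis unfolding c using k by (simp add: of_nat_diff)
    qed
    finally show ?thesis .
  qed
  have few: "?P ?few \<le> exp (- 2 * (real k - 1) * \<delta>\<^sup>2)"
  proof -
    have "N > 0" using N_ge k by simp
    hence "?D \<noteq> {}" unfolding N_def by (metis card.empty of_nat_0 less_irrefl)
    hence "?P ?few \<le> exp (- 2 * (N * \<delta>)\<^sup>2 / card ?D)"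
      using q \<open>\<delta> \<ge> 0\<close> finD N_ge by (intro hoeffding_coins) (auto simp: N_def)
    also have "- 2 * (N * \<delta>)\<^sup>2 / card ?D = - 2 * N * \<delta>\<^sup>2"
      using \<open>N > 0\<close> unfolding N_def[symmetric] by (simp add: power2_eq_square)
    also have "exp \<dots> \<le> exp (- 2 * (real k - 1) * \<delta>\<^sup>2)"
      using mult_right_mono[OF N_ge, of "\<delta>\<^sup>2"] by (simp add: algebra_simps)
    finally show ?thesis .
  qed
  let ?Q = "{X. deg_le t ?D B X \<and> ?m \<le> real (card {e\<in>?D. X e})}"
  have "- ?Q \<subseteq> (\<Union>v\<in>B. ?bad v) \<union> ?few"
  proof
    fix X assume X: "X \<in> - ?Q"
    show "X \<in> (\<Union>v\<in>B. ?bad v) \<union> ?few"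
    proof (cases "deg_le t ?D B X")
      case True
      hence "real (card {e\<in>?D. X e}) < ?m" using X by auto
      moreover have "?m = card ?D * ?q - N * \<delta>"
        unfolding N_def[symmetric] by (simp add: algebra_simps)
      ultimately have "X \<in> ?few" by (simp only: mem_Collect_eq)
      thus ?thesis by blast
    next
      case False
      then obtain v where v: "v \<in> B" "card {e\<in>?D. v \<in> e \<and> X e} > t"
        by (auto simp: deg_le_def not_le)
      have "card (?star v) * ?q + (real k - 1) * \<delta> = (real k - 1) * (?q + \<delta>)"
        using card_star[OF B(1) v(1)] k by (simp add: k_def of_nat_diff algebra_simps)
      also have "\<dots> \<le> t" using t by (simp add: k_def)
      also have "\<dots> \<le> real (card {e\<in>?D. v \<in> e \<and> X e})" using v by simp
      finally have "X \<in> ?bad v" by (simp add: conj_assoc)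
      with v show ?thesis by blast
    qed
  qed
  hence "?P (- ?Q) \<le> ?P ((\<Union>v\<in>B. ?bad v) \<union> ?few)"
    by (intro measure_pmf.finite_measure_mono) auto
  also have "\<dots> \<le> ?P (\<Union>v\<in>B. ?bad v) + ?P ?few"
    by (intro measure_subadditive) auto
  also have "?P (\<Union>v\<in>B. ?bad v) \<le> (\<Sum>v\<in>B. ?P (?bad v))"
    by (intro measure_pmf.finite_measure_subadditive_finite) (use B in auto)
  also have "\<dots> \<le> (\<Sum>v\<in>B. exp (- 2 * (real k - 1) * \<delta>\<^sup>2))"
    by (intro sum_mono bad)
  also have "\<dots> = k * exp (- 2 * (real k - 1) * \<delta>\<^sup>2)" by (simp add: k_def)
  also note few
  finally have "?P (- ?Q) \<le> (real k + 1) * exp (- 2 * (real k - 1) * \<delta>\<^sup>2)"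
    by (simp add: algebra_simps)
  moreover have "?P (- ?Q) = 1 - ?P ?Q"
    using measure_pmf.prob_compl[of ?Q "coins ?D ?q"] by (simp add: Compl_eq_Diff_UNIV)
  ultimately have "1 - (real k + 1) * exp (- 2 * (real k - 1) * \<delta>\<^sup>2) \<le> ?P ?Q" by linarith
  hence "exp (s * ?m - N * cgf p s) * (1 - (real k + 1) * exp (- 2 * (real k - 1) * \<delta>\<^sup>2)) \<le>
      exp (s * ?m - N * cgf p s) * ?P ?Q"
    by (intro mult_left_mono) auto
  also have "\<dots> \<le> measure_pmf.prob (coins ?D p) {X. deg_le t ?D B X}"
    using prob_coins_tilt[OF finD s, of ?m "deg_le t ?D B"] by (simp add: N_def)
  finally show ?thesis .
qed

text \<open>Solves for the tilt with a prescribed mean. The bound on s keeps the loss s \<delta>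
  under control when x stays away from 0.\<close>

lemma tilted_surj:
  assumes "0 < x" "x \<le> p"
  obtains s where "s \<ge> 0" "tilted p s = x" "s \<le> ln (p / ((1 - p) * x))"
proof -
  define s where "s = ln (p * (1 - x) / ((1 - p) * x))"
  have "(1 - p) * x \<le> p * (1 - x)" using assms p by (simp add: algebra_simps)
  moreover have pos: "(1 - p) * x > 0" using assms p by simp
  ultimately have ge1: "p * (1 - x) / ((1 - p) * x) \<ge> 1" by simp
  hence "s \<ge> 0" unfolding s_def by simp
  have "exp (- s) = (1 - p) * x / (p * (1 - x))"
    unfolding s_def exp_minus using ge1 by (subst exp_ln) auto
  hence "p * exp (- s) = (1 - p) * x / (1 - x)" using p by simp
  moreover from this have "1 - p + p * exp (- s) = (1 - p) / (1 - x)"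
    using assms p by (simp add: field_simps)
  ultimately have "tilted p s = ((1 - p) * x / (1 - x)) / ((1 - p) / (1 - x))"
    unfolding tilted_def by simp
  hence "tilted p s = x" using assms p by simp
  have "s \<le> ln (p / ((1 - p) * x))"
  proof -
    have "p * (1 - x) / ((1 - p) * x) \<le> p / ((1 - p) * x)"
      using pos assms p by (intro divide_right_mono) auto
    thus ?thesis unfolding s_def using ge1 by (intro ln_mono) auto
  qed
  show ?thesis by (rule that) fact+
qed

text \<open>The moment bound is sharp up to exp(-\<eta> k^2) for a suitable s. This s is chosen
  before \<open>V\<close> and \<open>B\<close> because the same tilt must afterwards serve in the
  upper bound for the part of a set outside an overlap.\<close>

lemma prob_dependent_lower:
  assumes "\<eta> > 0"
  shows "\<exists>K::nat. \<forall>k\<ge>K. \<forall>t::nat. \<exists>s\<ge>0. \<forall>(V :: 'a set) B. finite V \<longrightarrow> B \<subseteq> V \<longrightarrow> card B = k \<longrightarrow>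
    exp (real k / 2 * (s * real t - (real k - 1) * cgf p s) - \<eta> * (real k)\<^sup>2) \<le>
    measure_pmf.prob (coins (nsets V 2) p) {X. deg_le t (nsets B 2) B X}"
proof -
  \<comment> \<open>For very small t edgeless sets suffice: at tilt \<open>S\<close> the exponent
    per pair is within \<eta> of ln (1 - p), and below 2 \<open>\<delta>0\<close> the term S x costs
    at most another \<eta>. With fewer than k^2/2 pairs this fits into \<eta> k^2.\<close>
  have "- ln (1 - p) - \<eta> < - ln (1 - p)" using assms by simp
  then obtain S where S: "S > 0" "- ln (1 - p) - \<eta> < cgf p S" by (rule cgf_approx_sup[OF p])
  define \<delta>0 where "\<delta>0 = \<eta> / (2 * S)"
  have \<delta>0: "\<delta>0 > 0" using S assms by (simp add: \<delta>0_def)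
  \<comment> \<open>Bounds all tilts of the middle range, so that \<delta> can be fixed before k and
    t with s \<delta> at most \<eta>/2.\<close>
  define S' where "S' = \<bar>ln (p / ((1 - p) * \<delta>0))\<bar> + 1"
  define \<delta> where "\<delta> = min \<delta>0 (\<eta> / (2 * S'))"
  have S': "S' > 0" by (simp add: S'_def)
  have \<delta>: "\<delta> > 0" "\<delta> \<le> \<delta>0" "\<delta> \<le> \<eta> / (2 * S')" using \<delta>0 assms S' by (auto simp: \<delta>_def)
  have "eventually (\<lambda>k::nat. (real k + 1) * exp (- 2 * (real k - 1) * \<delta>\<^sup>2) < 1 / 2) at_top"
    using \<delta>(1) by real_asymp
  moreover have "eventually (\<lambda>k::nat. ln 2 < \<eta> / 2 * (real k)\<^sup>2) at_top"
    using assms by real_asymp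
  ultimately have "eventually (\<lambda>k::nat. k \<ge> 2 \<and> (real k + 1) * exp (- 2 * (real k - 1) * \<delta>\<^sup>2) < 1 / 2 \<and>
      ln 2 < \<eta> / 2 * (real k)\<^sup>2) at_top"
    using eventually_ge_at_top[of 2] by eventually_elim auto
  then obtain K where K: "\<And>k. k \<ge> K \<Longrightarrow> k \<ge> 2 \<and> (real k + 1) * exp (- 2 * (real k - 1) * \<delta>\<^sup>2) < 1 / 2 \<and>
      ln 2 < \<eta> / 2 * (real k)\<^sup>2"
    unfolding eventually_at_top_linorder by blast
  show ?thesis
  proof (intro exI[of _ K] allI impI)
    fix k t :: nat assume "k \<ge> K"
    note K = K[OF this]
    define x where "x = t / (real k - 1)"
    have k1: "real k - 1 > 0" using K by simp
    have tx: "real t = x * (real k - 1)" using k1 by (simp add: x_def)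
    define N where "N = real (k choose 2)"
    have N: "N = k * (real k - 1) / 2"
      using K by (simp add: N_def real_choose_two)
    have Nk2: "2 * N \<le> (real k)\<^sup>2" "N \<ge> 0" using k1 by (simp_all add: N power2_eq_square algebra_simps)
    have half: "k / 2 * (s * real t - (real k - 1) * cgf p s) = N * (s * x - cgf p s)" for s
      by (simp add: N tx algebra_simps)
    have core: "exp (- ln 2 + (s * (N * (tilted p s - \<delta>)) - N * cgf p s)) \<le>
        measure_pmf.prob (coins (nsets V 2) p) {X. deg_le t (nsets B 2) B X}"
      if V: "finite V" "B \<subseteq> V" "card B = k" and s: "s \<ge> 0" "tilted p s + \<delta> \<le> x" for s V and B :: "'a set"
    proof -
      have finB: "finite B" using V finite_subset by blast
      have cN: "real (card (nsets B 2)) = N" using V finB by (simp add: card_nsets N_def)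
      have "(real k - 1) * (tilted p s + \<delta>) \<le> t"
        using s k1 by (simp add: tx mult.commute)
      hence "exp (s * (N * (tilted p s - \<delta>)) - N * cgf p s) *
          (1 - (real k + 1) * exp (- 2 * (real k - 1) * \<delta>\<^sup>2)) \<le>
        measure_pmf.prob (coins (nsets B 2) p) {X. deg_le t (nsets B 2) B X}"
        using prob_dependent_tilt[OF finB _ s(1) less_imp_le[OF \<delta>(1)], of t] K
        unfolding cN V(3) by blast
      moreover have "1 / 2 \<le> 1 - (real k + 1) * exp (- 2 * (real k - 1) * \<delta>\<^sup>2)"
        using K by simp
      ultimately have "exp (s * (N * (tilted p s - \<delta>)) - N * cgf p s) * (1 / 2) \<le>
          measure_pmf.prob (coins (nsets B 2) p) {X. deg_le t (nsets B 2) B X}"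
        by (meson exp_ge_zero mult_left_mono order.trans)
      moreover have "exp (- ln 2 :: real) = 1 / 2" by (simp add: exp_minus)
      moreover have "measure_pmf.prob (coins (nsets V 2) p) {X. deg_le t (nsets B 2) B X} =
          measure_pmf.prob (coins (nsets B 2) p) {X. deg_le t (nsets B 2) B X}"
        using V by (intro prob_coins_restrict determined_by_deg_le finite_imp_finite_nsets nsets_mono)
      ultimately show ?thesis unfolding exp_add by (simp only: mult.commute)
    qed
    \<comment> \<open>x is the allowed fraction of neighbours. Above p + \<delta> no tilt is
      required, near 0 edgeless sets do, and in between the tilted mean is set to x -
      \<delta>.\<close>
    consider "x \<ge> p + \<delta>" | "x < 2 * \<delta>0" | "x < p + \<delta>" "x \<ge> 2 * \<delta>0" by linarith
    hence "\<exists>s\<ge>0. \<forall>(V :: 'a set) B. finite V \<longrightarrow> B \<subseteq> V \<longrightarrow> card B = k \<longrightarrow>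
        exp (real k / 2 * (s * real t - (real k - 1) * cgf p s) - \<eta> * (real k)\<^sup>2) \<le>
        measure_pmf.prob (coins (nsets V 2) p) {X. deg_le t (nsets B 2) B X}"
    proof cases
      case 1
      have "\<eta> / 2 * (real k)\<^sup>2 \<le> \<eta> * (real k)\<^sup>2" using assms by (intro mult_right_mono) auto
      hence e: "- (\<eta> * (real k)\<^sup>2) \<le> - ln 2" using K by linarith
      show ?thesis
      proof (rule exI[of _ "0"], intro conjI allI impI)
        fix V B :: "'a set" assume V: "finite V" "B \<subseteq> V" "card B = k"
        have "exp (real k / 2 * (0 * real t - (real k - 1) * cgf p 0) - \<eta> * (real k)\<^sup>2) \<le> exp (- ln 2)"
          using e cgf_0[OF p] by simp
        also have "\<dots> \<le> measure_pmf.prob (coins (nsets V 2) p) {X. deg_le t (nsets B 2) B X}"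
          using core[OF V, of 0] 1 cgf_0[OF p] by simp
        finally show "exp (real k / 2 * (0 * real t - (real k - 1) * cgf p 0) - \<eta> * (real k)\<^sup>2) \<le>
          measure_pmf.prob (coins (nsets V 2) p) {X. deg_le t (nsets B 2) B X}" .
      qed simp
    next
      case 2
      show ?thesis
      proof (rule exI[of _ "S"], intro conjI allI impI)
        fix V B :: "'a set" assume V: "finite V" "B \<subseteq> V" "card B = k"
        have finB: "finite B" using V finite_subset by blast
        have cN: "real (card (nsets B 2)) = N" using V finB by (simp add: card_nsets N_def)
        have "S * x \<le> S * (2 * \<delta>0)" using 2 S by (intro mult_left_mono) auto
        also have "\<dots> = \<eta>" using S by (simp add: \<delta>0_def)
        finally have "S * x - cgf p S - 2 * \<eta> \<le> ln (1 - p)" using S by linarith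
        hence "N * (S * x - cgf p S - 2 * \<eta>) \<le> N * ln (1 - p)" using Nk2 by (intro mult_left_mono) auto
        moreover have "\<eta> * (2 * N) \<le> \<eta> * (real k)\<^sup>2" using Nk2 assms by (intro mult_left_mono) auto
        ultimately have "N * (S * x - cgf p S) - \<eta> * (real k)\<^sup>2 \<le> N * ln (1 - p)"
          by (simp add: algebra_simps)
        hence "exp (real k / 2 * (S * real t - (real k - 1) * cgf p S) - \<eta> * (real k)\<^sup>2) \<le> exp (N * ln (1 - p))"
          unfolding half by simp
        also have "\<dots> = (1 - p) ^ card (nsets B 2)"
          unfolding cN[symmetric] using p by (simp add: exp_of_nat_mult)
        also have "\<dots> = measure_pmf.prob (coins (nsets V 2) p) {X. \<forall>e\<in>nsets B 2. \<not> X e}"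
          using V p by (intro prob_no_edges[symmetric] finite_imp_finite_nsets nsets_mono) auto
        also have "\<dots> \<le> measure_pmf.prob (coins (nsets V 2) p) {X. deg_le t (nsets B 2) B X}"
        proof (intro measure_pmf.finite_measure_mono subsetI, clarify)
          fix X :: "'a set \<Rightarrow> bool" assume "\<forall>e\<in>nsets B 2. \<not> X e"
          hence none: "{e \<in> nsets B 2. v \<in> e \<and> X e} = {}" for v by auto
          show "deg_le t (nsets B 2) B X" unfolding deg_le_def none by simp
        qed auto
        finally show "exp (real k / 2 * (S * real t - (real k - 1) * cgf p S) - \<eta> * (real k)\<^sup>2) \<le>
          measure_pmf.prob (coins (nsets V 2) p) {X. deg_le t (nsets B 2) B X}" .
      qed (use S in simp)
    next
      case 3
      have x: "0 < x - \<delta>" "x - \<delta> \<le> p" "\<delta>0 \<le> x - \<delta>" using 3 \<delta> \<delta>0 by auto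
      obtain s where s: "s \<ge> 0" "tilted p s = x - \<delta>" "s \<le> ln (p / ((1 - p) * (x - \<delta>)))"
        using tilted_surj[OF x(1,2)] by blast
      have "p / ((1 - p) * (x - \<delta>)) \<le> p / ((1 - p) * \<delta>0)"
        using x p \<delta>0 by (intro divide_left_mono mult_left_mono) auto
      hence "ln (p / ((1 - p) * (x - \<delta>))) \<le> ln (p / ((1 - p) * \<delta>0))"
        using x p by (intro ln_mono) auto
      hence "s \<le> S'" using s(3) unfolding S'_def by linarith
      hence "s * \<delta> \<le> S' * (\<eta> / (2 * S'))" using \<delta> S' by (intro mult_mono) auto
      hence s\<delta>: "s * \<delta> \<le> \<eta> / 2" using S' by simp
      show ?thesis
      proof (rule exI[of _ "s"], intro conjI allI impI)
        fix V B :: "'a set" assume V: "finite V" "B \<subseteq> V" "card B = k"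
        have "(2 * N) * (s * \<delta>) \<le> (real k)\<^sup>2 * (\<eta> / 2)"
          using Nk2 s\<delta> s \<delta> by (intro mult_mono) auto
        hence "N * (s * x - cgf p s) - \<eta> * (real k)\<^sup>2 \<le> - ln 2 + (s * (N * (tilted p s - \<delta>)) - N * cgf p s)"
          using K unfolding s(2) by (simp add: algebra_simps)
        hence "exp (real k / 2 * (s * real t - (real k - 1) * cgf p s) - \<eta> * (real k)\<^sup>2) \<le>
            exp (- ln 2 + (s * (N * (tilted p s - \<delta>)) - N * cgf p s))"
          unfolding half by simp
        also have "\<dots> \<le> measure_pmf.prob (coins (nsets V 2) p) {X. deg_le t (nsets B 2) B X}"
          using core[OF V s(1)] s(2) by simp
        finally show "exp (real k / 2 * (s * real t - (real k - 1) * cgf p s) - \<eta> * (real k)\<^sup>2) \<le>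
          measure_pmf.prob (coins (nsets V 2) p) {X. deg_le t (nsets B 2) B X}" .
      qed (use s in simp)
    qed
    thus "\<exists>s\<ge>0. \<forall>(V :: 'a set) B. finite V \<longrightarrow> B \<subseteq> V \<longrightarrow> card B = k \<longrightarrow>
        exp (real k / 2 * (s * real t - (real k - 1) * cgf p s) - \<eta> * (real k)\<^sup>2) \<le>
        measure_pmf.prob (coins (nsets V 2) p) {X. deg_le t (nsets B 2) B X}" .
  qed
qed

end

section \<open>Dependent subsets of large vertex sets\<close>

text \<open>Lowering the lower index by one multiplies the binomial coefficient by at most k / (m -
  k); this is iterated l times.\<close>

lemma binomial_shift_le:
  "l \<le> k \<Longrightarrow> k \<le> m \<Longrightarrow> (m choose (k - l)) * (m - k) ^ l \<le> (m choose k) * k ^ l"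
proof (induction l)
  case (Suc l)
  define j where "j = k - Suc l"
  have j: "Suc j = k - l" "j < k" "j < m" using Suc.prems by (auto simp: j_def)
  have "(m choose j) * (m - k) \<le> (m choose j) * (m - j)"
    using j by (intro mult_le_mono) auto
  also have "\<dots> = Suc j * (m choose Suc j)"
    using binomial_absorb_comp[of m j] Suc_times_binomial_eq[of "m - 1" j] j
    by (cases m) (auto simp: mult.commute)
  also have "\<dots> \<le> k * (m choose Suc j)" using j by (intro mult_le_mono) auto
  finally have "(m choose j) * (m - k) * (m - k) ^ l \<le> k * (m choose (k - l)) * (m - k) ^ l"
    unfolding j(1) by (rule mult_le_mono1)
  also have "\<dots> = k * ((m choose (k - l)) * (m - k) ^ l)" by simp
  also have "\<dots> \<le> k * ((m choose k) * k ^ l)" by (intro mult_le_mono2 Suc.IH) (use Suc.prems in auto)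
  finally show ?case by (simp add: j_def mult_ac)
qed simp

text \<open>The common part is chosen in at most k^l ways and the remaining k - l elements outside
  A; replacing k - l by k in the binomial gains (k / (m - k))^l.\<close>

lemma card_fixed_overlap_le:
  assumes W: "finite W" "A \<in> nsets W k" and l: "l \<le> k" and k: "k < card W"
  shows "real (card {B \<in> nsets W k. card (A \<inter> B) = l}) \<le>
    card (nsets W k) * ((real k)\<^sup>2 / (real (card W) - k)) ^ l"
proof -
  let ?m = "card W"
  have A: "A \<subseteq> W" "finite A" "card A = k" using W by (auto simp: nsets_def)
  have "card {B \<in> nsets W k. card (A \<inter> B) = l} \<le> card (nsets A l \<times> nsets (W - A) (k - l))"
  proof (rule card_inj_on_le[where f = "\<lambda>B. (A \<inter> B, B - A)"])
    show "inj_on (\<lambda>B. (A \<inter> B, B - A)) {B \<in> nsets W k. card (A \<inter> B) = l}"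
      by (auto simp: inj_on_def)
    show "(\<lambda>B. (A \<inter> B, B - A)) ` {B \<in> nsets W k. card (A \<inter> B) = l} \<subseteq> nsets A l \<times> nsets (W - A) (k - l)"
      using A by (auto simp: nsets_def card_Diff_subset_Int Int_commute)
    show "finite (nsets A l \<times> nsets (W - A) (k - l))"
      using A W by (auto intro: finite_imp_finite_nsets)
  qed
  also have "\<dots> = (k choose l) * ((?m - k) choose (k - l))"
    using A W by (simp add: card_cartesian_product card_nsets card_Diff_subset)
  also have "\<dots> \<le> k ^ l * (?m choose (k - l))"
    using l by (intro mult_le_mono binomial_le_pow binomial_right_mono) auto
  finally have "card {B \<in> nsets W k. card (A \<inter> B) = l} * (?m - k) ^ l \<le>
      k ^ l * ((?m choose (k - l)) * (?m - k) ^ l)"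
    by (simp add: mult.assoc[symmetric] del: of_nat_mult)
  also have "\<dots> \<le> k ^ l * ((?m choose k) * k ^ l)"
    using l k by (intro mult_le_mono binomial_shift_le) auto
  finally have "real (card {B \<in> nsets W k. card (A \<inter> B) = l} * (?m - k) ^ l) \<le>
      real (k ^ l * ((?m choose k) * k ^ l))" by (subst of_nat_le_iff)
  hence "real (card {B \<in> nsets W k. card (A \<inter> B) = l}) * (real ?m - k) ^ l \<le>
      card (nsets W k) * ((real k)\<^sup>2) ^ l"
    using k W by (simp add: of_nat_diff card_nsets power2_eq_square power_mult_distrib mult_ac)
  thus ?thesis using k by (simp add: power_divide field_simps)
qed

text \<open>Janson with the indicator of \<open>dep A\<close> scaled by w / P(dep A): every mean
  becomes \<open>w\<close>, so the total mean can be tuned below the expected number.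
  \<open>R\<close> is the factor by which an overlap raises the joint probability; sets with at most
  one common vertex share no pair and do not enter the sum.\<close>

lemma prob_no_dependent_subset:
  fixes R :: "nat \<Rightarrow> real" and t :: nat
  assumes p: "0 \<le> p" "p \<le> 1" and V: "finite V" "W \<subseteq> V" and k: "2 \<le> k" "k < card W"
  defines "P \<equiv> measure_pmf.prob (coins (nsets V 2) p)"
  defines "dep \<equiv> \<lambda>A. {X. deg_le t (nsets A 2) A X}"
  defines "M \<equiv> real (card (nsets W k))"
  assumes R: "\<And>l. R l \<ge> 0"
    and pair: "\<And>A B. A \<in> nsets W k \<Longrightarrow> B \<in> nsets W k \<Longrightarrow> 2 \<le> card (A \<inter> B) \<Longrightarrow>
      P (dep A \<inter> dep B) \<le> R (card (A \<inter> B)) * (P (dep A) * P (dep B))"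
    and w: "w > 0" "\<And>A. A \<in> nsets W k \<Longrightarrow> w \<le> P (dep A)"
  shows "P {X. \<forall>A\<in>nsets W k. X \<notin> dep A} \<le>
    exp (- (M * w) + (M * w)\<^sup>2 * (\<Sum>l=2..k. ((real k)\<^sup>2 / (real (card W) - k)) ^ l * R l))"
proof -
  let ?E = "measure_pmf.expectation (coins (nsets V 2) p)"
  let ?I = "nsets W k"
  define f where "f = (\<lambda>A X. w / P (dep A) * indicator (dep A) X :: real)"
  have finW: "finite W" by (rule finite_subset[OF V(2,1)])
  have finI: "finite ?I" using finW by (rule finite_imp_finite_nsets)
  have finV: "finite (nsets V 2)" using V(1) by (rule finite_imp_finite_nsets)
  have Ppos: "P (dep A) > 0" if "A \<in> ?I" for A using w(1) w(2)[OF that] by linarith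
  have fin2: "finite (nsets A 2)" if "A \<in> ?I" for A
    using that by (intro finite_imp_finite_nsets) (auto simp: nsets_def)
  have f01: "0 \<le> f A X" "f A X \<le> 1" if "A \<in> ?I" for A X
    using Ppos[OF that] w(1) w(2)[OF that] by (auto simp: f_def indicator_def)
  have anti: "antimono (f A)" if "A \<in> ?I" for A
  proof (rule antimonoI)
    fix X Y :: "'a set \<Rightarrow> bool" assume "X \<le> Y"
    hence "Y \<in> dep A \<Longrightarrow> X \<in> dep A"
      using deg_le_antimono[OF fin2[OF that] order.refl _ order.refl] by (auto simp: dep_def)
    thus "f A Y \<le> f A X" using Ppos[OF that] w(1) by (auto simp: f_def indicator_def)
  qed
  have det: "determined_by (nsets A 2) (f A)" for A
    using determined_by_deg_le[of "nsets A 2" t A]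
    by (auto simp: determined_by_def f_def dep_def indicator_def)
  have Ef: "?E (f A) = w" if "A \<in> ?I" for A
    using Ppos[OF that] by (simp add: f_def P_def)
  have Eff: "?E (\<lambda>X. f A X * f B X) \<le> w\<^sup>2 * R (card (A \<inter> B))"
    if AB: "A \<in> ?I" "B \<in> ?I" "2 \<le> card (A \<inter> B)" for A B
  proof -
    have "?E (\<lambda>X. f A X * f B X) = ?E (\<lambda>X. w / P (dep A) * (w / P (dep B)) * indicator (dep A \<inter> dep B) X)"
      by (intro Bochner_Integration.integral_cong) (auto simp: f_def indicator_def)
    also have "\<dots> = w / P (dep A) * (w / P (dep B)) * P (dep A \<inter> dep B)"
      by (simp add: P_def)
    also have "\<dots> \<le> w / P (dep A) * (w / P (dep B)) * (R (card (A \<inter> B)) * (P (dep A) * P (dep B)))"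
      using w(1) Ppos AB by (intro mult_left_mono pair) (auto intro!: mult_nonneg_nonneg divide_nonneg_pos)
    also have "\<dots> = w\<^sup>2 * R (card (A \<inter> B))"
      using Ppos[OF AB(1)] Ppos[OF AB(2)] by (simp add: power2_eq_square)
    finally show ?thesis .
  qed
  define \<theta> where "\<theta> = (real k)\<^sup>2 / (real (card W) - k)"
  have "P {X. \<forall>A\<in>?I. X \<notin> dep A} \<le> ?E (\<lambda>X. \<Prod>A\<in>?I. 1 - f A X)"
    unfolding P_def
  proof (rule prob_coins_le_expectation[OF finV])
    fix X assume "X \<in> {X. \<forall>A\<in>?I. X \<notin> dep A}"
    hence "(\<Prod>A\<in>?I. 1 - f A X) = (\<Prod>A\<in>?I. 1)" by (intro prod.cong) (auto simp: f_def)
    thus "1 \<le> (\<Prod>A\<in>?I. 1 - f A X)" by simp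
  qed (auto intro!: prod_nonneg f01)
  also have "\<dots> \<le> exp (- (\<Sum>A\<in>?I. ?E (f A)) +
      (\<Sum>A\<in>?I. \<Sum>B | B \<in> ?I \<and> nsets A 2 \<inter> nsets B 2 \<noteq> {}. ?E (\<lambda>X. f A X * f B X)))"
    by (rule janson_inequality[OF finV p finI anti det]) (use f01 in auto)
  also have "\<dots> \<le> exp (- (M * w) + (M * w)\<^sup>2 * (\<Sum>l=2..k. \<theta> ^ l * R l))"
  proof -
    have "(\<Sum>A\<in>?I. ?E (f A)) = M * w" using Ef by (simp add: M_def)
    moreover have "(\<Sum>B | B \<in> ?I \<and> nsets A 2 \<inter> nsets B 2 \<noteq> {}. ?E (\<lambda>X. f A X * f B X)) \<le>
        M * w\<^sup>2 * (\<Sum>l=2..k. \<theta> ^ l * R l)" if A: "A \<in> ?I" for A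
    proof -
      have finA: "finite A" "card A = k" using A by (auto simp: nsets_def)
      let ?J = "{B. B \<in> ?I \<and> nsets A 2 \<inter> nsets B 2 \<noteq> {}}"
      have J: "2 \<le> card (A \<inter> B)" "card (A \<inter> B) \<le> k" if "B \<in> ?J" for B
      proof -
        obtain e where "e \<in> nsets A 2" "e \<in> nsets B 2" using \<open>B \<in> ?J\<close> by auto
        hence "e \<subseteq> A \<inter> B" "card e = 2" by (auto simp: nsets_def)
        thus "2 \<le> card (A \<inter> B)" using card_mono[of "A \<inter> B" e] finA by auto
        show "card (A \<inter> B) \<le> k" using card_mono[of A "A \<inter> B"] finA by auto
      qed
      have "(\<Sum>B\<in>?J. ?E (\<lambda>X. f A X * f B X)) \<le> (\<Sum>B\<in>?J. w\<^sup>2 * R (card (A \<inter> B)))"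
        by (intro sum_mono Eff A) (use J in auto)
      also have "\<dots> = (\<Sum>l=2..k. \<Sum>B | B \<in> ?J \<and> card (A \<inter> B) = l. w\<^sup>2 * R (card (A \<inter> B)))"
        proof (rule sum.group[symmetric])
        show "(\<lambda>B. card (A \<inter> B)) ` ?J \<subseteq> {2..k}"
        proof (rule image_subsetI)
          fix B assume "B \<in> ?J"
          from J[OF this] show "card (A \<inter> B) \<in> {2..k}" by simp
        qed
      qed (use finI in auto)
      also have "\<dots> \<le> (\<Sum>l=2..k. M * w\<^sup>2 * (\<theta> ^ l * R l))"
      proof (rule sum_mono)
        fix l assume l: "l \<in> {2..k}"
        have "(\<Sum>B | B \<in> ?J \<and> card (A \<inter> B) = l. w\<^sup>2 * R (card (A \<inter> B))) =
            real (card {B. B \<in> ?J \<and> card (A \<inter> B) = l}) * (w\<^sup>2 * R l)"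
          by simp
        also have "\<dots> \<le> real (card {B \<in> ?I. card (A \<inter> B) = l}) * (w\<^sup>2 * R l)"
          using finI R by (intro mult_right_mono of_nat_mono card_mono mult_nonneg_nonneg) auto
        also have "\<dots> \<le> (M * \<theta> ^ l) * (w\<^sup>2 * R l)"
          unfolding M_def \<theta>_def using l R
          by (intro mult_right_mono card_fixed_overlap_le[OF finW A _ k(2)] mult_nonneg_nonneg) auto
        finally show "(\<Sum>B | B \<in> ?J \<and> card (A \<inter> B) = l. w\<^sup>2 * R (card (A \<inter> B))) \<le> M * w\<^sup>2 * (\<theta> ^ l * R l)"
          by (simp add: mult_ac)
      qed
      finally show ?thesis by (simp add: sum_distrib_left)
    qed
    hence "(\<Sum>A\<in>?I. \<Sum>B | B \<in> ?I \<and> nsets A 2 \<inter> nsets B 2 \<noteq> {}. ?E (\<lambda>X. f A X * f B X)) \<le>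
        (\<Sum>A\<in>?I. M * w\<^sup>2 * (\<Sum>l=2..k. \<theta> ^ l * R l))"
      by (rule sum_mono)
    moreover have "(\<Sum>A\<in>?I. M * w\<^sup>2 * (\<Sum>l=2..k. \<theta> ^ l * R l)) = (M * w)\<^sup>2 * (\<Sum>l=2..k. \<theta> ^ l * R l)"
      by (simp add: M_def power2_eq_square mult_ac)
    ultimately show ?thesis unfolding exp_le_cancel_iff by linarith
  qed
  finally show ?thesis unfolding \<theta>_def .
qed

text \<open>\<open>g\<close> bounds the cost of one vertex at tilt \<open>s\<close>, and
  \<open>H\<close> is the error of the lower bound. The power of 1/(1-p) is good for small overlaps.
  For large ones the moment bound on the k - l vertices outside is compared with the lower bound on
  all k, losing e^g per common vertex and e^H once.\<close>

lemma prob_two_dependent_le_overlap: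
  fixes t k :: nat and g H :: real
  assumes p: "0 < p" "p < 1" and V: "finite V" "A \<subseteq> V" "B \<subseteq> V" and k: "card B = k" and s: "s \<ge> 0"
    and lower: "exp (real k / 2 * (s * real t - (real k - 1) * cgf p s) - H) \<le>
        measure_pmf.prob (coins (nsets V 2) p) {X. deg_le t (nsets B 2) B X}"
    and g: "(real k - 1) * cgf p s - s * real t \<le> 2 * g"
  defines "P \<equiv> measure_pmf.prob (coins (nsets V 2) p)"
  defines "dep \<equiv> \<lambda>A. {X. deg_le t (nsets A 2) A X}"
  shows "P (dep A \<inter> dep B) \<le>
    min ((1 / (1 - p)) ^ (card (A \<inter> B) choose 2)) (exp (card (A \<inter> B) * g + H)) * (P (dep A) * P (dep B))"
proof -
  let ?l = "card (A \<inter> B)"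
  define Q where "Q = P {X. deg_le t (nsets B 2 - nsets (A \<inter> B) 2) B X}"
  have "dep A \<inter> dep B = {X. deg_le t (nsets A 2) A X \<and> deg_le t (nsets B 2) B X}"
    by (auto simp: dep_def)
  hence 1: "P (dep A \<inter> dep B) \<le> P (dep A) * Q"
    using prob_two_dependent_le(1)[OF p V, of t] by (simp add: P_def dep_def Q_def)
  have 2: "Q \<le> (1 / (1 - p)) ^ (?l choose 2) * P (dep B)"
    using prob_two_dependent_le(2)[OF p V, of t] by (simp add: P_def dep_def Q_def power_divide)
  have finB: "finite B" by (rule finite_subset[OF V(3,1)])
  have c: "real (card (B - A)) = real k - ?l"
  proof -
    have "?l \<le> card B" using finB by (intro card_mono) auto
    thus ?thesis using k finB by (simp add: card_Diff_subset_Int Int_commute of_nat_diff)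
  qed
  define y where "y = s * real t - (real k - 1) * cgf p s"
  have "Q \<le> exp (card (B - A) / 2 * y)"
    using prob_two_dependent_le(3)[OF p V s, of t] k by (simp add: P_def Q_def y_def)
  also have "card (B - A) / 2 * y = (- ?l / 2 * y + H) + (real k / 2 * y - H)"
    unfolding c by (simp add: field_simps)
  also have "exp \<dots> = exp (- ?l / 2 * y + H) * exp (real k / 2 * y - H)"
    by (rule exp_add)
  also have "\<dots> \<le> exp (?l * g + H) * P (dep B)"
  proof (intro mult_mono)
    have "?l / 2 * ((real k - 1) * cgf p s - s * real t) \<le> ?l / 2 * (2 * g)"
      using g by (intro mult_left_mono) auto
    thus "exp (- ?l / 2 * y + H) \<le> exp (?l * g + H)"
      by (simp add: y_def algebra_simps)
  qed (use lower in \<open>auto simp: P_def dep_def y_def\<close>)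
  finally have 3: "Q \<le> exp (?l * g + H) * P (dep B)" .
  have "Q \<le> min ((1 / (1 - p)) ^ (?l choose 2)) (exp (?l * g + H)) * P (dep B)"
    using 2 3 by (simp add: min_def)
  hence "P (dep A) * Q \<le> P (dep A) * (min ((1 / (1 - p)) ^ (?l choose 2)) (exp (?l * g + H)) * P (dep B))"
    by (intro mult_left_mono) (auto simp: P_def)
  with 1 show ?thesis by (simp add: mult_ac)
qed

text \<open>Cleared of the denominator so as to include s = 0, a tilt that
  \<open>prob_dependent_lower\<close> may return.\<close>

lemma kappa_cgf_le:
  assumes p: "0 < p" "p < 1" and "\<tau> \<ge> 0" "s \<ge> 0"
  shows "kappa p \<tau> * cgf p s \<le> 2 + s * \<tau>"
proof (cases "s = 0")
  case False
  hence s: "s > 0" using assms by simp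
  show ?thesis using kappa_le[OF p \<open>\<tau> \<ge> 0\<close> s] cgf_pos[OF p s] by (simp add: field_simps)
qed (simp add: cgf_def)

text \<open>All constants depend on p, \<epsilon> and C, so the bound is uniform in t and W. Writing
  L = ln n, a common vertex costs about n^(-1) in counting, while below the threshold it is worth at
  most n^(1-\<epsilon>) in probability; this surplus makes \<Delta> small.\<close>

lemma eventually_large_subset_has_dependent:
  assumes p: "0 < p" "p < 1" and \<epsilon>: "0 < \<epsilon>" "\<epsilon> \<le> 1 / 5" and C: "C \<ge> 0"
  shows "eventually (\<lambda>n::nat. \<forall>t::nat. real t \<le> C * ln (real n) \<longrightarrow>
    (\<forall>W. W \<subseteq> {1..n} \<longrightarrow> card W = nat \<lceil>real n powr (1 - \<epsilon> / 8)\<rceil> \<longrightarrow>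
      measure_pmf.prob (coins (nsets {1..n} 2) p)
        {X. \<forall>A\<in>nsets W (nat \<lfloor>(1 - \<epsilon>) * kappa p (real t / ln (real n)) * ln (real n)\<rfloor>).
           \<not> deg_le t (nsets A 2) A X} \<le> exp (- (real n powr (3 / 2)) / 4))) at_top"
proof -
  define \<beta> where "\<beta> = - ln (1 - p)"
  have \<beta>: "\<beta> > 0" using p by (simp add: \<beta>_def)
  \<comment> \<open>Overlaps l below c L use the power of 1/(1-p); this \<open>c\<close> makes that
    factor at most n^(l/10).\<close>
  define c where "c = 1 / (5 * \<beta>)"
  define K where "K = kappa p C"
  define \<kappa>0 where "\<kappa>0 = kappa p 0"
  define \<gamma> where "\<gamma> = \<epsilon> / 8"
  have \<kappa>0: "\<kappa>0 = 2 / \<beta>" "\<kappa>0 > 0" using kappa_0[OF p] kappa_0_pos[OF p] by (simp_all add: \<kappa>0_def \<beta>_def)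
  have K: "\<kappa>0 \<le> K" using kappa_mono[OF p _ C] by (simp add: K_def \<kappa>0_def)
  have Kpos: "K > 0" using \<kappa>0 K by linarith
  have cpos: "c > 0" using \<beta> by (simp add: c_def)
  have "c \<le> \<kappa>0" unfolding \<kappa>0(1) c_def using \<beta> by (simp add: field_simps)
  hence cK: "c \<le> K" using K by linarith
  have \<gamma>: "\<gamma> > 0" "\<gamma> \<le> 1 / 40" using \<epsilon> by (auto simp: \<gamma>_def)
  \<comment> \<open>Chosen so that H = \<eta> k^2, with k at most K L, is at most (\<epsilon>/2) l L
    for every l >= c L.\<close>
  define \<eta> where "\<eta> = \<epsilon> * c / (2 * K\<^sup>2)"
  have \<eta>: "\<eta> > 0" using \<epsilon> cpos Kpos by (simp add: \<eta>_def)
  from prob_dependent_lower[OF p \<eta>, where 'a = nat]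
  obtain K0 :: nat where K0: "\<forall>k\<ge>K0. \<forall>t. \<exists>s\<ge>0. \<forall>(V :: nat set) B. finite V \<longrightarrow> B \<subseteq> V \<longrightarrow> card B = k \<longrightarrow>
      exp (real k / 2 * (s * real t - (real k - 1) * cgf p s) - \<eta> * (real k)\<^sup>2) \<le>
      measure_pmf.prob (coins (nsets V 2) p) {X. deg_le t (nsets B 2) B X}" ..
  \<comment> \<open>Minimal size of k: \<open>K0\<close> for the sharp lower bound, 2 for a pair to
    exist, and 6/\<epsilon> so that (\<epsilon>/4) k L covers the (3/2) L lost in bounding
    \<open>w\<close> by P(dep A).\<close>
  define Q where "Q = max (real K0) (max 2 (6 / \<epsilon>))"
  have "eventually (\<lambda>n::nat. (K * ln n)\<^sup>2 + K * ln n \<le> real n powr \<gamma>) at_top"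
    using \<gamma>(1) Kpos by real_asymp
  moreover have "eventually (\<lambda>n::nat. 7 \<le> c * \<epsilon> * ln n) at_top"
    using mult_pos_pos[OF cpos \<epsilon>(1)] by real_asymp
  moreover have "eventually (\<lambda>n::nat. K * ln n \<le> real n powr (1 / 5)) at_top"
    using Kpos by real_asymp
  moreover have "eventually (\<lambda>n::nat. Q + 1 \<le> (1 - \<epsilon>) * \<kappa>0 * ln n) at_top"
  proof -
    have "(1 - \<epsilon>) * \<kappa>0 > 0" using \<epsilon> \<kappa>0 by simp
    thus ?thesis by real_asymp
  qed
  ultimately show ?thesis
    using eventually_ge_at_top[of 3]
  proof eventually_elim
    case (elim n)
    define L where "L = ln (real n)"
    have L: "L > 0" using elim(5) by (simp add: L_def)
    have pw: "real n powr a = exp (a * L)" for a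
      using elim(5) by (simp add: L_def powr_def)
    have E1: "(K * L)\<^sup>2 + K * L \<le> exp (\<gamma> * L)" using elim(1) unfolding pw L_def[symmetric] .
    have E2: "7 \<le> c * \<epsilon> * L" using elim(2) by (simp add: L_def)
    have E3: "K * L \<le> exp (L / 5)" using elim(3) unfolding pw L_def[symmetric] by simp
    have E4: "Q + 1 \<le> (1 - \<epsilon>) * \<kappa>0 * L" using elim(4) by (simp add: L_def)
    have KL: "K * L > 0" using Kpos L by simp
    show ?case
    proof (intro allI impI)
      fix t :: nat and W assume t: "real t \<le> C * ln (real n)" and W: "W \<subseteq> {1..n}"
        and cW: "card W = nat \<lceil>real n powr (1 - \<epsilon> / 8)\<rceil>"
      define \<tau> where "\<tau> = real t / L"
      have \<tau>: "0 \<le> \<tau>" "\<tau> \<le> C" using t L by (auto simp: \<tau>_def L_def[symmetric] field_simps)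
      define \<kappa> where "\<kappa> = kappa p \<tau>"
      have \<kappa>: "\<kappa>0 \<le> \<kappa>" "\<kappa> \<le> K"
        using kappa_mono[OF p _ \<tau>(1)] kappa_mono[OF p \<tau>] by (auto simp: \<kappa>_def \<kappa>0_def K_def)
      have \<kappa>pos: "\<kappa> > 0" using \<kappa>(1) \<kappa>0(2) by linarith
      define k where "k = nat \<lfloor>(1 - \<epsilon>) * \<kappa> * L\<rfloor>"
      have lo: "(1 - \<epsilon>) * \<kappa>0 * L \<le> (1 - \<epsilon>) * \<kappa> * L"
        using \<kappa> \<epsilon> L by (intro mult_right_mono mult_left_mono) auto
      have nn: "0 \<le> (1 - \<epsilon>) * \<kappa> * L" using \<kappa>pos \<epsilon> L by (intro mult_nonneg_nonneg) auto
      have k_le: "real k \<le> (1 - \<epsilon>) * \<kappa> * L" unfolding k_def using nn by linarith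
      have k_ge: "real k \<ge> Q" unfolding k_def using lo E4 by linarith
      have k2: "k \<ge> 2" "k \<ge> K0" "real k \<ge> 6 / \<epsilon>"
        using k_ge by (auto simp: Q_def)
      have kK: "real k \<le> K * L"
      proof -
        have "(1 - \<epsilon>) * \<kappa> \<le> 1 * K" using \<kappa>(2) \<kappa>pos \<epsilon> by (intro mult_mono) auto
        hence "(1 - \<epsilon>) * \<kappa> * L \<le> K * L" using L by (intro mult_right_mono) auto
        thus ?thesis using k_le by linarith
      qed
      define g where "g = (1 - \<epsilon>) * L"
      define H where "H = \<eta> * (real k)\<^sup>2"
      from K0[rule_format, OF k2(2), of t] obtain s where s: "s \<ge> 0"
        and low': "\<forall>(V :: nat set) B. finite V \<longrightarrow> B \<subseteq> V \<longrightarrow> card B = k \<longrightarrow>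
          exp (real k / 2 * (s * real t - (real k - 1) * cgf p s) - \<eta> * (real k)\<^sup>2) \<le>
          measure_pmf.prob (coins (nsets V 2) p) {X. deg_le t (nsets B 2) B X}"
        by (elim exE conjE)
      have low: "\<And>B. B \<subseteq> {1..n} \<Longrightarrow> card B = k \<Longrightarrow>
          exp (real k / 2 * (s * real t - (real k - 1) * cgf p s) - H) \<le>
          measure_pmf.prob (coins (nsets {1..n} 2) p) {X. deg_le t (nsets B 2) B X}"
        unfolding H_def by (rule low'[rule_format]) auto
      \<comment> \<open>The place where \<open>kappa\<close> enters: below the threshold a vertex
        costs at most (1 - \<epsilon>) L, whichever s was supplied.\<close>
      have g: "(real k - 1) * cgf p s - s * real t \<le> 2 * g"
      proof -
        have cg: "cgf p s \<ge> 0" using cgf_nonneg[OF p s] .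
        have "real k * cgf p s \<le> (1 - \<epsilon>) * \<kappa> * L * cgf p s"
          using k_le cg by (rule mult_right_mono)
        also have "\<dots> = (1 - \<epsilon>) * L * (\<kappa> * cgf p s)" by simp
        also have "\<dots> \<le> (1 - \<epsilon>) * L * (2 + s * \<tau>)"
          unfolding \<kappa>_def using \<epsilon> L by (intro mult_left_mono kappa_cgf_le[OF p \<tau>(1) s]) auto
        also have "\<dots> = 2 * g + (1 - \<epsilon>) * (s * real t)"
        proof -
          have "real t = \<tau> * L" using L by (simp add: \<tau>_def)
          thus ?thesis by (simp add: g_def algebra_simps)
        qed
        also have "\<dots> \<le> 2 * g + 1 * (s * real t)"
          using \<epsilon> s by (intro add_left_mono mult_right_mono) auto
        finally show ?thesis using cg by (simp add: algebra_simps)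
      qed
      define R where "R = (\<lambda>l. min ((1 / (1 - p)) ^ (l choose 2)) (exp (real l * g + H)))"
      define \<theta> where "\<theta> = (real k)\<^sup>2 / (real (card W) - real k)"
      define m where "m = real (card W)"
      have m: "m \<ge> exp ((1 - \<gamma>) * L)"
        unfolding m_def cW pw \<gamma>_def by linarith
      have big: "exp (\<gamma> * L) \<le> exp ((1 - \<gamma>) * L)" using \<gamma> L by simp
      have km: "real k < m"
      proof -
        have "K * L < (K * L)\<^sup>2 + K * L" using zero_less_power[OF KL, of 2] by linarith
        thus ?thesis using kK E1 big m by linarith
      qed
      \<comment> \<open>Counting gain per common vertex: k^2 is at most n^\<gamma> and W has at
        least n^(1-\<gamma>) vertices.\<close>
      have \<theta>: "\<theta> \<le> exp (- (1 - 2 * \<gamma>) * L)" "\<theta> \<ge> 0"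
      proof -
        have "(real k)\<^sup>2 \<le> (K * L)\<^sup>2" using kK by (intro power_mono) auto
        also have "\<dots> \<le> exp (\<gamma> * L) - K * L * 1" using E1 by simp
        also have "\<dots> \<le> exp (\<gamma> * L) - K * L * exp (- (1 - 2 * \<gamma>) * L)"
        proof -
          have "- (1 - 2 * \<gamma>) * L \<le> 0" using L \<gamma> by (intro mult_nonpos_nonneg) auto
          thus ?thesis using KL by (intro diff_left_mono mult_left_mono) auto
        qed
        also have "\<dots> = (exp ((1 - \<gamma>) * L) - K * L) * exp (- (1 - 2 * \<gamma>) * L)"
        proof -
          have "exp (\<gamma> * L) = exp ((1 - \<gamma>) * L) * exp (- (1 - 2 * \<gamma>) * L)"
            unfolding exp_add[symmetric] by (simp add: algebra_simps)
          thus ?thesis unfolding left_diff_distrib by (simp only:)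
        qed
        also have "\<dots> \<le> (m - real k) * exp (- (1 - 2 * \<gamma>) * L)"
          using m kK by (intro mult_right_mono) auto
        finally show "\<theta> \<le> exp (- (1 - 2 * \<gamma>) * L)"
          unfolding \<theta>_def m_def[symmetric] using km by (simp add: field_simps)
        show "\<theta> \<ge> 0" unfolding \<theta>_def m_def[symmetric] using km by simp
      qed
      have H1: "H \<le> \<epsilon> / 2 * (c * L) * L"
      proof -
        have "H \<le> \<eta> * (K * L)\<^sup>2" unfolding H_def using kK \<eta> by (intro mult_left_mono power_mono) auto
        also have "\<dots> = \<epsilon> / 2 * (c * L) * L" using Kpos by (simp add: \<eta>_def power2_eq_square)
        finally show ?thesis .
      qed
      have H2: "H \<le> \<epsilon> / 2 * (real k * L)"
      proof -
        have "H \<le> \<eta> * (real k * (K * L))" unfolding H_def power2_eq_square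
          using kK \<eta> by (intro mult_left_mono) auto
        also have "\<dots> = (\<epsilon> / 2 * (real k * L)) * (c / K)" using Kpos by (simp add: \<eta>_def power2_eq_square)
        also have "\<dots> \<le> (\<epsilon> / 2 * (real k * L)) * 1"
          using \<epsilon> L cK Kpos by (intro mult_left_mono) auto
        finally show ?thesis by simp
      qed
      have term_le: "\<theta> ^ l * R l \<le> exp (- (17 / 10) * L)" if l: "2 \<le> l" "l \<le> k" for l
      proof -
        have Rnn: "R l \<ge> 0" using p by (simp add: R_def)
        have "\<theta> ^ l \<le> exp (- (1 - 2 * \<gamma>) * L) ^ l" using \<theta> by (intro power_mono) auto
        also have "\<dots> = exp (- (1 - 2 * \<gamma>) * (real l * L))"
          by (simp add: exp_of_nat_mult[symmetric] algebra_simps)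
        finally have \<theta>l: "\<theta> ^ l \<le> exp (- (1 - 2 * \<gamma>) * (real l * L))" .
        \<comment> \<open>Small overlaps: l >= 2 together with 9/10 - 2\<gamma> >= 17/20 gives
          n^(-17/10). Large overlaps: the exponents add up to -(\<epsilon>/4) l, and l >= c L makes
          this at most -7/4.\<close>
        show ?thesis
        proof (cases "real l < c * L")
          case True
          have "R l \<le> (1 / (1 - p)) ^ (l choose 2)" by (simp add: R_def)
          also have "\<dots> = exp (real (l choose 2) * \<beta>)"
            using p by (simp add: exp_of_nat_mult \<beta>_def exp_minus inverse_eq_divide power_divide)
          also have "\<dots> \<le> exp (real l * L / 10)"
          proof -
            have "real (l choose 2) * \<beta> \<le> (real l * (c * L) / 2) * \<beta>"
              unfolding real_choose_two using True l \<beta> by (intro mult_right_mono divide_right_mono mult_left_mono) auto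
            also have "\<dots> = real l * L / 10" using \<beta> by (simp add: c_def)
            finally show ?thesis by simp
          qed
          finally have "\<theta> ^ l * R l \<le> exp (- (1 - 2 * \<gamma>) * (real l * L)) * exp (real l * L / 10)"
            using \<theta>l Rnn \<theta> by (intro mult_mono) auto
          also have "\<dots> = exp (- (9 / 10 - 2 * \<gamma>) * (real l * L))"
            unfolding exp_add[symmetric] by (simp add: algebra_simps)
          also have "\<dots> \<le> exp (- (17 / 10) * L)"
          proof -
            have "17 / 20 * (2 * L) \<le> (9 / 10 - 2 * \<gamma>) * (real l * L)"
              using \<gamma> l L by (intro mult_mono mult_right_mono) auto
            thus ?thesis unfolding exp_le_cancel_iff minus_mult_left[symmetric] by linarith
          qed
          finally show ?thesis .
        next
          case False
          have "R l \<le> exp (real l * g + H)" by (simp add: R_def)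
          also have "\<dots> \<le> exp ((1 - \<epsilon> / 2) * (real l * L))"
          proof -
            have "H \<le> \<epsilon> / 2 * real l * L"
              using False \<epsilon> L by (intro order.trans[OF H1] mult_right_mono mult_left_mono) auto
            thus ?thesis by (simp add: g_def algebra_simps)
          qed
          finally have "\<theta> ^ l * R l \<le> exp (- (1 - 2 * \<gamma>) * (real l * L)) * exp ((1 - \<epsilon> / 2) * (real l * L))"
            using \<theta>l Rnn \<theta> by (intro mult_mono) auto
          also have "\<dots> = exp (- (\<epsilon> / 4) * (real l * L))"
            unfolding exp_add[symmetric] by (simp add: \<gamma>_def algebra_simps)
          also have "\<dots> \<le> exp (- (17 / 10) * L)"
          proof -
            have "7 / 4 \<le> \<epsilon> / 4 * (c * L)" using E2 by (simp add: algebra_simps)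
            also have "\<dots> \<le> \<epsilon> / 4 * real l" using False \<epsilon> by (intro mult_left_mono) auto
            finally have "17 / 10 * L \<le> \<epsilon> / 4 * real l * L" using L by (intro mult_right_mono) auto
            thus ?thesis by (simp add: mult_ac)
          qed
          finally show ?thesis .
        qed
      qed
      \<comment> \<open>There are at most k <= n^(1/5) overlap sizes, each contributing at most
        n^(-17/10).\<close>
      have sum_le: "(\<Sum>l=2..k. \<theta> ^ l * R l) \<le> exp (- (3 / 2) * L)"
      proof -
        have "(\<Sum>l=2..k. \<theta> ^ l * R l) \<le> real (card {2..k}) * exp (- (17 / 10) * L)"
          by (rule sum_bounded_above) (use term_le in auto)
        also have "\<dots> \<le> exp (L / 5) * exp (- (17 / 10) * L)"
          using kK E3 by (intro mult_right_mono) auto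
        also have "\<dots> = exp (- (3 / 2) * L)"
          unfolding exp_add[symmetric] by simp
        finally show ?thesis .
      qed
      let ?P = "measure_pmf.prob (coins (nsets {1..n} 2) p)"
      let ?dep = "\<lambda>A. {X. deg_le t (nsets A 2) A X}"
      define M where "M = real (card (nsets W k))"
      have M: "exp (real k * ((1 - 2 * \<gamma>) * L)) \<le> M"
      proof -
        have "real k * exp ((1 - 2 * \<gamma>) * L) \<le> exp (\<gamma> * L) * exp ((1 - 2 * \<gamma>) * L)"
        proof (rule mult_right_mono)
          show "real k \<le> exp (\<gamma> * L)" using kK E1 zero_le_power2[of "K * L"] by linarith
        qed simp
        also have "\<dots> = exp ((1 - \<gamma>) * L)" unfolding exp_add[symmetric] by (simp add: algebra_simps)
        finally have "real k * exp ((1 - 2 * \<gamma>) * L) \<le> m" using m by linarith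
        hence "exp ((1 - 2 * \<gamma>) * L) \<le> m / k" using k2 by (simp add: field_simps)
        hence "exp ((1 - 2 * \<gamma>) * L) ^ k \<le> (m / k) ^ k" by (intro power_mono) auto
        also have "\<dots> \<le> real (card W choose k)"
          unfolding m_def using km by (intro binomial_ge_n_over_k_pow_k) (auto simp: m_def)
        finally show ?thesis by (simp add: M_def exp_of_nat_mult)
      qed
      have Mpos: "M > 0" using M less_le_trans[OF exp_gt_zero] by blast
      \<comment> \<open>Normalises the mean M w to n^(3/2)/2; the pair sum is then at most (M w)^2
        n^(-3/2) = n^(3/2)/4, half of the mean.\<close>
      define w where "w = exp (3 / 2 * L) / (2 * M)"
      have w_le: "w \<le> ?P (?dep A)" if A: "A \<in> nsets W k" for A
      proof -
        have "w \<le> exp (3 / 2 * L) / M" unfolding w_def using Mpos by (simp add: field_simps)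
        also have "\<dots> \<le> exp (3 / 2 * L) / exp (real k * ((1 - 2 * \<gamma>) * L))"
          using M Mpos by (intro divide_left_mono) auto
        also have "\<dots> = exp (3 / 2 * L - real k * ((1 - 2 * \<gamma>) * L))" by (simp add: exp_diff)
        also have "\<dots> \<le> exp (real k / 2 * (s * real t - (real k - 1) * cgf p s) - H)"
        proof -
          have "real k / 2 * ((real k - 1) * cgf p s - s * real t) \<le> real k / 2 * (2 * g)"
            using g by (intro mult_left_mono) auto
          moreover have "3 / 2 * L \<le> \<epsilon> / 4 * real k * L"
            using k2(3) \<epsilon> L by (intro mult_right_mono) (auto simp: field_simps)
          ultimately show ?thesis using H2 by (simp add: g_def \<gamma>_def algebra_simps)
        qed
        also have "\<dots> \<le> ?P (?dep A)"
          by (rule low) (use A W in \<open>auto simp: nsets_def\<close>)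
        finally show ?thesis .
      qed
      have pair: "?P (?dep A \<inter> ?dep B) \<le> R (card (A \<inter> B)) * (?P (?dep A) * ?P (?dep B))"
        if A: "A \<in> nsets W k" and B: "B \<in> nsets W k" for A B
      proof -
        have AB: "A \<subseteq> {1..n}" "B \<subseteq> {1..n}" "card B = k" using A B W by (auto simp: nsets_def)
        show ?thesis unfolding R_def
          by (rule prob_two_dependent_le_overlap[OF p _ AB s low[OF AB(2,3)] g]) auto
      qed
      have "?P {X. \<forall>A\<in>nsets W k. X \<notin> ?dep A} \<le>
          exp (- (M * w) + (M * w)\<^sup>2 * (\<Sum>l=2..k. \<theta> ^ l * R l))"
        unfolding M_def \<theta>_def
        by (rule prob_no_dependent_subset[OF _ _ _ W k2(1) _ _ pair _ w_le])
           (use p km Mpos in \<open>auto simp: m_def R_def w_def\<close>)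
      also have "\<dots> \<le> exp (- (exp (3 / 2 * L) / 2) + exp (3 / 2 * L) / 4)"
      proof -
        have Mw: "M * w = exp (3 / 2 * L) / 2" using Mpos by (simp add: w_def)
        have "(M * w)\<^sup>2 * (\<Sum>l=2..k. \<theta> ^ l * R l) \<le> (M * w)\<^sup>2 * exp (- (3 / 2) * L)"
          using sum_le by (intro mult_left_mono) auto
        also have "\<dots> = exp (3 / 2 * L) * (exp (3 / 2 * L) * exp (- (3 / 2) * L)) / 4"
          unfolding Mw by (simp add: power2_eq_square)
        also have "exp (3 / 2 * L) * exp (- (3 / 2) * L) = 1"
          unfolding exp_add[symmetric] by simp
        finally show ?thesis unfolding exp_le_cancel_iff using Mw by linarith
      qed
      also have "\<dots> = exp (- (real n powr (3 / 2)) / 4)" unfolding pw by simp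
      finally show "measure_pmf.prob (coins (nsets {1..n} 2) p)
        {X. \<forall>A\<in>nsets W (nat \<lfloor>(1 - \<epsilon>) * kappa p (real t / ln (real n)) * ln (real n)\<rfloor>).
           \<not> deg_le t (nsets A 2) A X} \<le> exp (- (real n powr (3 / 2)) / 4)"
        by (simp add: k_def \<kappa>_def \<tau>_def L_def)
    qed
  qed
qed

section \<open>Colourings\<close>

abbreviation graph_of :: "nat \<Rightarrow> (nat set \<Rightarrow> bool) \<Rightarrow> nat set set" where
  "graph_of n X \<equiv> {e \<in> nsets {1..n} 2. X e}"

lemma prob_gnp:
  "measure_pmf.prob (gnp n p) {E. P E} = measure_pmf.prob (coins (nsets {1..n} 2) p) {X. P (graph_of n X)}"
  by (simp add: gnp_def coins_def)

lemma dependent_set_subset: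
  assumes "finite E" "dependent_set t E S" "S' \<subseteq> S"
  shows "dependent_set t E S'"
  unfolding dependent_set_def
proof
  fix v assume "v \<in> S'"
  have "vertex_degree (induced_edges E S') v \<le> vertex_degree (induced_edges E S) v"
    unfolding vertex_degree_def induced_edges_def using assms by (intro card_mono) auto
  also have "\<dots> \<le> t" using assms \<open>v \<in> S'\<close> by (auto simp: dependent_set_def)
  finally show "vertex_degree (induced_edges E S') v \<le> t" .
qed

lemma dependent_set_small:
  assumes "E \<subseteq> nsets V 2" "\<And>u v. u \<in> S \<Longrightarrow> v \<in> S \<Longrightarrow> u = v"
  shows "dependent_set t E S"
proof -
  have "induced_edges E S = {}"
    using assms by (force simp: induced_edges_def nsets_2_eq)
  thus ?thesis by (simp add: dependent_set_def vertex_degree_def)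
qed

text \<open>All vertices get different colours. This makes the LEAST meaningful and disposes of the
  vertices left over by the greedy procedure.\<close>

lemma improper_colouring_discrete:
  assumes "finite V" "E \<subseteq> nsets U 2"
  obtains c where "improper_colouring t V E (card V) c"
proof -
  obtain c where c: "bij_betw c V {..<card V}"
    using ex_bij_betw_finite_nat[OF assms(1)] by (auto simp: atLeast0LessThan)
  have "improper_colouring t V E (card V) c"
    unfolding improper_colouring_def
  proof (intro conjI allI impI)
    show "c ` V \<subseteq> {..<card V}" using c by (simp add: bij_betw_def)
    show "dependent_set t E {v \<in> V. c v = i}" for i
      using c by (intro dependent_set_small[OF assms(2)]) (auto simp: bij_betw_def inj_on_def)
  qed
  thus ?thesis by (rule that)
qed

lemma improper_chromatic_number_le:
  "improper_colouring t V E k c \<Longrightarrow> improper_chromatic_number t V E \<le> k"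
  unfolding improper_chromatic_number_def by (intro Least_le) blast

lemma improper_chromatic_number_colouring:
  assumes "finite V" "E \<subseteq> nsets U 2"
  obtains c where "improper_colouring t V E (improper_chromatic_number t V E) c"
proof -
  have "\<exists>k c. improper_colouring t V E k c"
    using improper_colouring_discrete[OF assms] by metis
  hence "\<exists>c. improper_colouring t V E (improper_chromatic_number t V E) c"
    unfolding improper_chromatic_number_def by (rule LeastI_ex)
  thus ?thesis using that by blast
qed

text \<open>Dependence passes to subsets, so excluding size r + 1 alone bounds every colour class by
  r.\<close>

lemma card_le_improper_chromatic_number:
  assumes V: "finite V" and E: "finite E" "E \<subseteq> nsets U 2"
    and no: "\<And>S. S \<in> nsets V (Suc r) \<Longrightarrow> \<not> dependent_set t E S"
  shows "card V \<le> improper_chromatic_number t V E * r"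
proof -
  let ?\<chi> = "improper_chromatic_number t V E"
  obtain c where c: "improper_colouring t V E ?\<chi> c"
    using improper_chromatic_number_colouring[OF V E(2)] .
  let ?S = "\<lambda>i. {v \<in> V. c v = i}"
  have small: "card (?S i) \<le> r" if "i < ?\<chi>" for i
  proof (rule ccontr)
    assume "\<not> card (?S i) \<le> r"
    then obtain S where S: "S \<subseteq> ?S i" "card S = Suc r" "finite S"
      using obtain_subset_with_card_n[of "Suc r" "?S i"] by auto
    have "dependent_set t E (?S i)" using c that by (auto simp: improper_colouring_def)
    hence "dependent_set t E S" using dependent_set_subset[OF E(1)] S by blast
    moreover have "S \<in> nsets V (Suc r)" using S by (auto simp: nsets_def)
    ultimately show False using no by blast
  qed
  have "V = (\<Union>i<?\<chi>. ?S i)" using c by (auto simp: improper_colouring_def)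
  hence "card V \<le> (\<Sum>i<?\<chi>. card (?S i))"
    using card_UN_le[of "{..<?\<chi>}" ?S] by simp
  also have "\<dots> \<le> (\<Sum>i<?\<chi>. r)" using small by (intro sum_mono) auto
  finally show ?thesis by simp
qed

text \<open>Dependent k-sets are removed while at least m vertices remain; the fewer than m others
  get colours of their own. The bound is multiplied by k to stay in the naturals.\<close>

lemma greedy_colouring:
  assumes V: "finite V" and E: "E \<subseteq> nsets U 2" and k: "k > 0"
    and ex: "\<And>W. W \<subseteq> V \<Longrightarrow> card W = m \<Longrightarrow> \<exists>A\<in>nsets W k. dependent_set t E A"
  shows "\<exists>j c. improper_colouring t V E j c \<and> j * k \<le> card V + m * k"
  using V ex
proof (induction "card V" arbitrary: V rule: less_induct)
  case (less V)
  show ?case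
  proof (cases "card V < m")
    case True
    obtain c where "improper_colouring t V E (card V) c"
      using improper_colouring_discrete[OF less.prems(1) E] .
    moreover have "card V * k \<le> card V + m * k"
      using True by (intro trans_le_add2 mult_le_mono1) auto
    ultimately show ?thesis by blast
  next
    case False
    then obtain W where "W \<subseteq> V" "card W = m"
      using obtain_subset_with_card_n[of m V] by auto
    then obtain A where A: "A \<in> nsets W k" "dependent_set t E A" using less.prems(2) by blast
    have A': "A \<subseteq> V" "finite A" "card A = k" using A(1) \<open>W \<subseteq> V\<close> by (auto simp: nsets_def)
    have c1: "card (V - A) + k = card V"
      using A' less.prems(1) card_mono[of V A] by (simp add: card_Diff_subset)
    have "\<exists>j c. improper_colouring t (V - A) E j c \<and> j * k \<le> card (V - A) + m * k"
    proof (rule less.hyps)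
      show "card (V - A) < card V" using c1 k by simp
      show "finite (V - A)" using less.prems(1) by simp
      show "\<And>W. W \<subseteq> V - A \<Longrightarrow> card W = m \<Longrightarrow> \<exists>A\<in>nsets W k. dependent_set t E A"
        using less.prems(2) by blast
    qed
    then obtain j c where c: "improper_colouring t (V - A) E j c" "j * k \<le> card (V - A) + m * k"
      by blast
    define c' where "c' = (\<lambda>v. if v \<in> A then j else c v)"
    have lt: "c v < j" if "v \<in> V - A" for v
      using c(1) that by (auto simp: improper_colouring_def)
    have "improper_colouring t V E (Suc j) c'"
      unfolding improper_colouring_def
    proof (intro conjI allI impI)
      show "c' ` V \<subseteq> {..<Suc j}" using lt by (auto simp: c'_def less_Suc_eq)
      fix i assume i: "i < Suc j"
      show "dependent_set t E {v \<in> V. c' v = i}"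
      proof (cases "i = j")
        case True
        have "{v \<in> V. c' v = i} = A" using A'(1) lt True by (auto simp: c'_def)
        thus ?thesis using A(2) by simp
      next
        case False
        have "{v \<in> V. c' v = i} = {v \<in> V - A. c v = i}" using False by (auto simp: c'_def)
        moreover have "dependent_set t E {v \<in> V - A. c v = i}"
          using c(1) i False by (simp add: improper_colouring_def)
        ultimately show ?thesis by simp
      qed
    qed
    moreover have "Suc j * k \<le> card V + m * k" using c(2) c1 by simp
    ultimately show ?thesis by blast
  qed
qed

section \<open>Failure probabilities for the two bounds on the chromatic number\<close>

lemma prob_exists_dependent_le:
  assumes p: "0 < p" "p < 1" and V: "finite V" and s: "s \<ge> 0"
  shows "measure_pmf.prob (coins (nsets V 2) p) {X. \<exists>S\<in>nsets V k. deg_le t (nsets S 2) S X} \<le>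
    real (card V choose k) * exp (real k / 2 * (s * real t - (real k - 1) * cgf p s))"
proof -
  let ?P = "measure_pmf.prob (coins (nsets V 2) p)"
  have fin: "finite (nsets V k)" using V by (rule finite_imp_finite_nsets)
  have "{X. \<exists>S\<in>nsets V k. deg_le t (nsets S 2) S X} = (\<Union>S\<in>nsets V k. {X. deg_le t (nsets S 2) S X})"
    by auto
  hence "?P {X. \<exists>S\<in>nsets V k. deg_le t (nsets S 2) S X} \<le>
      (\<Sum>S\<in>nsets V k. ?P {X. deg_le t (nsets S 2) S X})"
    using fin by (simp add: measure_pmf.finite_measure_subadditive_finite)
  also have "\<dots> \<le> (\<Sum>S\<in>nsets V k. exp (real k / 2 * (s * real t - (real k - 1) * cgf p s)))"
  proof (rule sum_mono)
    fix S assume "S \<in> nsets V k"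
    hence "S \<subseteq> V" "card S = k" by (auto simp: nsets_def)
    thus "?P {X. deg_le t (nsets S 2) S X} \<le> exp (real k / 2 * (s * real t - (real k - 1) * cgf p s))"
      using prob_dependent_le[OF p V _ s, of S t] by simp
  qed
  also have "\<dots> = real (card V choose k) * exp (real k / 2 * (s * real t - (real k - 1) * cgf p s))"
    by simp
  finally show ?thesis .
qed

text \<open>If n exceeds \<chi> r, some colour class has more than r vertices; the union bound runs
  over sets of r + 1 vertices, whence the factor r in front of \<open>cgf\<close>.\<close>

lemma prob_chromatic_lower:
  assumes p: "0 < p" "p < 1" and s: "s \<ge> 0"
  shows "measure_pmf.prob (gnp n p) {E. \<not> n \<le> improper_chromatic_number t {1..n} E * r} \<le>
    real (n choose Suc r) * exp (real (Suc r) / 2 * (s * real t - real r * cgf p s))"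
proof -
  let ?P = "measure_pmf.prob (coins (nsets {1..n} 2) p)"
  have "measure_pmf.prob (gnp n p) {E. \<not> n \<le> improper_chromatic_number t {1..n} E * r} \<le>
      ?P {X. \<exists>S\<in>nsets {1..n} (Suc r). deg_le t (nsets S 2) S X}"
    unfolding prob_gnp
  proof (intro measure_pmf.finite_measure_mono subsetI)
    fix X assume X: "X \<in> {X. \<not> n \<le> improper_chromatic_number t {1..n} (graph_of n X) * r}"
    show "X \<in> {X. \<exists>S\<in>nsets {1..n} (Suc r). deg_le t (nsets S 2) S X}"
    proof (rule ccontr)
      assume "\<not> ?thesis"
      hence "\<not> dependent_set t (graph_of n X) S" if "S \<in> nsets {1..n} (Suc r)" for S
        using that dependent_set_iff_deg_le[of S "{1..n}" t X] by (auto simp: nsets_def)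
      hence "card {1..n} \<le> improper_chromatic_number t {1..n} (graph_of n X) * r"
        by (intro card_le_improper_chromatic_number[where U = "{1..n}"])
           (auto intro: finite_subset[OF _ finite_imp_finite_nsets[of "{1..n}" 2]])
      thus False using X by simp
    qed
  qed auto
  also have "\<dots> \<le> real (n choose Suc r) * exp (real (Suc r) / 2 * (s * real t - real r * cgf p s))"
    using prob_exists_dependent_le[OF p _ s, of "{1..n}" "Suc r" t] by simp
  finally show ?thesis .
qed

lemma card_residue_class_le: "card {v \<in> {1..n}. v mod j = i} \<le> n div j + 1"
proof -
  have "card {v \<in> {1..n}. v mod j = i} \<le> card {..n div j}"
  proof (rule card_inj_on_le[where f = "\<lambda>v. v div j"])
    show "inj_on (\<lambda>v. v div j) {v \<in> {1..n}. v mod j = i}"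
      by (rule inj_onI) (metis (mono_tags, lifting) div_mult_mod_eq mem_Collect_eq)
    show "(\<lambda>v. v div j) ` {v \<in> {1..n}. v mod j = i} \<subseteq> {..n div j}"
      by (auto intro: div_le_mono)
  qed auto
  thus ?thesis by simp
qed

text \<open>The classes are fixed before the graph is drawn, so the union bound runs over vertices
  alone. Degrees inside a class are binomial with mean at most np/j, and \<delta> is the room up to
  t.\<close>

lemma prob_chromatic_upper_residues:
  assumes p: "0 < p" "p < 1" and j: "j > 0" and n: "n > 0" and "\<delta> \<ge> 0" and t: "real n / real j * p + \<delta> \<le> real t"
  shows "measure_pmf.prob (gnp n p) {E. \<not> improper_chromatic_number t {1..n} E \<le> j} \<le>
    real n * exp (- 2 * \<delta>\<^sup>2 / (real n / real j))"
proof -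
  let ?P = "measure_pmf.prob (coins (nsets {1..n} 2) p)"
  let ?S = "\<lambda>i. {v \<in> {1..n}. v mod j = i}"
  let ?F = "\<lambda>v. {e \<in> nsets (?S (v mod j)) 2. v \<in> e}"
  let ?bad = "\<lambda>v. {X. t < card {e \<in> ?F v. X e}}"
  have fin: "finite (nsets {1..n} 2)" by (intro finite_imp_finite_nsets) auto
  have "measure_pmf.prob (gnp n p) {E. \<not> improper_chromatic_number t {1..n} E \<le> j} \<le> ?P (\<Union>v\<in>{1..n}. ?bad v)"
    unfolding prob_gnp
  proof (intro measure_pmf.finite_measure_mono subsetI)
    fix X assume X: "X \<in> {X. \<not> improper_chromatic_number t {1..n} (graph_of n X) \<le> j}"
    show "X \<in> (\<Union>v\<in>{1..n}. ?bad v)"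
    proof (rule ccontr)
      assume no: "\<not> ?thesis"
      have "improper_colouring t {1..n} (graph_of n X) j (\<lambda>v. v mod j)"
        unfolding improper_colouring_def
      proof (intro conjI allI impI)
        fix i
        have "deg_le t (nsets (?S i) 2) (?S i) X"
          unfolding deg_le_def
        proof
          fix v assume v: "v \<in> ?S i"
          hence "card {e \<in> ?F v. X e} \<le> t" using no by (auto simp: not_less)
          moreover have "{e \<in> ?F v. X e} = {e \<in> nsets (?S i) 2. v \<in> e \<and> X e}" using v by auto
          ultimately show "card {e \<in> nsets (?S i) 2. v \<in> e \<and> X e} \<le> t" by simp
        qed
        thus "dependent_set t (graph_of n X) (?S i)"
          by (subst dependent_set_iff_deg_le) auto
      qed (use j in auto)
      with X show False using improper_chromatic_number_le by blast
    qed
  qed auto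
  also have "\<dots> \<le> (\<Sum>v\<in>{1..n}. ?P (?bad v))"
    by (intro measure_pmf.finite_measure_subadditive_finite) auto
  also have "\<dots> \<le> (\<Sum>v\<in>{1..n}. exp (- 2 * \<delta>\<^sup>2 / (real n / real j)))"
  proof (rule sum_mono)
    fix v assume v: "v \<in> {1..n}"
    \<comment> \<open>A vertex is not its own neighbour: this -1 cancels the +1 of an incomplete
      period, so no rounding is lost.\<close>
    have "card (?F v) = card (?S (v mod j)) - 1" using v by (intro card_star) auto
    also have "\<dots> \<le> n div j" using card_residue_class_le[of n j "v mod j"] by simp
    finally have "real (card (?F v)) \<le> real (n div j)" by simp
    also have "\<dots> \<le> real n / real j"
    proof -
      have "real (n div j * j) \<le> real n" by (intro of_nat_mono div_times_less_eq_dividend)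
      thus ?thesis using j by (simp add: le_divide_eq)
    qed
    finally have F: "real (card (?F v)) \<le> real n / real j" .
    have FV: "?F v \<subseteq> nsets {1..n} 2" by (auto simp: nsets_def)
    have finF: "finite (?F v)" by (rule finite_subset[OF FV fin])
    show "?P (?bad v) \<le> exp (- 2 * \<delta>\<^sup>2 / (real n / real j))"
    proof (cases "?F v = {}")
      case True
      have "card {e \<in> ?F v. X e} = 0" for X unfolding True by simp
      hence "?bad v = {}" by (simp only:) simp
      thus ?thesis by simp
    next
      case False
      have cpos: "real (card (?F v)) > 0" using False finF by (simp add: card_gt_0_iff)
      have "real (card (?F v)) * p + \<delta> \<le> real t"
        using F p mult_right_mono[OF F, of p] t by linarith
      hence "?P (?bad v) \<le> ?P {X. real (card {e \<in> ?F v. X e}) \<ge> real (card (?F v)) * p + \<delta>}"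
        by (intro measure_pmf.finite_measure_mono) auto
      also have "\<dots> \<le> exp (- 2 * \<delta>\<^sup>2 / real (card (?F v)))"
        using p \<open>\<delta> \<ge> 0\<close> False by (intro hoeffding_coins fin FV) auto
      also have "\<dots> \<le> exp (- 2 * \<delta>\<^sup>2 / (real n / real j))"
      proof -
        have "2 * \<delta>\<^sup>2 / (real n / real j) \<le> 2 * \<delta>\<^sup>2 / real (card (?F v))"
          using F cpos by (intro divide_left_mono mult_pos_pos) auto
        thus ?thesis by (simp only: exp_le_cancel_iff minus_divide_left[symmetric] mult_minus_left neg_le_iff_le)
      qed
      finally show ?thesis .
    qed
  qed
  also have "\<dots> = real n * exp (- 2 * \<delta>\<^sup>2 / (real n / real j))" by simp
  finally show ?thesis .
qed

section \<open>Bounds on the chromatic number\<close>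

text \<open>With r near (1 + \<epsilon>) \<kappa> ln n and s nearly optimal for t / ln n, the
  expected number of dependent (r + 1)-sets is at most n^(-(\<rho> - 1)(r + 1)).\<close>

lemma chromatic_lower_eventually:
  assumes p: "0 < p" "p < 1" and \<epsilon>: "\<epsilon> > 0"
  shows "eventually (\<lambda>n::nat. \<forall>t::nat. measure_pmf.prob (gnp n p)
    {E. real (improper_chromatic_number t {1..n} E) <
        real n / ((1 + 2 * \<epsilon>) * (kappa p (real t / ln (real n)) * ln (real n)))} \<le> 1 / real n) at_top"
proof -
  \<comment> \<open>Size slack 1 + \<epsilon> divided by the factor 1 + \<epsilon>/2 given away in
    choosing s near the infimum.\<close>
  define \<rho> where "\<rho> = (1 + \<epsilon>) / (1 + \<epsilon> / 2)"
  have \<rho>: "\<rho> > 1" using \<epsilon> by (simp add: \<rho>_def)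
  have \<kappa>0: "kappa p 0 > 0" by (rule kappa_0_pos[OF p])
  have "eventually (\<lambda>n::nat. 1 \<le> (\<rho> - 1) * ((1 + \<epsilon>) * kappa p 0) * ln n) at_top"
  proof -
    have "(\<rho> - 1) * ((1 + \<epsilon>) * kappa p 0) > 0" using \<rho> \<epsilon> \<kappa>0 by simp
    thus ?thesis by real_asymp
  qed
  moreover have "eventually (\<lambda>n::nat. 1 \<le> (\<epsilon> * kappa p 0) * ln n) at_top"
    using mult_pos_pos[OF \<epsilon> \<kappa>0] by real_asymp
  ultimately show ?thesis using eventually_ge_at_top[of 3]
  proof eventually_elim
    case (elim n)
    define L where "L = ln (real n)"
    have L: "L > 0" using elim(3) by (simp add: L_def)
    have n: "real n = exp L" using elim(3) by (simp add: L_def)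
    have E1: "1 \<le> (\<rho> - 1) * ((1 + \<epsilon>) * kappa p 0) * L" and E2: "1 \<le> (\<epsilon> * kappa p 0) * L"
      using elim by (simp_all add: L_def)
    show ?case
    proof
      fix t :: nat
      define \<tau> where "\<tau> = real t / L"
      have \<tau>: "\<tau> \<ge> 0" using L by (simp add: \<tau>_def)
      have tL: "real t = \<tau> * L" using L by (simp add: \<tau>_def)
      define \<kappa> where "\<kappa> = kappa p \<tau>"
      have \<kappa>: "kappa p 0 \<le> \<kappa>" "\<kappa> > 0"
        using kappa_mono[OF p _ \<tau>] kappa_pos[OF p \<tau>] by (auto simp: \<kappa>_def)
      have "kappa p \<tau> < (1 + \<epsilon> / 2) * \<kappa>" using \<kappa> \<epsilon> by (simp add: \<kappa>_def[symmetric])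
      then obtain s where s: "s > 0" "(2 + s * \<tau>) / cgf p s < (1 + \<epsilon> / 2) * \<kappa>"
        by (rule kappa_lessE[OF p \<tau>])
      have cg: "cgf p s > 0" by (rule cgf_pos[OF p s(1)])
      have le: "2 + s * \<tau> \<le> (1 + \<epsilon> / 2) * (\<kappa> * cgf p s)"
        using s(2) cg by (simp add: divide_less_eq mult_ac)
      \<comment> \<open>Rounding up is paid for by the second \<epsilon> in 1 + 2\<epsilon>.\<close>
      define r where "r = nat \<lceil>(1 + \<epsilon>) * \<kappa> * L\<rceil>"
      have nn: "(1 + \<epsilon>) * \<kappa> * L \<ge> 0" using \<epsilon> \<kappa> L by simp
      have r_ge: "real r \<ge> (1 + \<epsilon>) * \<kappa> * L" unfolding r_def by linarith
      have r_le: "real r \<le> (1 + 2 * \<epsilon>) * (\<kappa> * L)"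
      proof -
        have "(\<epsilon> * kappa p 0) * L \<le> \<epsilon> * \<kappa> * L"
          using \<kappa> \<epsilon> L by (intro mult_right_mono mult_left_mono) auto
        hence "(1 + \<epsilon>) * \<kappa> * L + 1 \<le> (1 + 2 * \<epsilon>) * (\<kappa> * L)"
          using E2 by (simp add: algebra_simps)
        moreover have "real r \<le> (1 + \<epsilon>) * \<kappa> * L + 1" unfolding r_def using nn by linarith
        ultimately show ?thesis by linarith
      qed
      have exponent: "s * real t - real r * cgf p s \<le> - 2 * \<rho> * L"
      proof -
        have "\<rho> * (L * (2 + s * \<tau>)) \<le> \<rho> * (L * ((1 + \<epsilon> / 2) * (\<kappa> * cgf p s)))"
          using le L \<rho> by (intro mult_left_mono) auto
        also have "\<dots> = (\<rho> * (1 + \<epsilon> / 2)) * \<kappa> * L * cgf p s" by simp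
        also have "\<rho> * (1 + \<epsilon> / 2) = 1 + \<epsilon>" using \<epsilon> by (simp add: \<rho>_def)
        also have "(1 + \<epsilon>) * \<kappa> * L * cgf p s \<le> real r * cgf p s"
          using r_ge cg by (intro mult_right_mono) auto
        finally have "\<rho> * (2 * L) + \<rho> * (s * real t) \<le> real r * cgf p s"
          by (simp add: tL algebra_simps)
        moreover have "1 * (s * real t) \<le> \<rho> * (s * real t)"
          using \<rho> s by (intro mult_right_mono) auto
        ultimately show ?thesis by linarith
      qed
      have "measure_pmf.prob (gnp n p)
          {E. real (improper_chromatic_number t {1..n} E) < real n / ((1 + 2 * \<epsilon>) * (\<kappa> * L))} \<le>
          measure_pmf.prob (gnp n p) {E. \<not> n \<le> improper_chromatic_number t {1..n} E * r}"
      proof (intro measure_pmf.finite_measure_mono subsetI, clarify)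
        fix E assume lt: "real (improper_chromatic_number t {1..n} E) < real n / ((1 + 2 * \<epsilon>) * (\<kappa> * L))"
          and "n \<le> improper_chromatic_number t {1..n} E * r"
        hence "real n \<le> real (improper_chromatic_number t {1..n} E) * real r"
          unfolding of_nat_mult[symmetric] by (subst of_nat_le_iff)
        also have "\<dots> \<le> real (improper_chromatic_number t {1..n} E) * ((1 + 2 * \<epsilon>) * (\<kappa> * L))"
          using r_le by (intro mult_left_mono) auto
        finally show False using lt \<kappa> L \<epsilon> by (simp add: less_divide_eq)
      qed auto
      also have "\<dots> \<le> real (n choose Suc r) * exp (real (Suc r) / 2 * (s * real t - real r * cgf p s))"
        using s by (intro prob_chromatic_lower[OF p]) auto
      also have "\<dots> \<le> real n ^ Suc r * exp (real (Suc r) / 2 * (- 2 * \<rho> * L))"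
      proof (intro mult_mono)
        show "real (n choose Suc r) \<le> real n ^ Suc r"
        proof (cases "Suc r \<le> n")
          case True
          thus ?thesis using binomial_le_pow[OF True]
            by (metis of_nat_le_iff of_nat_power)
        qed (simp add: binomial_eq_0)
        show "exp (real (Suc r) / 2 * (s * real t - real r * cgf p s)) \<le>
            exp (real (Suc r) / 2 * (- 2 * \<rho> * L))"
          unfolding exp_le_cancel_iff using exponent by (intro mult_left_mono) auto
      qed auto
      also have "\<dots> = exp (real (Suc r) * L) * exp (real (Suc r) / 2 * (- 2 * \<rho> * L))"
        unfolding n by (simp only: exp_of_nat_mult)
      also have "\<dots> = exp (- ((\<rho> - 1) * real (Suc r)) * L)"
      proof -
        have "R * L + R / 2 * (- 2 * \<rho> * L) = - ((\<rho> - 1) * R) * L" for R :: real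
          by (simp add: algebra_simps)
        thus ?thesis unfolding exp_add[symmetric] by (simp only:)
      qed
      also have "\<dots> \<le> exp (- 1 * L)"
      proof -
        have "(\<rho> - 1) * ((1 + \<epsilon>) * kappa p 0) * L \<le> (\<rho> - 1) * ((1 + \<epsilon>) * \<kappa>) * L"
          using \<rho> \<epsilon> \<kappa> L by (intro mult_right_mono mult_left_mono) auto
        also have "\<dots> = (\<rho> - 1) * ((1 + \<epsilon>) * \<kappa> * L)" by simp
        also have "\<dots> \<le> (\<rho> - 1) * real (Suc r)"
          using r_ge \<rho> by (intro mult_left_mono) auto
        finally have "1 \<le> (\<rho> - 1) * real (Suc r)" using E1 by linarith
        thus ?thesis unfolding exp_le_cancel_iff using L by (intro mult_right_mono) auto
      qed
      also have "\<dots> = 1 / real n" unfolding n by (simp add: exp_minus inverse_eq_divide)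
      finally show "measure_pmf.prob (gnp n p)
        {E. real (improper_chromatic_number t {1..n} E) <
            real n / ((1 + 2 * \<epsilon>) * (kappa p (real t / ln (real n)) * ln (real n)))} \<le> 1 / real n"
        by (simp only: \<kappa>_def \<tau>_def L_def)
    qed
  qed
qed

text \<open>For large \<tau> the target n / (\<kappa> ln n) is close to np/t, the number of equal
  parts at which mean degrees reach t. A factor 1 + \<epsilon> more parts leaves room for
  Hoeffding's inequality.\<close>

lemma chromatic_upper_large_t:
  assumes p: "0 < p" "p < 1" and \<epsilon>: "\<epsilon> > 0"
  obtains C where "C > 0" "\<And>(n::nat) (t::nat). n \<ge> 2 \<Longrightarrow> C * ln (real n) \<le> real t \<Longrightarrow> real t \<le> \<epsilon> * p * real n \<Longrightarrow>
    measure_pmf.prob (gnp n p)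
    {E. real (improper_chromatic_number t {1..n} E) > (1 + 2 * \<epsilon>) * (1 + \<epsilon>) *
        (real n / (kappa p (real t / ln (real n)) * ln (real n)))} \<le> 1 / real n"
proof -
  obtain C1 where C1: "C1 > 0" "\<And>\<tau>. \<tau> \<ge> C1 \<Longrightarrow> kappa p \<tau> \<le> (1 + \<epsilon>) * (\<tau> / p)"
    by (rule kappa_asymp_upper[OF p \<epsilon>]) blast
  \<comment> \<open>With t >= C2 ln n, \<delta>^2 j / n is at least ln n, so each vertex fails with
    probability at most n^(-2).\<close>
  define C2 where "C2 = (1 + \<epsilon>) / (\<epsilon>\<^sup>2 * p)"
  define C where "C = max C1 C2"
  have C: "C > 0" "C1 \<le> C" "C2 \<le> C" using C1 by (auto simp: C_def)
  have main: "measure_pmf.prob (gnp n p)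
      {E. real (improper_chromatic_number t {1..n} E) > (1 + 2 * \<epsilon>) * (1 + \<epsilon>) *
          (real n / (kappa p (real t / ln (real n)) * ln (real n)))} \<le> 1 / real n"
    if n: "n \<ge> 2" and t: "C * ln (real n) \<le> real t" and tn: "real t \<le> \<epsilon> * p * real n" for n t :: nat
  proof -
    define L where "L = ln (real n)"
    have L: "L > 0" using n by (simp add: L_def)
    have nL: "real n = exp L" using n by (simp add: L_def)
    have t': "C * L \<le> real t" using t by (simp add: L_def)
    hence tpos: "real t > 0" using C(1) L mult_pos_pos[of C L] by linarith
    define \<tau> where "\<tau> = real t / L"
    have "C \<le> \<tau>" using t' L by (simp add: \<tau>_def le_divide_eq)
    hence \<tau>: "\<tau> \<ge> C1" "\<tau> \<ge> 0" using C by auto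
    define \<kappa> where "\<kappa> = kappa p \<tau>"
    have \<kappa>pos: "\<kappa> > 0" unfolding \<kappa>_def by (rule kappa_pos[OF p \<tau>(2)])
    have "\<kappa> * L \<le> (1 + \<epsilon>) * (\<tau> / p) * L"
      unfolding \<kappa>_def using C1(2)[OF \<tau>(1)] L by (intro mult_right_mono) auto
    also have "\<dots> = (1 + \<epsilon>) * (real t / p)" using L by (simp add: \<tau>_def)
    finally have \<kappa>L: "\<kappa> * L \<le> (1 + \<epsilon>) * (real t / p)" .
    define y where "y = real n * p * (1 + \<epsilon>) / real t"
    have ypos: "y > 0" using n p \<epsilon> tpos by (simp add: y_def)
    define j where "j = nat \<lceil>y\<rceil>"
    have j_ge: "real j \<ge> y" unfolding j_def by linarith
    have j_le: "real j \<le> y + 1" unfolding j_def using ypos by linarith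
    have jpos: "j > 0" using j_ge ypos by (intro gr0I) auto
    have nj: "real n / real j \<le> real t / (p * (1 + \<epsilon>))"
    proof -
      have "real n / real j \<le> real n / y"
        using j_ge ypos jpos by (intro divide_left_mono) auto
      also have "\<dots> = real t / (p * (1 + \<epsilon>))" using n tpos by (simp add: y_def)
      finally show ?thesis .
    qed
    define \<delta> where "\<delta> = real t * \<epsilon> / (1 + \<epsilon>)"
    have \<delta>: "\<delta> \<ge> 0" using \<epsilon> by (simp add: \<delta>_def)
    have "real n / real j * p + \<delta> \<le> real t / (p * (1 + \<epsilon>)) * p + \<delta>"
      using nj p by (intro add_right_mono mult_right_mono) auto
    also have "\<dots> = real t"
    proof -
      have "real t / (p * a) * p + real t * \<epsilon> / a = real t * (1 + \<epsilon>) / a" if "a > 0" for a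
        using that p by (simp add: field_simps)
      from this[of "1 + \<epsilon>"] show ?thesis using \<epsilon> by (simp add: \<delta>_def)
    qed
    finally have cond: "real n / real j * p + \<delta> \<le> real t" .
    have "measure_pmf.prob (gnp n p)
        {E. real (improper_chromatic_number t {1..n} E) > (1 + 2 * \<epsilon>) * (1 + \<epsilon>) * (real n / (\<kappa> * L))} \<le>
        measure_pmf.prob (gnp n p) {E. \<not> improper_chromatic_number t {1..n} E \<le> j}"
    proof (intro measure_pmf.finite_measure_mono subsetI, clarify)
      fix E assume gt: "(1 + 2 * \<epsilon>) * (1 + \<epsilon>) * (real n / (\<kappa> * L)) < real (improper_chromatic_number t {1..n} E)"
        and "improper_chromatic_number t {1..n} E \<le> j"
      hence "real (improper_chromatic_number t {1..n} E) \<le> y + 1" using j_le by linarith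
      also have "\<dots> \<le> (1 + 2 * \<epsilon>) * (real n * p / real t)"
      proof -
        \<comment> \<open>The hypothesis t <= \<epsilon> p n makes the number of parts so large that
          rounding it up costs only a factor in \<epsilon>.\<close>
        have "1 \<le> \<epsilon> * (real n * p / real t)" using tn tpos by (simp add: le_divide_eq mult_ac)
        moreover have "(1 + \<epsilon>) * v + 1 \<le> (1 + 2 * \<epsilon>) * v" if "1 \<le> \<epsilon> * v" for v
          using that by (simp add: algebra_simps)
        moreover have "y = (1 + \<epsilon>) * (real n * p / real t)" by (simp add: y_def)
        ultimately show ?thesis by (simp only:)
      qed
      also have "\<dots> = (1 + 2 * \<epsilon>) * ((1 + \<epsilon>) * (real n / ((1 + \<epsilon>) * (real t / p))))"
        using \<epsilon> p by simp
      also have "\<dots> \<le> (1 + 2 * \<epsilon>) * ((1 + \<epsilon>) * (real n / (\<kappa> * L)))"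
        using \<kappa>L \<kappa>pos L \<epsilon> p tpos by (intro mult_left_mono divide_left_mono) auto
      finally show False using gt by simp
    qed auto
    also have "\<dots> \<le> real n * exp (- 2 * \<delta>\<^sup>2 / (real n / real j))"
      by (rule prob_chromatic_upper_residues[OF p jpos _ \<delta> cond]) (use n in auto)
    also have "\<dots> \<le> real n * exp (- (2 * L))"
    proof -
      have "2 * L \<le> 2 * (\<epsilon>\<^sup>2 * p / (1 + \<epsilon>) * real t)"
      proof -
        have "C2 * L \<le> real t" using t' C(3) mult_right_mono[OF C(3), of L] L by linarith
        thus ?thesis using \<epsilon> p by (simp add: C2_def field_simps)
      qed
      also have "\<dots> = 2 * \<delta>\<^sup>2 / (real t / (p * (1 + \<epsilon>)))"
      proof -
        have "2 * (\<epsilon>\<^sup>2 * p / a * real t) = 2 * (real t * \<epsilon> / a)\<^sup>2 / (real t / (p * a))" if "a > 0" for a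
          using that tpos p by (simp add: power2_eq_square field_simps)
        from this[of "1 + \<epsilon>"] show ?thesis using \<epsilon> by (simp add: \<delta>_def)
      qed
      also have "\<dots> \<le> 2 * \<delta>\<^sup>2 / (real n / real j)"
        using nj n jpos tpos p \<epsilon> by (intro divide_left_mono mult_pos_pos divide_pos_pos) auto
      finally show ?thesis by (intro mult_left_mono) auto
    qed
    also have "\<dots> = 1 / real n"
    proof -
      have "exp L * exp (- (2 * L)) = exp (- L)" unfolding exp_add[symmetric] by simp
      thus ?thesis unfolding nL by (simp add: exp_minus inverse_eq_divide)
    qed
    finally show ?thesis by (simp only: \<kappa>_def \<tau>_def L_def)
  qed
  show ?thesis by (rule that[OF C(1) main])
qed

text \<open>If all sets of m = n^(1-\<epsilon>/8) vertices, rounded up, contain a dependent k-set,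
  greedy colouring needs at most n/k + m colours. Here m is at most \<epsilon> times the target, and
  rounding k down turns 1 - \<epsilon> into 1 - 2\<epsilon>.\<close>

lemma chromatic_upper_small_t:
  assumes p: "0 < p" "p < 1" and \<epsilon>: "0 < \<epsilon>" "\<epsilon> \<le> 1 / 5" and C: "C \<ge> 0"
  shows "eventually (\<lambda>n::nat. \<forall>t::nat. real t \<le> C * ln (real n) \<longrightarrow> measure_pmf.prob (gnp n p)
    {E. real (improper_chromatic_number t {1..n} E) >
       (1 / (1 - 2 * \<epsilon>) + \<epsilon>) * (real n / (kappa p (real t / ln (real n)) * ln (real n)))} \<le> 1 / real n) at_top"
proof -
  define \<gamma> where "\<gamma> = \<epsilon> / 8"
  define K where "K = kappa p C"
  have \<gamma>: "\<gamma> > 0" "\<gamma> < 1" using \<epsilon> by (auto simp: \<gamma>_def)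
  have K: "K > 0" unfolding K_def by (rule kappa_pos[OF p C])
  have \<kappa>0: "kappa p 0 > 0" by (rule kappa_0_pos[OF p])
  have "eventually (\<lambda>n::nat. 2 * K * ln n \<le> \<epsilon> * real n powr \<gamma>) at_top"
    using \<epsilon>(1) K \<gamma> by real_asymp
  \<comment> \<open>The union bound over vertex sets, which works because 3/2 > 1.\<close>
  moreover have "eventually (\<lambda>n::nat. 2 ^ n * exp (- (real n powr (3 / 2)) / 4) \<le> 1 / real n) at_top"
    by real_asymp
  moreover have "eventually (\<lambda>n::nat. 1 \<le> (\<epsilon> * kappa p 0) * ln n) at_top"
    using mult_pos_pos[OF \<epsilon>(1) \<kappa>0] by real_asymp
  ultimately show ?thesis
    using eventually_large_subset_has_dependent[OF p \<epsilon> C] eventually_ge_at_top[of 3]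
  proof eventually_elim
    case (elim n)
    define L where "L = ln (real n)"
    have L: "L > 0" using elim(5) by (simp add: L_def)
    have E1: "2 * K * L \<le> \<epsilon> * real n powr \<gamma>" and E3: "1 \<le> (\<epsilon> * kappa p 0) * L"
      using elim by (simp_all add: L_def)
    define m where "m = nat \<lceil>real n powr (1 - \<epsilon> / 8)\<rceil>"
    have m_le: "real m \<le> \<epsilon> * (real n / (K * L))"
    proof -
      have "real m \<le> real n powr (1 - \<gamma>) + 1"
        unfolding m_def \<gamma>_def using powr_ge_zero[of "real n" "1 - \<epsilon> / 8"] by linarith
      moreover have "1 \<le> real n powr (1 - \<gamma>)" using elim(5) \<gamma> by (intro ge_one_powr_ge_zero) auto
      ultimately have "real m * (K * L) \<le> (2 * real n powr (1 - \<gamma>)) * (K * L)"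
        using K L by (intro mult_right_mono) auto
      also have "\<dots> = real n powr (1 - \<gamma>) * (2 * K * L)" by simp
      also have "\<dots> \<le> real n powr (1 - \<gamma>) * (\<epsilon> * real n powr \<gamma>)"
        using E1 by (intro mult_left_mono) auto
      also have "\<dots> = \<epsilon> * real n" using elim(5) by (simp add: powr_add[symmetric])
      finally show ?thesis using K L by (simp add: le_divide_eq)
    qed
    show ?case
    proof (intro allI impI)
      fix t :: nat assume t: "real t \<le> C * ln (real n)"
      define \<tau> where "\<tau> = real t / L"
      have \<tau>: "0 \<le> \<tau>" "\<tau> \<le> C" using t L by (auto simp: \<tau>_def L_def[symmetric] field_simps)
      define \<kappa> where "\<kappa> = kappa p \<tau>"
      have \<kappa>: "kappa p 0 \<le> \<kappa>" "\<kappa> \<le> K" "\<kappa> > 0"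
        using kappa_mono[OF p _ \<tau>(1)] kappa_mono[OF p \<tau>] kappa_pos[OF p \<tau>(1)] by (auto simp: \<kappa>_def K_def)
      define k where "k = nat \<lfloor>(1 - \<epsilon>) * \<kappa> * L\<rfloor>"
      have k_ge: "real k \<ge> (1 - 2 * \<epsilon>) * (\<kappa> * L)"
      proof -
        have "(\<epsilon> * kappa p 0) * L \<le> \<epsilon> * \<kappa> * L"
          using \<kappa> \<epsilon> L by (intro mult_right_mono mult_left_mono) auto
        hence "(1 - 2 * \<epsilon>) * (\<kappa> * L) \<le> (1 - \<epsilon>) * \<kappa> * L - 1"
          using E3 by (simp add: algebra_simps)
        also have "\<dots> \<le> real k" unfolding k_def by linarith
        finally show ?thesis .
      qed
      have kpos': "(1 - 2 * \<epsilon>) * (\<kappa> * L) > 0" using \<epsilon> \<kappa> L by simp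
      hence kpos: "k > 0" using k_ge by (intro gr0I) auto
      let ?P = "measure_pmf.prob (coins (nsets {1..n} 2) p)"
      let ?bad = "\<lambda>W. {X. \<forall>A\<in>nsets W k. \<not> deg_le t (nsets A 2) A X}"
      have bad: "?P (?bad W) \<le> exp (- (real n powr (3 / 2)) / 4)" if "W \<in> nsets {1..n} m" for W
        using elim(4) t that unfolding k_def m_def \<kappa>_def \<tau>_def L_def by (auto simp: nsets_def)
      have "measure_pmf.prob (gnp n p)
          {E. real (improper_chromatic_number t {1..n} E) > (1 / (1 - 2 * \<epsilon>) + \<epsilon>) * (real n / (\<kappa> * L))} \<le>
          ?P (\<Union>W\<in>nsets {1..n} m. ?bad W)"
        unfolding prob_gnp
      proof (intro measure_pmf.finite_measure_mono subsetI)
        fix X assume "X \<in> {X. real (improper_chromatic_number t {1..n} (graph_of n X)) >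
            (1 / (1 - 2 * \<epsilon>) + \<epsilon>) * (real n / (\<kappa> * L))}"
        hence X: "real (improper_chromatic_number t {1..n} (graph_of n X)) >
            (1 / (1 - 2 * \<epsilon>) + \<epsilon>) * (real n / (\<kappa> * L))" by simp
        show "X \<in> (\<Union>W\<in>nsets {1..n} m. ?bad W)"
        proof (rule ccontr)
          assume no: "\<not> ?thesis"
          have "\<exists>A\<in>nsets W k. dependent_set t (graph_of n X) A" if W: "W \<subseteq> {1..n}" "card W = m" for W
          proof -
            have "W \<in> nsets {1..n} m" using W finite_subset[OF W(1)] by (auto simp: nsets_def)
            hence "X \<notin> ?bad W" using no by blast
            then obtain A where A: "A \<in> nsets W k" "deg_le t (nsets A 2) A X" by blast
            have "A \<subseteq> {1..n}" using A(1) W by (auto simp: nsets_def)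
            from dependent_set_iff_deg_le[OF this] A show ?thesis by blast
          qed
          then obtain j c where c: "improper_colouring t {1..n} (graph_of n X) j c" "j * k \<le> card {1..n} + m * k"
            using greedy_colouring[of "{1..n}" "graph_of n X" "{1..n}" k m t] kpos by auto
          have "real (improper_chromatic_number t {1..n} (graph_of n X)) \<le> real j"
            using improper_chromatic_number_le[OF c(1)] by simp
          also have "real j \<le> real n / real k + real m"
          proof -
            have "real (j * k) \<le> real (n + m * k)" using c(2) by (subst of_nat_le_iff) simp
            thus ?thesis using kpos by (simp add: field_simps)
          qed
          also have "real n / real k \<le> real n / ((1 - 2 * \<epsilon>) * (\<kappa> * L))"
            using k_ge kpos' kpos by (intro divide_left_mono) auto
          also have "real m \<le> \<epsilon> * (real n / (\<kappa> * L))"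
          proof -
            have "real n / (K * L) \<le> real n / (\<kappa> * L)"
              using \<kappa> L K by (intro divide_left_mono mult_right_mono) auto
            hence "\<epsilon> * (real n / (K * L)) \<le> \<epsilon> * (real n / (\<kappa> * L))"
              using \<epsilon> by (intro mult_left_mono) auto
            thus ?thesis using m_le by linarith
          qed
          also have "real n / ((1 - 2 * \<epsilon>) * (\<kappa> * L)) + \<epsilon> * (real n / (\<kappa> * L)) =
              (1 / (1 - 2 * \<epsilon>) + \<epsilon>) * (real n / (\<kappa> * L))"
          proof -
            have "real n / ((1 - 2 * \<epsilon>) * (\<kappa> * L)) = 1 / (1 - 2 * \<epsilon>) * (real n / (\<kappa> * L))" by simp
            thus ?thesis by (simp only: distrib_right)
          qed
          finally show False using X by simp
        qed
      qed auto
      also have "\<dots> \<le> (\<Sum>W\<in>nsets {1..n} m. ?P (?bad W))"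
        by (intro measure_pmf.finite_measure_subadditive_finite finite_imp_finite_nsets) auto
      also have "\<dots> \<le> (\<Sum>W\<in>nsets {1..n} m. exp (- (real n powr (3 / 2)) / 4))"
        by (intro sum_mono bad)
      also have "\<dots> = real (card (nsets {1..n} m)) * exp (- (real n powr (3 / 2)) / 4)"
        by (simp only: sum_constant)
      also have "\<dots> \<le> 2 ^ n * exp (- (real n powr (3 / 2)) / 4)"
      proof -
        have "card (nsets {1..n} m) \<le> card (Pow {1..n})"
          by (intro card_mono) (auto simp: nsets_def)
        hence "real (card (nsets {1..n} m)) \<le> real (2 ^ n)"
          unfolding of_nat_le_iff by (simp add: card_Pow)
        thus ?thesis by (intro mult_right_mono) auto
      qed
      also have "\<dots> \<le> 1 / real n" by (rule elim(2))
      finally show "measure_pmf.prob (gnp n p)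
        {E. real (improper_chromatic_number t {1..n} E) >
           (1 / (1 - 2 * \<epsilon>) + \<epsilon>) * (real n / (kappa p (real t / ln (real n)) * ln (real n)))} \<le> 1 / real n"
        by (simp only: \<kappa>_def \<tau>_def L_def)
    qed
  qed
qed

section \<open>Convergence of the ratio for sublinear t\<close>

lemma aasI:
  assumes "eventually (\<lambda>n. measure_pmf.prob (gnp n p) {E. \<not> P n E} \<le> f n) at_top" "f \<longlonglongrightarrow> 0"
  shows "aas p P"
  unfolding aas_def
proof (rule tendsto_sandwich)
  have "measure_pmf.prob (gnp n p) {E. P n E} = 1 - measure_pmf.prob (gnp n p) {E. \<not> P n E}" for n
    using measure_pmf.prob_compl[of "{E. \<not> P n E}" "gnp n p"] by (simp add: Collect_neg_eq[symmetric] Compl_eq_Diff_UNIV[symmetric])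
  thus "eventually (\<lambda>n. 1 - f n \<le> measure_pmf.prob (gnp n p) {E. P n E}) at_top"
    using assms(1) by simp
  show "(\<lambda>n. 1 - f n) \<longlonglongrightarrow> 1" using tendsto_diff[OF tendsto_const assms(2), of 1] by simp
qed (auto simp: measure_pmf.prob_le_1)

lemma chromatic_asymp_equiv:
  fixes t :: "nat \<Rightarrow> nat"
  assumes p: "0 < p" "p < 1" and t: "(\<lambda>n. real (t n)) \<in> o(\<lambda>n. real n)"
  shows "aas_asymp_equiv p
    (\<lambda>n E. real (improper_chromatic_number (t n) {1..n} E))
    (\<lambda>n. real n / (kappa p (real (t n) / ln (real n)) * ln (real n)))"
  unfolding aas_asymp_equiv_def
proof (intro allI impI)
  fix e :: real assume e: "e > 0"
  define \<epsilon> where "\<epsilon> = min (1 / 10) (e / 8)"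
  have \<epsilon>: "\<epsilon> > 0" "\<epsilon> \<le> 1 / 10" "8 * \<epsilon> \<le> e" using e by (auto simp: \<epsilon>_def)
  let ?X = "\<lambda>n E. real (improper_chromatic_number (t n) {1..n} E)"
  let ?a = "\<lambda>n. real n / (kappa p (real (t n) / ln (real n)) * ln (real n))"
  let ?P = "\<lambda>n. measure_pmf.prob (gnp n p)"
  obtain C where C: "C > 0" "\<And>(n::nat) (t::nat). n \<ge> 2 \<Longrightarrow> C * ln (real n) \<le> real t \<Longrightarrow> real t \<le> \<epsilon> * p * real n \<Longrightarrow>
    measure_pmf.prob (gnp n p)
    {E. real (improper_chromatic_number t {1..n} E) > (1 + 2 * \<epsilon>) * (1 + \<epsilon>) *
        (real n / (kappa p (real t / ln (real n)) * ln (real n)))} \<le> 1 / real n"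
    by (rule chromatic_upper_large_t[OF p \<epsilon>(1)]) blast
  have \<epsilon>5: "\<epsilon> \<le> 1 / 5" using \<epsilon> by simp
  have "\<epsilon> * p > 0" using \<epsilon> p by simp
  from landau_o.smallD[OF t this]
  have "eventually (\<lambda>n. real (t n) \<le> \<epsilon> * p * real n) at_top" by simp
  hence "eventually (\<lambda>n. ?P n {E. \<not> \<bar>?X n E / ?a n - 1\<bar> < e} \<le> 2 / real n) at_top"
    using chromatic_lower_eventually[OF p \<epsilon>(1)] chromatic_upper_small_t[OF p \<epsilon>(1) \<epsilon>5 less_imp_le[OF C(1)]]
      eventually_ge_at_top[of 3]
  proof eventually_elim
    case (elim n)
    have L: "ln (real n) > 0" using elim(4) by simp
    define \<kappa> where "\<kappa> = kappa p (real (t n) / ln (real n))"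
    have \<kappa>: "\<kappa> > 0" unfolding \<kappa>_def by (rule kappa_pos[OF p]) (use L in simp)
    define a where "a = ?a n"
    have a: "a > 0" using elim(4) L \<kappa> by (simp add: a_def \<kappa>_def)
    \<comment> \<open>Dominates the upper factors of both regimes for \<epsilon> <= 1/10 while
      staying within the tolerance \<open>e\<close>.\<close>
    define U where "U = 1 + 4 * \<epsilon>"
    have U1: "(1 + 2 * \<epsilon>) * (1 + \<epsilon>) \<le> U"
      using mult_right_mono[OF \<epsilon>(2), of \<epsilon>] \<epsilon> unfolding U_def by (simp add: algebra_simps)
    have U2: "1 / (1 - 2 * \<epsilon>) + \<epsilon> \<le> U"
    proof -
      have "(1 + 3 * \<epsilon>) * (1 - 2 * \<epsilon>) \<ge> 1"
        using mult_right_mono[OF \<epsilon>(2), of \<epsilon>] \<epsilon> by (simp add: algebra_simps)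
      hence "1 / (1 - 2 * \<epsilon>) \<le> 1 + 3 * \<epsilon>" using \<epsilon> by (simp add: divide_le_eq)
      thus ?thesis by (simp add: U_def)
    qed
    have up: "?P n {E. ?X n E > U * a} \<le> 1 / real n"
    proof (cases "C * ln (real n) \<le> real (t n)")
      case True
      have "(1 + 2 * \<epsilon>) * (1 + \<epsilon>) * a \<le> U * a" using U1 a by (intro mult_right_mono) auto
      hence "?P n {E. ?X n E > U * a} \<le> ?P n {E. ?X n E > (1 + 2 * \<epsilon>) * (1 + \<epsilon>) * a}"
        by (intro measure_pmf.finite_measure_mono) auto
      also have "\<dots> \<le> 1 / real n"
        unfolding a_def using C(2)[of n "t n"] True elim by simp
      finally show ?thesis .
    next
      case False
      have "(1 / (1 - 2 * \<epsilon>) + \<epsilon>) * a \<le> U * a" using U2 a by (intro mult_right_mono) auto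
      hence "?P n {E. ?X n E > U * a} \<le> ?P n {E. ?X n E > (1 / (1 - 2 * \<epsilon>) + \<epsilon>) * a}"
        by (intro measure_pmf.finite_measure_mono) auto
      also have "\<dots> \<le> 1 / real n"
        unfolding a_def using elim(3)[rule_format, of "t n"] False by simp
      finally show ?thesis .
    qed
    have lo: "?P n {E. ?X n E < a / (1 + 2 * \<epsilon>)} \<le> 1 / real n"
      using elim(2)[rule_format, of "t n"] unfolding a_def by (simp add: mult_ac)
    have "{E. \<not> \<bar>?X n E / ?a n - 1\<bar> < e} \<subseteq> {E. ?X n E < a / (1 + 2 * \<epsilon>)} \<union> {E. ?X n E > U * a}"
    proof (rule subsetI, rule ccontr)
      fix E assume 1: "E \<in> {E. \<not> \<bar>?X n E / ?a n - 1\<bar> < e}"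
        and "E \<notin> {E. ?X n E < a / (1 + 2 * \<epsilon>)} \<union> {E. ?X n E > U * a}"
      hence 2: "a / (1 + 2 * \<epsilon>) \<le> ?X n E" "?X n E \<le> U * a" by auto
      have "(1 - 2 * \<epsilon>) \<le> 1 / (1 + 2 * \<epsilon>)"
        using \<epsilon> by (simp add: le_divide_eq algebra_simps)
      also have "\<dots> \<le> ?X n E / a" using 2(1) a \<epsilon> by (simp add: field_simps)
      finally have "1 - 2 * \<epsilon> \<le> ?X n E / a" .
      moreover have "?X n E / a \<le> 1 + 4 * \<epsilon>" using 2(2) a by (simp add: U_def divide_le_eq)
      ultimately have "\<bar>?X n E / a - 1\<bar> < e" using \<epsilon> by linarith
      with 1 show False by (simp add: a_def)
    qed
    hence "?P n {E. \<not> \<bar>?X n E / ?a n - 1\<bar> < e} \<le> ?P n ({E. ?X n E < a / (1 + 2 * \<epsilon>)} \<union> {E. ?X n E > U * a})"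
      by (intro measure_pmf.finite_measure_mono) auto
    also have "\<dots> \<le> ?P n {E. ?X n E < a / (1 + 2 * \<epsilon>)} + ?P n {E. ?X n E > U * a}"
      by (intro measure_subadditive) auto
    also have "\<dots> \<le> 2 / real n" using up lo by simp
    finally show ?case .
  qed
  moreover have "(\<lambda>n. 2 / real n) \<longlonglongrightarrow> 0" by real_asymp
  ultimately show "aas p (\<lambda>n E. \<bar>?X n E / ?a n - 1\<bar> < e)" by (rule aasI)
qed

section \<open>Linear t: a bounded number of colours\<close>

lemma choose_le_two_pow: "real (n choose k) \<le> 2 ^ n"
proof (cases "k \<le> n")
  case True
  have "n choose k \<le> (\<Sum>i\<le>n. n choose i)" by (rule member_le_sum) (use True in auto)
  also have "\<dots> = 2 ^ n" by (rule choose_row_sum)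
  finally show ?thesis by (metis of_nat_le_iff of_nat_numeral of_nat_power)
qed (simp add: binomial_eq_0)

text \<open>With j < x colours some class has at least n/j vertices and mean degree near np/j, above
  t by a linear amount. Such a class is dependent with probability exp(-c n^2) for some c > 0, which
  beats the 2^n choices.\<close>

lemma chromatic_fixed_lower:
  fixes t :: "nat \<Rightarrow> nat"
  assumes p: "0 < p" "p < 1" and t: "(\<lambda>n. real (t n) / real n) \<longlonglongrightarrow> p / x"
    and x: "x > 0" and j: "real j < x"
  obtains f where "f \<longlonglongrightarrow> 0"
    "eventually (\<lambda>n. measure_pmf.prob (gnp n p) {E. \<not> Suc j \<le> improper_chromatic_number (t n) {1..n} E} \<le> f n) at_top"
proof (cases "j = 0")
  \<comment> \<open>There is no n/j here; class size n works instead, since no set has n + 1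
    vertices.\<close>
  case True
  have "measure_pmf.prob (gnp n p) {E. \<not> Suc j \<le> improper_chromatic_number (t n) {1..n} E} \<le> 0"
    if "n \<ge> 1" for n
  proof -
    have "measure_pmf.prob (gnp n p) {E. \<not> Suc j \<le> improper_chromatic_number (t n) {1..n} E} \<le>
        measure_pmf.prob (gnp n p) {E. \<not> n \<le> improper_chromatic_number (t n) {1..n} E * n}"
      by (intro measure_pmf.finite_measure_mono) (use True that in auto)
    also have "\<dots> \<le> 0" using prob_chromatic_lower[OF p order.refl, of n "t n" n] by (simp add: binomial_eq_0)
    finally show ?thesis .
  qed
  hence "eventually (\<lambda>n. measure_pmf.prob (gnp n p)
      {E. \<not> Suc j \<le> improper_chromatic_number (t n) {1..n} E} \<le> 0) at_top"
    by (rule eventually_at_top_linorderI)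
  thus ?thesis by (rule that[OF tendsto_const])
next
  case False
  hence jpos: "real j > 0" by simp
  have "p * real j / x < p" using p x j by (simp add: field_simps)
  \<comment> \<open>q replaces the slope p by a smaller one that a positive s achieves, still
    leaving q/j above the limit p/x of t/n.\<close>
  then obtain q where q: "p * real j / x < q" "q < p" using dense by blast
  obtain s where s: "s > 0" "q * s < cgf p s" by (rule cgf_slope_at_0[OF p q(2)])
  have qpos: "q > 0"
  proof -
    have "0 < p * real j / x" using p jpos x by simp
    thus ?thesis using q(1) by linarith
  qed
  define d where "d = s * (q / real j - p / x) / 2"
  have "p / x < q / real j" using q(1) jpos x by (simp add: field_simps)
  hence d: "d > 0" using s by (simp add: d_def)
  have "(\<lambda>n. s * (real (t n) / real n - q / real j + q / real n)) \<longlonglongrightarrow> s * (p / x - q / real j + 0)"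
    by (intro tendsto_mult tendsto_add tendsto_diff tendsto_const t) real_asymp
  also have "s * (p / x - q / real j + 0) = - 2 * d" by (simp add: d_def algebra_simps)
  finally have "eventually (\<lambda>n. s * (real (t n) / real n - q / real j + q / real n) < - d) at_top"
    by (rule order_tendstoD) (use d in auto)
  define f where "f = (\<lambda>n. 2 ^ n * exp (- (d / (2 * real j)) * (real n)\<^sup>2))"
  have "(\<lambda>n. 2 ^ n * exp (- c * (real n)\<^sup>2)) \<longlonglongrightarrow> 0" if "c > 0" for c
    using that by real_asymp
  from this[of "d / (2 * real j)"] have f: "f \<longlonglongrightarrow> 0" using d jpos by (simp add: f_def)
  from \<open>eventually (\<lambda>n. s * (real (t n) / real n - q / real j + q / real n) < - d) at_top\<close>
    eventually_gt_at_top[of 0]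
  have "eventually (\<lambda>n. measure_pmf.prob (gnp n p)
      {E. \<not> Suc j \<le> improper_chromatic_number (t n) {1..n} E} \<le> f n) at_top"
  proof eventually_elim
    case (elim n)
    \<comment> \<open>The largest integer below n/j: j classes of size at most r cannot cover n
      vertices, while r + 1 is still at least n/j.\<close>
    define r where "r = nat \<lceil>real n / real j\<rceil> - 1"
    have "real n / real j > 0" using elim(2) jpos by simp
    hence "\<lceil>real n / real j\<rceil> \<ge> 1" by linarith
    hence r: "real (Suc r) \<ge> real n / real j" "real r < real n / real j"
      unfolding r_def by linarith+
    have "measure_pmf.prob (gnp n p) {E. \<not> Suc j \<le> improper_chromatic_number (t n) {1..n} E} \<le>
        measure_pmf.prob (gnp n p) {E. \<not> n \<le> improper_chromatic_number (t n) {1..n} E * r}"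
    proof (intro measure_pmf.finite_measure_mono subsetI, clarify)
      fix E assume 1: "\<not> Suc j \<le> improper_chromatic_number (t n) {1..n} E"
        and "n \<le> improper_chromatic_number (t n) {1..n} E * r"
      note this(2)
      also have "improper_chromatic_number (t n) {1..n} E * r \<le> j * r"
        using 1 by (intro mult_le_mono1) auto
      finally have "real n \<le> real (j * r)" by (subst of_nat_le_iff)
      thus False using r(2) jpos by (simp add: field_simps)
    qed auto
    also have "\<dots> \<le> real (n choose Suc r) * exp (real (Suc r) / 2 * (s * real (t n) - real r * cgf p s))"
      using s by (intro prob_chromatic_lower[OF p]) auto
    also have "\<dots> \<le> 2 ^ n * exp (real (Suc r) / 2 * (- d * real n))"
    proof (intro mult_mono choose_le_two_pow)
      have "real r * (q * s) \<le> real r * cgf p s" using s by (intro mult_left_mono) auto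
      moreover have "(real n / real j - 1) * (q * s) \<le> real r * (q * s)"
        using r qpos s by (intro mult_right_mono) auto
      ultimately have "s * real (t n) - real r * cgf p s \<le> s * real (t n) - (real n / real j - 1) * (q * s)"
        by linarith
      also have "\<dots> = s * (real (t n) / real n - q / real j + q / real n) * real n"
        using elim(2) by (simp add: algebra_simps)
      also have "\<dots> \<le> - d * real n" using elim by (intro mult_right_mono) auto
      finally show "exp (real (Suc r) / 2 * (s * real (t n) - real r * cgf p s)) \<le>
          exp (real (Suc r) / 2 * (- d * real n))"
        unfolding exp_le_cancel_iff by (intro mult_left_mono) auto
    qed auto
    also have "\<dots> \<le> f n"
      unfolding f_def
    proof (rule mult_left_mono)
      have "(real n / real j) / 2 * (d * real n) \<le> real (Suc r) / 2 * (d * real n)"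
        using r(1) d by (intro mult_right_mono divide_right_mono) auto
      moreover have "(real n / real j) / 2 * (d * real n) = d / (2 * real j) * (real n)\<^sup>2"
        by (simp add: power2_eq_square mult_ac)
      ultimately show "exp (real (Suc r) / 2 * (- d * real n)) \<le> exp (- (d / (2 * real j)) * (real n)\<^sup>2)"
        unfolding exp_le_cancel_iff by linarith
    qed simp
    finally show ?case .
  qed
  with f show ?thesis by (rule that)
qed

text \<open>With j > x residue classes the mean degrees, at most np/j, lie below t by a linear
  margin.\<close>

lemma chromatic_fixed_upper:
  fixes t :: "nat \<Rightarrow> nat"
  assumes p: "0 < p" "p < 1" and t: "(\<lambda>n. real (t n) / real n) \<longlonglongrightarrow> p / x"
    and x: "x > 0" and j: "x < real j"
  obtains f where "f \<longlonglongrightarrow> 0"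
    "eventually (\<lambda>n. measure_pmf.prob (gnp n p) {E. \<not> improper_chromatic_number (t n) {1..n} E \<le> j} \<le> f n) at_top"
proof -
  have jpos: "real j > 0" using x j by linarith
  \<comment> \<open>Half of the limiting gap goes to Hoeffding's inequality, the other half absorbs
    the convergence of t/n.\<close>
  define d where "d = (p / x - p / real j) / 2"
  have "p / real j < p / x" using p x j by (intro divide_strict_left_mono) auto
  moreover have "0 < (v - u) / 2" "u + (v - u) / 2 < v" if "u < v" for u v :: real
    using that by (simp_all add: field_simps)
  ultimately have d: "d > 0" "p / real j + d < p / x" unfolding d_def by blast+
  define f where "f = (\<lambda>n. real n * exp (- (2 * d\<^sup>2 * real j) * real n))"
  have "(\<lambda>n. real n * exp (- c * real n)) \<longlonglongrightarrow> 0" if "c > 0" for c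
    using that by real_asymp
  from this[of "2 * d\<^sup>2 * real j"] have f: "f \<longlonglongrightarrow> 0" using d jpos by (simp add: f_def)
  from order_tendstoD(1)[OF t d(2)] eventually_gt_at_top[of 0]
  have "eventually (\<lambda>n. measure_pmf.prob (gnp n p)
      {E. \<not> improper_chromatic_number (t n) {1..n} E \<le> j} \<le> f n) at_top"
  proof eventually_elim
    case (elim n)
    have "real n / real j * p + d * real n \<le> real (t n)"
      using elim by (simp add: less_divide_eq algebra_simps)
    hence "measure_pmf.prob (gnp n p) {E. \<not> improper_chromatic_number (t n) {1..n} E \<le> j} \<le>
        real n * exp (- 2 * (d * real n)\<^sup>2 / (real n / real j))"
      using elim d jpos by (intro prob_chromatic_upper_residues[OF p]) auto
    also have "- 2 * (d * real n)\<^sup>2 / (real n / real j) = - (2 * d\<^sup>2 * real j) * real n"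
      using elim(2) jpos by (simp add: power2_eq_square field_simps)
    finally show ?case by (simp add: f_def)
  qed
  with f show ?thesis by (rule that)
qed

lemma chromatic_linear_t:
  fixes t :: "nat \<Rightarrow> nat"
  assumes p: "0 < p" "p < 1" and x: "x > 0" "x \<notin> \<int>"
    and t: "(\<lambda>n. real (t n)) \<sim>[at_top] (\<lambda>n. real n * p / x)"
  shows "aas p (\<lambda>n E. int (improper_chromatic_number (t n) {1..n} E) = \<lceil>x\<rceil>)"
proof -
  have lim: "(\<lambda>n. real (t n) / real n) \<longlonglongrightarrow> p / x"
  proof -
    have nz: "eventually (\<lambda>n. real n * p / x \<noteq> 0) at_top"
      using eventually_gt_at_top[of 0] by eventually_elim (use p x in auto)
    have "(\<lambda>n. real (t n) / (real n * p / x)) \<longlonglongrightarrow> 1"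
      by (rule asymp_equivD_strong[OF t]) (use nz in eventually_elim, auto)
    from tendsto_mult_right[OF this, of "p / x"]
    have "(\<lambda>n. real (t n) / (real n * p / x) * (p / x)) \<longlonglongrightarrow> p / x" by simp
    moreover have "real (t n) / (real n * p / x) * (p / x) = real (t n) / real n" for n
      using p x by simp
    ultimately show ?thesis by simp
  qed
  define j where "j = nat \<lfloor>x\<rfloor>"
  \<comment> \<open>Non-integrality makes both inequalities around x strict, so each side has a
    linear margin in the degrees.\<close>
  have fl: "of_int \<lfloor>x\<rfloor> \<noteq> x" using x(2) by (metis Ints_of_int)
  have "real j = of_int \<lfloor>x\<rfloor>" using x(1) by (simp add: j_def)
  hence j: "real j < x" "x < real (Suc j)" using fl by linarith+
  have ceil: "\<lceil>x\<rceil> = int (Suc j)" using j by (intro ceiling_unique) auto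
  obtain f where f: "f \<longlonglongrightarrow> 0" "eventually (\<lambda>n. measure_pmf.prob (gnp n p)
      {E. \<not> Suc j \<le> improper_chromatic_number (t n) {1..n} E} \<le> f n) at_top"
    by (rule chromatic_fixed_lower[OF p lim x(1) j(1)])
  obtain g where g: "g \<longlonglongrightarrow> 0" "eventually (\<lambda>n. measure_pmf.prob (gnp n p)
      {E. \<not> improper_chromatic_number (t n) {1..n} E \<le> Suc j} \<le> g n) at_top"
    by (rule chromatic_fixed_upper[OF p lim x(1) j(2)])
  have "eventually (\<lambda>n. measure_pmf.prob (gnp n p)
      {E. \<not> int (improper_chromatic_number (t n) {1..n} E) = \<lceil>x\<rceil>} \<le> f n + g n) at_top"
    using f(2) g(2)
  proof eventually_elim
    case (elim n)
    let ?\<chi> = "improper_chromatic_number (t n) {1..n}"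
    have "measure_pmf.prob (gnp n p) {E. \<not> int (?\<chi> E) = \<lceil>x\<rceil>} \<le>
        measure_pmf.prob (gnp n p) ({E. \<not> Suc j \<le> ?\<chi> E} \<union> {E. \<not> ?\<chi> E \<le> Suc j})"
      unfolding ceil by (intro measure_pmf.finite_measure_mono) auto
    also have "\<dots> \<le> measure_pmf.prob (gnp n p) {E. \<not> Suc j \<le> ?\<chi> E} +
        measure_pmf.prob (gnp n p) {E. \<not> ?\<chi> E \<le> Suc j}"
      by (intro measure_subadditive) auto
    also have "\<dots> \<le> f n + g n" using elim by (rule add_mono)
    finally show ?case .
  qed
  moreover have "(\<lambda>n. f n + g n) \<longlonglongrightarrow> 0" using tendsto_add[OF f(1) g(1)] by simp
  ultimately show ?thesis by (rule aasI)
qed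

theorem theorem2:
  fixes p b :: real
  assumes "0 < p" and "p < 1" and "b = 1 / (1 - p)"
  shows
    "(\<exists>\<kappa> :: real \<Rightarrow> real.
        continuous_on {0..} \<kappa> \<and> strict_mono_on {0..} \<kappa> \<and>
        \<kappa> 0 = 2 / ln b \<and> \<kappa> \<sim>[at_top] (\<lambda>\<tau>. \<tau> / p) \<and>
        (\<forall>t :: nat \<Rightarrow> nat. (\<lambda>n. real (t n)) \<in> o(\<lambda>n. real n) \<longrightarrow>
           aas_asymp_equiv p
             (\<lambda>n E. real (improper_chromatic_number (t n) {1..n} E))
             (\<lambda>n. real n / (\<kappa> (real (t n) / ln (real n)) * ln (real n))))) \<and>
     (\<forall>(t :: nat \<Rightarrow> nat) (x :: real).
        x > 0 \<longrightarrow> x \<notin> \<int> \<longrightarrow> (\<lambda>n. real (t n)) \<sim>[at_top] (\<lambda>n. real n * p / x) \<longrightarrow>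
        aas p (\<lambda>n E. int (improper_chromatic_number (t n) {1..n} E) = \<lceil>x\<rceil>))"
proof (intro conjI allI impI exI[of _ "kappa p"])
  note p = assms(1,2)
  show "continuous_on {0..} (kappa p)" by (rule continuous_kappa[OF p])
  show "strict_mono_on {0..} (kappa p)" by (rule strict_mono_kappa[OF p])
  show "kappa p 0 = 2 / ln b" using kappa_0[OF p] assms by (simp add: ln_div)
  show "kappa p \<sim>[at_top] (\<lambda>\<tau>. \<tau> / p)" by (rule kappa_asymp_equiv[OF p])
qed (use chromatic_asymp_equiv chromatic_linear_t assms in auto)

end
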